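(* Let $G$ be a finitely generated non-cyclic free group. For every $h\in\mathbb{R}$, $$\sup_{G\curvearrowright(X,\mu)}\Delta^*_G(X,\mu)=\sup_{G\curvearrowright(X,\mu)}\Delta_G(X,\mu)=+\infty,$$ where the suprema are taken over all essentially free ergodic probability measure preserving actions $G\curvearrowright(X,\mu)$ for which the f-invariant entropy $f_G(X,\mu)$ is defined and $f_G(X,\mu)=h$.
   Context: Partitions of $X$ are partitions into measurable sets. For a partition $\alpha$ of $X$, $G\cdot\alpha$ denotes the smallest $\sigma$-algebra containing all the sets $g\cdot A$ for $g\in G$ and $A\in\alpha$. The partition $\alpha$ is generating if for every measurable set $B\subseteq X$ there is some $B'\in G\cdot\alpha$ with $\mu(B\triangle B')=0$. The Shannon entropy of a partition $\alpha$ is $\mathrm{H}(\alpha)=\sum_{A\in\alpha^*}-\mu(A)\log(\mu(A))$ (with $0\log 0=0$) if there is a countable subcollection $\alpha^*\subseteq\alpha$ with $\mu(\bigcup\alpha^* )=1$, and $\mathrm{H}(\alpha)=\infty$ otherwise. $\Delta^*_G(X,\mu)$ denotes the infimum of the Shannon entropies of the generating partitions of $G\curvearrowright(X,\mu)$ ($+\infty$ if there are none). $\Delta_G(X,\mu)$ denotes the smallest number of classes of a finite generating partition ($+\infty$ if there are none). An action is essentially free if for almost every $x\in X$ the stabilizer of $x$ in $G$ is trivial. f-invariant entropy (L. Bowen): let $G$ be a free group of finite rank $r$ with free generating set $\{s_1,\dots,s_r\}$, acting by measure preserving bijections on a probability space $(X,\mu)$. For a countable partition $\alpha$ with $\mathrm{H}(\alpha)<\infty$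 put $$F(\alpha)=(1-2r)\,\mathrm{H}(\alpha)+\sum_{i=1}^r\mathrm{H}(\alpha\vee s_i\cdot\alpha),\qquad f(\alpha)=\inf_{n\ge 0}F\Big(\bigvee_{g\in B(n)}g\cdot\alpha\Big),$$ where $B(n)$ is the ball of radius $n$ about the identity in $G$ for the word length with respect to $\{s_1^{\pm1},\dots,s_r^{\pm1}\}$, and $\vee$ denotes common refinement. The quantity $f_G(X,\mu)$ is defined exactly when the action admits a generating partition with finite Shannon entropy, and then $f_G(X,\mu)=f(\alpha)\in\mathbb{R}\cup\{-\infty\}$ for any such generating partition $\alpha$; by a theorem of Bowen this does not depend on the choice of $\alpha$ or of the free generating set. *)

theory Defs
  imports "HOL-Probability.Probability" "HOL-Algebra.Algebra"
begin

section \<open>Free groups\<close>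

text \<open>The letter \<open>(s, True)\<close> stands for \<open>s\<close> and \<open>(s, False)\<close> for its inverse.\<close>

definition word_val :: "'g monoid \<Rightarrow> ('g \<times> bool) list \<Rightarrow> 'g" where
  "word_val G w =
     foldr (\<lambda>(s, b) x. (if b then s else inv\<^bsub>G\<^esub> s) \<otimes>\<^bsub>G\<^esub> x) w \<one>\<^bsub>G\<^esub>"

definition reduced :: "('g \<times> bool) list \<Rightarrow> bool" where
  "reduced w \<longleftrightarrow> successively (\<lambda>(s, b) (t, c). \<not> (s = t \<and> b \<noteq> c)) w"

definition free_generating_set :: "'g monoid \<Rightarrow> 'g set \<Rightarrow> bool" where
  "free_generating_set G S \<longleftrightarrow>
     S \<subseteq> carrier G \<and> bij_betw (word_val G) {w \<in> lists (S \<times> UNIV). reduced w} (carrier G)"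

definition word_ball :: "'g monoid \<Rightarrow> 'g set \<Rightarrow> nat \<Rightarrow> 'g set" where
  "word_ball G S n = word_val G ` {w \<in> lists (S \<times> UNIV). length w \<le> n}"

section \<open>Probability measure preserving actions\<close>

text \<open>Every standard Borel space is isomorphic to a Borel subset of an uncountable Polish space,
  so letting the carrier range over the Borel subsets of a fixed such type loses no generality.\<close>

definition standard_probability_space :: "'x::polish_space measure \<Rightarrow> bool" where
  "standard_probability_space M \<longleftrightarrow>
     prob_space M \<and> space M \<in> sets borel \<and> sets M = sets (restrict_space borel (space M))"

definition pmp_action :: "'g monoid \<Rightarrow> 'x measure \<Rightarrow> ('g \<Rightarrow> 'x \<Rightarrow> 'x) \<Rightarrow> bool" where
  "pmp_action G M \<phi> \<longleftrightarrow>
     prob_space M \<and> group_action G (space M) \<phi> \<and>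
     (\<forall>g\<in>carrier G. \<phi> g \<in> measurable M M \<and> distr M M (\<phi> g) = M)"

definition ergodic_action :: "'g monoid \<Rightarrow> 'x measure \<Rightarrow> ('g \<Rightarrow> 'x \<Rightarrow> 'x) \<Rightarrow> bool" where
  "ergodic_action G M \<phi> \<longleftrightarrow>
     (\<forall>A\<in>sets M. (\<forall>g\<in>carrier G. \<phi> g ` A = A) \<longrightarrow> measure M A = 0 \<or> measure M A = 1)"

definition essentially_free :: "'g monoid \<Rightarrow> 'x measure \<Rightarrow> ('g \<Rightarrow> 'x \<Rightarrow> 'x) \<Rightarrow> bool" where
  "essentially_free G M \<phi> \<longleftrightarrow> (AE x in M. stabilizer G \<phi> x = {\<one>\<^bsub>G\<^esub>})"

section \<open>Generating partitions and Shannon entropy\<close>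

definition measurable_partition :: "'x measure \<Rightarrow> 'x set set \<Rightarrow> bool" where
  "measurable_partition M \<alpha> \<longleftrightarrow> partition_on (space M) \<alpha> \<and> \<alpha> \<subseteq> sets M"

definition translate_partition :: "('g \<Rightarrow> 'x \<Rightarrow> 'x) \<Rightarrow> 'g \<Rightarrow> 'x set set \<Rightarrow> 'x set set" where
  "translate_partition \<phi> g \<alpha> = (\<lambda>A. \<phi> g ` A) ` \<alpha>"

definition generated_algebra ::
    "'g monoid \<Rightarrow> 'x measure \<Rightarrow> ('g \<Rightarrow> 'x \<Rightarrow> 'x) \<Rightarrow> 'x set set \<Rightarrow> 'x set set" where
  "generated_algebra G M \<phi> \<alpha> =
     sigma_sets (space M) (\<Union>g\<in>carrier G. translate_partition \<phi> g \<alpha>)"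

definition generating_partition ::
    "'g monoid \<Rightarrow> 'x measure \<Rightarrow> ('g \<Rightarrow> 'x \<Rightarrow> 'x) \<Rightarrow> 'x set set \<Rightarrow> bool" where
  "generating_partition G M \<phi> \<alpha> \<longleftrightarrow>
     measurable_partition M \<alpha> \<and>
     (\<forall>B\<in>sets M. \<exists>B'\<in>generated_algebra G M \<phi> \<alpha>. measure M (sym_diff B B') = 0)"

text \<open>The classes outside a countable subcollection of full measure are null and contribute
  \<open>0\<close> (recall \<open>ln 0 = 0\<close>), so the sum may be taken over all of \<open>\<alpha>\<close>.\<close>

definition shannon_entropy :: "'x measure \<Rightarrow> 'x set set \<Rightarrow> ennreal" where
  "shannon_entropy M \<alpha> =
     (if \<exists>\<beta>\<subseteq>\<alpha>. countable \<beta> \<and> measure M (\<Union>\<beta>) = 1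
      then \<Sum>\<^sub>\<infinity>A\<in>\<alpha>. ennreal (- (measure M A * ln (measure M A)))
      else \<infinity>)"

text \<open>In both infima below, the infimum of the empty set is \<open>\<infinity>\<close>.\<close>

definition Delta_star :: "'g monoid \<Rightarrow> 'x measure \<Rightarrow> ('g \<Rightarrow> 'x \<Rightarrow> 'x) \<Rightarrow> ennreal" where
  "Delta_star G M \<phi> = (INF \<alpha>\<in>{\<alpha>. generating_partition G M \<phi> \<alpha>}. shannon_entropy M \<alpha>)"

definition Delta :: "'g monoid \<Rightarrow> 'x measure \<Rightarrow> ('g \<Rightarrow> 'x \<Rightarrow> 'x) \<Rightarrow> enat" where
  "Delta G M \<phi> =
     (INF \<alpha>\<in>{\<alpha>. generating_partition G M \<phi> \<alpha> \<and> finite \<alpha>}. enat (card \<alpha>))"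

section \<open>The f-invariant entropy\<close>

text \<open>The next two definitions are used for a finite free generating set \<open>S\<close> and a countable
  measurable partition of finite Shannon entropy only; all entropies involved are then finite.\<close>

definition F_entropy ::
    "'g set \<Rightarrow> 'x measure \<Rightarrow> ('g \<Rightarrow> 'x \<Rightarrow> 'x) \<Rightarrow> 'x set set \<Rightarrow> ereal" where
  "F_entropy S M \<phi> \<alpha> =
     ereal (1 - 2 * real (card S)) * enn2ereal (shannon_entropy M \<alpha>) +
     (\<Sum>s\<in>S. enn2ereal (shannon_entropy M (common_refinement {\<alpha>, translate_partition \<phi> s \<alpha>})))"

definition f_partition ::
    "'g monoid \<Rightarrow> 'g set \<Rightarrow> 'x measure \<Rightarrow> ('g \<Rightarrow> 'x \<Rightarrow> 'x) \<Rightarrow> 'x set set \<Rightarrow> ereal" where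
  "f_partition G S M \<phi> \<alpha> =
     (INF n. F_entropy S M \<phi>
        (common_refinement ((\<lambda>g. translate_partition \<phi> g \<alpha>) ` word_ball G S n)))"

definition f_defined :: "'g monoid \<Rightarrow> 'x measure \<Rightarrow> ('g \<Rightarrow> 'x \<Rightarrow> 'x) \<Rightarrow> bool" where
  "f_defined G M \<phi> \<longleftrightarrow> (\<exists>\<alpha>. generating_partition G M \<phi> \<alpha> \<and> shannon_entropy M \<alpha> < \<infinity>)"

text \<open>By Bowen's theorem, if \<open>f_defined\<close> holds then all countable generating partitions of finite
  Shannon entropy have the same \<open>f_partition\<close> value, which is the value described here. Such
  partitions then exist, since null classes can be merged into another class.\<close>

definition f_invariant_entropy ::
    "'g monoid \<Rightarrow> 'g set \<Rightarrow> 'x measure \<Rightarrow> ('g \<Rightarrow> 'x \<Rightarrow> 'x) \<Rightarrow> ereal" where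
  "f_invariant_entropy G S M \<phi> =
     (THE v. \<forall>\<alpha>. generating_partition G M \<phi> \<alpha> \<and> countable \<alpha> \<and> shannon_entropy M \<alpha> < \<infinity>
        \<longrightarrow> f_partition G S M \<phi> \<alpha> = v)"

definition free_ergodic_actions_of_f_entropy ::
    "'g monoid \<Rightarrow> 'g set \<Rightarrow> real \<Rightarrow> ('x::polish_space measure \<times> ('g \<Rightarrow> 'x \<Rightarrow> 'x)) set" where
  "free_ergodic_actions_of_f_entropy G S h =
     {(M, \<phi>). standard_probability_space M \<and> pmp_action G M \<phi> \<and>
        essentially_free G M \<phi> \<and> ergodic_action G M \<phi> \<and>
        f_defined G M \<phi> \<and> f_invariant_entropy G S M \<phi> = ereal h}"

end

theory Submission
  imports Defs "HOL-Real_Asymp.Real_Asymp"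
begin

text \<open>
  The actions are products of a Bernoulli shift over \<open>G\<close> with base entropy \<open>H\<^sub>0\<close> and the transitive action
  of \<open>G\<close> on \<open>\<int>/N\<close> in which every generator acts as \<open>+1\<close>. With \<open>r\<close> generators such a product has f-invariant
  \<open>H\<^sub>0 + (1 - r) ln N\<close>, so any \<open>h\<close> is attained with \<open>H\<^sub>0 = h + (r - 1) ln N\<close>, which tends to infinity with \<open>N\<close>.

  Everything rests on the estimate \<open>F(\<sigma> \<or> \<tau>) \<le> F(\<sigma>) + H(\<tau> | \<sigma> \<or> t\<sigma>)\<close> for \<open>t \<in> S\<^sup>\<plusminus>\<close>, a consequence of the
  submodularity of Shannon entropy. It shows that \<open>F\<close> does not increase when a partition is joined with
  translates along the Cayley tree, and hence, for generating \<open>\<alpha>\<close> and \<open>\<beta>\<close>, that \<open>f(\<beta>) \<le> F(\<alpha>)\<close>: join a large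
  ball of translates of \<open>\<alpha>\<close> with \<open>\<beta>\<close>, then with large balls of translates of \<open>\<beta>\<close>, and finally drop \<open>\<alpha>\<close>.

  If \<open>\<xi>\<close> is the partition into the \<open>N\<close> phases and \<open>\<alpha>\<close> is generating, then
  \<open>h = f(\<alpha> \<or> \<xi>) \<le> F(\<alpha> \<or> \<xi>) \<le> H(\<alpha>) + (1 - r) ln N\<close>, because \<open>\<xi>\<close> is invariant. Thus \<open>H(\<alpha>) \<ge> H\<^sub>0\<close>.
\<close>

text \<open>The inequalities f(\<alpha>) \<le> F(\<alpha>) \<le> H(\<alpha>) alone bound H(\<alpha>)
  below only by h. The gain comes from the invariant finite factor: translation does not refine it,
  so its entropy ln N enters F with the total coefficient (1 - 2r) + r = 1 - r, which is negative
  because a non-cyclic free group has r \<ge> 2. A large N thus lowers f by (r - 1) ln N without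
  making the colours of the Bernoulli factor any cheaper to encode. Essential freeness comes from
  the colours; transitivity on the phases keeps the product ergodic. Two points shape the formal
  route. The value of f is a definite description over all countable generating partitions, so its
  independence of the partition has to be established; and the infimum of entropies runs over
  arbitrary generating partitions, possibly with uncountably many classes. Partitions are handled as
  discrete random variables, so that a join is a pair and a refinement is a functional
  dependence.\<close>

no_notation var (\<open>X\<index>\<close>)

section \<open>Entropy of discrete random variables\<close>

definition discrete_var :: "'a measure \<Rightarrow> ('a \<Rightarrow> 'c) \<Rightarrow> bool" where
  "discrete_var M X \<longleftrightarrow> countable (X ` space M) \<and> (\<forall>c. {x \<in> space M. X x = c} \<in> sets M)"

definition fiber_prob :: "'a measure \<Rightarrow> ('a \<Rightarrow> 'c) \<Rightarrow> 'c \<Rightarrow> real" where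
  "fiber_prob M X c = measure M {x \<in> space M. X x = c}"

definition info :: "'a measure \<Rightarrow> ('a \<Rightarrow> 'c) \<Rightarrow> 'a \<Rightarrow> ennreal" where
  "info M X x = ennreal (- ln (fiber_prob M X (X x)))"

text \<open>An integral of the information function rather than a sum over values: inequalities
  between entropies then follow from pointwise inequalities almost everywhere.\<close>

definition ent :: "'a measure \<Rightarrow> ('a \<Rightarrow> 'c) \<Rightarrow> ennreal" where
  "ent M X = (\<integral>\<^sup>+x. info M X x \<partial>M)"

text \<open>Refinement of partitions, expressed through variables with values in arbitrary types;
  the first variable is the finer one. The dependence holds at every point of the space, so no null
  sets have to be carried along.\<close>

definition determines :: "'a measure \<Rightarrow> ('a \<Rightarrow> 'c) \<Rightarrow> ('a \<Rightarrow> 'd) \<Rightarrow> bool" where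
  "determines M Y X \<longleftrightarrow> (\<forall>x\<in>space M. \<forall>y\<in>space M. Y x = Y y \<longrightarrow> X x = X y)"

lemma determinesI:
  assumes "\<And>x y. x \<in> space M \<Longrightarrow> y \<in> space M \<Longrightarrow> Y x = Y y \<Longrightarrow> X x = X y"
  shows "determines M Y X"
  using assms unfolding determines_def by blast

lemma determinesD:
  "determines M Y X \<Longrightarrow> x \<in> space M \<Longrightarrow> y \<in> space M \<Longrightarrow> Y x = Y y \<Longrightarrow> X x = X y"
  unfolding determines_def by blast

lemma determines_trans: "determines M Y X \<Longrightarrow> determines M Z Y \<Longrightarrow> determines M Z X"
  unfolding determines_def by blast

lemma determines_factor:
  assumes "determines M Y X"
  obtains f where "\<And>x. x \<in> space M \<Longrightarrow> X x = f (Y x)"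
proof
  fix x assume x: "x \<in> space M"
  then have "inv_into (space M) Y (Y x) \<in> space M" "Y (inv_into (space M) Y (Y x)) = Y x"
    by (auto intro!: inv_into_into f_inv_into_f)
  then show "X x = (\<lambda>c. X (inv_into (space M) Y c)) (Y x)"
    using assms x unfolding determines_def by metis
qed

lemma discrete_var_Collect:
  assumes "discrete_var M X"
  shows "{x \<in> space M. P (X x)} \<in> sets M"
proof -
  have "{x \<in> space M. P (X x)} = (\<Union>c\<in>{c \<in> X ` space M. P c}. {x \<in> space M. X x = c})"
    by auto
  also have "\<dots> \<in> sets M"
    using assms by (intro sets.countable_UN'') (auto simp: discrete_var_def)
  finally show ?thesis .
qed

lemma discrete_var_measurable:
  assumes "discrete_var M X" "\<And>c. f c \<in> space N"
  shows "(\<lambda>x. f (X x)) \<in> measurable M N"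
proof (rule measurableI)
  fix A assume "A \<in> sets N"
  have "(\<lambda>x. f (X x)) -` A \<inter> space M = {x \<in> space M. f (X x) \<in> A}" by auto
  then show "(\<lambda>x. f (X x)) -` A \<inter> space M \<in> sets M"
    using discrete_var_Collect[OF assms(1), of "\<lambda>c. f c \<in> A"] by simp
qed (use assms in auto)

lemma discrete_var_determined:
  assumes "discrete_var M Y" "determines M Y X"
  shows "discrete_var M X"
proof -
  obtain f where f: "\<And>x. x \<in> space M \<Longrightarrow> X x = f (Y x)"
    using determines_factor[OF assms(2)] by blast
  have "X ` space M = f ` Y ` space M" using f by (auto simp: image_image)
  moreover have "{x \<in> space M. X x = c} = {x \<in> space M. f (Y x) = c}" for c using f by auto
  ultimately show ?thesis
    using assms(1) discrete_var_Collect[OF assms(1), of "\<lambda>y. f y = _"]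
    by (simp add: discrete_var_def)
qed

lemma discrete_var_Pair:
  assumes "discrete_var M X" "discrete_var M Y"
  shows "discrete_var M (\<lambda>x. (X x, Y x))"
proof -
  have "(\<lambda>x. (X x, Y x)) ` space M \<subseteq> X ` space M \<times> Y ` space M" by auto
  then have "countable ((\<lambda>x. (X x, Y x)) ` space M)"
    using assms by (meson countable_SIGMA countable_subset discrete_var_def)
  moreover have "{x \<in> space M. (X x, Y x) = c} =
      {x \<in> space M. X x = fst c} \<inter> {x \<in> space M. Y x = snd c}" for c
    by (cases c) auto
  ultimately show ?thesis using assms by (auto simp: discrete_var_def)
qed

lemma nn_integral_discrete_var:
  fixes f :: "'c \<Rightarrow> ennreal"
  assumes X: "discrete_var M X"
  shows "(\<integral>\<^sup>+x. f (X x) \<partial>M) =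
    (\<integral>\<^sup>+c. f c * emeasure M {x \<in> space M. X x = c} \<partial>count_space UNIV)"
proof -
  let ?R = "X ` space M"
  have [measurable]: "{x \<in> space M. X x = c} \<in> sets M" for c
    using X by (auto simp: discrete_var_def)
  have "f (X x) = (\<integral>\<^sup>+c. f c * indicator {x \<in> space M. X x = c} x \<partial>count_space ?R)"
    if "x \<in> space M" for x
  proof -
    have "(\<integral>\<^sup>+c. f c * indicator {x \<in> space M. X x = c} x \<partial>count_space ?R) =
       (\<integral>\<^sup>+c. f (X x) * indicator {X x} c \<partial>count_space ?R)"
      using that by (intro nn_integral_cong) (auto split: split_indicator)
    also have "\<dots> = f (X x)" using that by (simp add: nn_integral_cmult)
    finally show ?thesis by simp
  qed
  then have "(\<integral>\<^sup>+x. f (X x) \<partial>M) =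
      (\<integral>\<^sup>+x. \<integral>\<^sup>+c. f c * indicator {x \<in> space M. X x = c} x \<partial>count_space ?R \<partial>M)"
    by (intro nn_integral_cong) auto
  also have "\<dots> = (\<integral>\<^sup>+c. \<integral>\<^sup>+x. f c * indicator {x \<in> space M. X x = c} x \<partial>M \<partial>count_space ?R)"
    using X by (intro nn_integral_count_space_nn_integral) (auto simp: discrete_var_def)
  also have "\<dots> = (\<integral>\<^sup>+c. f c * emeasure M {x \<in> space M. X x = c} \<partial>count_space ?R)"
    by (intro nn_integral_cong) (simp add: nn_integral_cmult)
  also have "\<dots> = (\<integral>\<^sup>+c. f c * emeasure M {x \<in> space M. X x = c} \<partial>count_space UNIV)"
  proof (intro nn_integral_count_space_eq)
    fix c assume "c \<in> UNIV - ?R"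
    then have empty: "{x \<in> space M. X x = c} = {}" by auto
    show "f c * emeasure M {x \<in> space M. X x = c} = 0" unfolding empty by simp
  qed simp
  finally show ?thesis .
qed

lemma fiber_prob_nonneg [simp]: "fiber_prob M X c \<ge> 0"
  by (simp add: fiber_prob_def)

context prob_space
begin

lemma fiber_prob_le_1 [simp]: "fiber_prob M X c \<le> 1"
  by (simp add: fiber_prob_def)

lemma neg_ln_fiber_prob_nonneg [simp]: "ln (fiber_prob M X c) \<le> 0"
  by (cases "fiber_prob M X c = 0") (auto simp: less_le)

lemma AE_fiber_prob_pos:
  assumes "discrete_var M X"
  shows "AE x in M. fiber_prob M X (X x) > 0"
proof -
  have "AE x in M. \<forall>c\<in>{c \<in> X ` space M. fiber_prob M X c = 0}. x \<notin> {x \<in> space M. X x = c}"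
    using assms by (intro AE_ball_countable' AE_not_in)
      (auto simp: discrete_var_def fiber_prob_def null_sets_def emeasure_eq_measure)
  then show ?thesis
    using AE_space by eventually_elim (metis (mono_tags, lifting) fiber_prob_nonneg image_eqI
      linorder_not_less mem_Collect_eq order_antisym_conv)
qed

lemma fiber_prob_determines_mono:
  assumes "determines M Y X" "discrete_var M X" "x \<in> space M"
  shows "fiber_prob M Y (Y x) \<le> fiber_prob M X (X x)"
  using assms determinesD[OF assms(1)] unfolding fiber_prob_def discrete_var_def
  by (intro finite_measure_mono subsetI) blast+

lemma measurable_info [measurable]:
  assumes "discrete_var M X"
  shows "info M X \<in> borel_measurable M"
  unfolding info_def using discrete_var_measurable[OF assms, of "\<lambda>c. ennreal (- ln (fiber_prob M X c))" borel] by simp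

text \<open>Finer fibers are smaller, so the information grows pointwise. A null fiber is an
  exception, since \<open>ln 0 = 0\<close> makes its information vanish; hence the restriction to
  almost every point.\<close>

lemma ent_determines_mono:
  assumes "discrete_var M Y" "determines M Y X"
  shows "ent M X \<le> ent M Y"
  unfolding ent_def info_def
proof (intro nn_integral_mono_AE)
  show "AE x in M. ennreal (- ln (fiber_prob M X (X x))) \<le> ennreal (- ln (fiber_prob M Y (Y x)))"
    using AE_fiber_prob_pos[OF assms(1)] AE_space
  proof eventually_elim
    case (elim x)
    then show ?case
      using fiber_prob_determines_mono[OF assms(2) discrete_var_determined[OF assms] elim(2)]
      by (intro ennreal_leI) simp
  qed
qed

lemma ent_eq_sum:
  assumes "discrete_var M X"
  shows "ent M X =
    (\<integral>\<^sup>+c. ennreal (- (fiber_prob M X c * ln (fiber_prob M X c))) \<partial>count_space UNIV)"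
  unfolding ent_def info_def nn_integral_discrete_var[OF assms, of "\<lambda>c. ennreal (- ln (fiber_prob M X c))"]
  by (intro nn_integral_cong) (simp add: emeasure_eq_measure flip: fiber_prob_def ennreal_mult' , simp add: mult.commute)

lemma nn_integral_fiber_prob_le:
  assumes "discrete_var M X" "\<And>c. c \<in> C \<Longrightarrow> {x \<in> space M. X x = c} \<subseteq> A" "A \<in> sets M"
  shows "(\<integral>\<^sup>+c. ennreal (fiber_prob M X c) * indicator C c \<partial>count_space UNIV) \<le> emeasure M A"
proof -
  have "(\<integral>\<^sup>+c. ennreal (fiber_prob M X c) * indicator C c \<partial>count_space UNIV) =
      (\<integral>\<^sup>+x. indicator C (X x) \<partial>M)"
    unfolding nn_integral_discrete_var[OF assms(1), of "indicator C"]
    by (intro nn_integral_cong) (simp add: emeasure_eq_measure fiber_prob_def mult.commute)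
  also have "\<dots> \<le> (\<integral>\<^sup>+x. indicator A x \<partial>M)"
    using assms(2) by (intro nn_integral_mono) (auto split: split_indicator)
  also have "\<dots> = emeasure M A" using assms(3) by simp
  finally show ?thesis .
qed

text \<open>Gibbs' inequality: \<open>ln t \<le> t - 1\<close> is applied to the ratio q = P(A) P(B)
  / (P(A, B) P(C)) at the observed values, whose mean is at most 1. The result is the nonnegativity
  of the conditional mutual information of A and B given C, written without subtraction so that
  infinite entropies are allowed.\<close>

lemma ent_submodular_Pair:
  assumes A: "discrete_var M A" and B: "discrete_var M B"
    and AC: "determines M A C" and BC: "determines M B C"
  shows "ent M (\<lambda>x. (A x, B x)) + ent M C \<le> ent M A + ent M B"
proof -
  let ?J = "\<lambda>x. (A x, B x)"
  have J: "discrete_var M ?J" by (rule discrete_var_Pair[OF A B])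
  have C: "discrete_var M C" by (rule discrete_var_determined[OF A AC])
  obtain f where f: "\<And>x. x \<in> space M \<Longrightarrow> C x = f (A x)"
    using determines_factor[OF AC] by blast
  define R where "R = ?J ` space M"
  define q where "q = (\<lambda>(a, b). fiber_prob M A a * fiber_prob M B b /
      (fiber_prob M ?J (a, b) * fiber_prob M C (f a)))"
  have q0: "q j \<ge> 0" for j by (auto simp: q_def split: prod.split)
  have inner: "(\<integral>\<^sup>+b. ennreal (q (a, b)) * emeasure M {x \<in> space M. ?J x = (a, b)} \<partial>count_space UNIV)
      \<le> ennreal (fiber_prob M A a)" for a
  proof -
    let ?D = "{b. (a, b) \<in> R}"
    have "ennreal (q (a, b)) * emeasure M {x \<in> space M. ?J x = (a, b)} \<le>
        ennreal (fiber_prob M A a / fiber_prob M C (f a)) *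
        (ennreal (fiber_prob M B b) * indicator ?D b)" for b
    proof (cases "(a, b) \<in> R")
      case True
      have "ennreal (q (a, b)) * emeasure M {x \<in> space M. ?J x = (a, b)} =
          ennreal (q (a, b) * fiber_prob M ?J (a, b))"
        using q0 by (simp add: ennreal_mult emeasure_eq_measure fiber_prob_def)
      also have "\<dots> \<le>
          ennreal (fiber_prob M A a / fiber_prob M C (f a) * fiber_prob M B b)"
        by (intro ennreal_leI, cases "fiber_prob M ?J (a, b) = 0") (auto simp: q_def field_simps)
      finally show ?thesis using True
        by (simp flip: ennreal_mult)
    next
      case False
      then have empty: "{x \<in> space M. ?J x = (a, b)} = {}" by (auto simp: R_def)
      show ?thesis unfolding empty by simp
    qed
    then have "(\<integral>\<^sup>+b. ennreal (q (a, b)) * emeasure M {x \<in> space M. ?J x = (a, b)} \<partial>count_space UNIV)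
       \<le> (\<integral>\<^sup>+b. ennreal (fiber_prob M A a / fiber_prob M C (f a)) *
        (ennreal (fiber_prob M B b) * indicator ?D b) \<partial>count_space UNIV)"
      by (intro nn_integral_mono) auto
    also have "\<dots> = ennreal (fiber_prob M A a / fiber_prob M C (f a)) *
        (\<integral>\<^sup>+b. ennreal (fiber_prob M B b) * indicator ?D b \<partial>count_space UNIV)"
      by (intro nn_integral_cmult) auto
    \<comment> \<open>Every b that occurs together with a has its B-fiber inside the C-fiber over f
      a, because both variables determine C. These B-fibers are disjoint, so their probabilities add
      up to at most that of the C-fiber.\<close>
    also have "\<dots> \<le> ennreal (fiber_prob M A a / fiber_prob M C (f a)) *
        emeasure M {x \<in> space M. C x = f a}"
    proof (intro mult_left_mono nn_integral_fiber_prob_le[OF B])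
      fix b assume "b \<in> ?D"
      then obtain z where z: "z \<in> space M" "A z = a" "B z = b" by (auto simp: R_def)
      have "C y = f a" if "y \<in> space M" "B y = b" for y
        using determinesD[OF BC that(1) z(1)] that z f[OF z(1)] by simp
      then show "{x \<in> space M. B x = b} \<subseteq> {x \<in> space M. C x = f a}"
        by blast
    qed (use C in \<open>auto simp: discrete_var_def\<close>)
    also have "\<dots> = ennreal (fiber_prob M A a / fiber_prob M C (f a) * fiber_prob M C (f a))"
      by (simp add: emeasure_eq_measure ennreal_mult divide_nonneg_nonneg flip: fiber_prob_def del: times_divide_eq_left)
    also have "\<dots> \<le> ennreal (fiber_prob M A a)"
      by (intro ennreal_leI) (cases "fiber_prob M C (f a) = 0", auto)
    finally show ?thesis .
  qed
  have "(\<integral>\<^sup>+x. ennreal (q (?J x)) \<partial>M) \<le> 1"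
  proof -
    have "(\<integral>\<^sup>+x. ennreal (q (?J x)) \<partial>M) =
      (\<integral>\<^sup>+a. \<integral>\<^sup>+b. ennreal (q (a, b)) * emeasure M {x \<in> space M. ?J x = (a, b)}
        \<partial>count_space UNIV \<partial>count_space UNIV)"
      unfolding nn_integral_discrete_var[OF J, of "\<lambda>j. ennreal (q j)"]
      by (subst nn_integral_fst_count_space[symmetric]) simp
    also have "\<dots> \<le> (\<integral>\<^sup>+a. ennreal (fiber_prob M A a) * indicator UNIV a \<partial>count_space UNIV)"
      using inner by (intro nn_integral_mono) simp
    also have "\<dots> \<le> emeasure M (space M)"
      by (intro nn_integral_fiber_prob_le[OF A]) auto
    finally show ?thesis by (simp add: emeasure_space_1)
  qed
  note q1 = this
  have meas: "info M A \<in> borel_measurable M" "info M B \<in> borel_measurable M" "info M C \<in> borel_measurable M"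
      "info M ?J \<in> borel_measurable M" "(\<lambda>x. ennreal (q (?J x))) \<in> borel_measurable M"
    using A B C J discrete_var_measurable[OF J, of "\<lambda>j. ennreal (q j)" borel]
    by (simp_all add: measurable_info)
  \<comment> \<open>The 1 from \<open>ln t \<le> t - 1\<close> is kept on the left, so that all
    terms are nonnegative and can be integrated in \<open>ennreal\<close>; it cancels at the end
    against the mean of q.\<close>
  have "AE x in M. info M ?J x + info M C x + 1 \<le> info M A x + info M B x + ennreal (q (?J x))"
    using AE_fiber_prob_pos[OF A] AE_fiber_prob_pos[OF B] AE_fiber_prob_pos[OF C]
      AE_fiber_prob_pos[OF J] AE_space
  proof eventually_elim
    case (elim x)
    define a where "a = fiber_prob M A (A x)"
    define b where "b = fiber_prob M B (B x)"
    define c where "c = fiber_prob M C (C x)"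
    define j where "j = fiber_prob M ?J (A x, B x)"
    have pos: "a > 0" "b > 0" "c > 0" "j > 0" using elim by (auto simp: a_def b_def c_def j_def)
    have "q (?J x) = a * b / (j * c)"
      using f[OF elim(5)] by (simp add: q_def a_def b_def c_def j_def)
    moreover have "ln (a * b / (j * c)) \<le> a * b / (j * c) - 1"
      using pos by (intro ln_le_minus_one) simp
    ultimately have "- ln j + - ln c + 1 \<le> - ln a + - ln b + q (?J x)"
      using pos by (simp add: ln_div ln_mult)
    moreover have le: "ln a \<le> 0" "ln b \<le> 0" "ln c \<le> 0" "ln j \<le> 0"
      by (auto simp: a_def b_def c_def j_def)
    ultimately have "ennreal (- ln j + - ln c + 1) \<le> ennreal (- ln a + - ln b + q (?J x))"
      by (intro ennreal_leI)
    also have "ennreal (- ln j + - ln c + 1) = ennreal (- ln j) + ennreal (- ln c) + 1"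
      using le ennreal_plus[of "- ln j + - ln c" 1] ennreal_plus[of "- ln j" "- ln c"] by simp
    also have "ennreal (- ln a + - ln b + q (?J x)) = ennreal (- ln a) + ennreal (- ln b) + q (?J x)"
      using le q0[of "?J x"] ennreal_plus[of "- ln a + - ln b" "q (?J x)"]
        ennreal_plus[of "- ln a" "- ln b"] by simp
    finally show ?case by (simp add: info_def a_def b_def c_def j_def)
  qed
  then have "(\<integral>\<^sup>+x. info M ?J x + info M C x + 1 \<partial>M) \<le> (\<integral>\<^sup>+x. info M A x + info M B x + ennreal (q (?J x)) \<partial>M)"
    by (rule nn_integral_mono_AE)
  then have "ent M ?J + ent M C + 1 \<le> ent M A + ent M B + (\<integral>\<^sup>+x. ennreal (q (?J x)) \<partial>M)"
    using meas by (simp add: nn_integral_add emeasure_space_1 ent_def)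
  also have "\<dots> \<le> ent M A + ent M B + 1"
    using q1 by (intro add_left_mono)
  finally show ?thesis
    by (metis add.commute ennreal_add_left_cancel_le ennreal_one_neq_top infinity_ennreal_def)
qed

lemma ent_submodular:
  assumes A: "discrete_var M A" and B: "discrete_var M B"
    and AC: "determines M A C" and BC: "determines M B C"
    and J: "determines M (\<lambda>x. (A x, B x)) J"
  shows "ent M J + ent M C \<le> ent M A + ent M B"
  using add_right_mono[OF ent_determines_mono[OF discrete_var_Pair[OF A B] J], of "ent M C"]
    ent_submodular_Pair[OF A B AC BC] by (rule order_trans)

lemma ent_const: "ent M (\<lambda>x. c) = 0"
  by (simp add: ent_def info_def fiber_prob_def prob_space)

end

section \<open>Finite and conditional entropy\<close>

definition fin_ent :: "'a measure \<Rightarrow> ('a \<Rightarrow> 'c) \<Rightarrow> bool" where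
  "fin_ent M X \<longleftrightarrow> discrete_var M X \<and> ent M X < \<infinity>"

text \<open>For use together with \<open>fin_ent\<close>: an infinite entropy would be sent to
  0.\<close>

definition Hr :: "'a measure \<Rightarrow> ('a \<Rightarrow> 'c) \<Rightarrow> real" where
  "Hr M X = enn2real (ent M X)"

text \<open>H(Y | X) by the chain rule; the conditioning variable comes last.\<close>

definition cond_ent :: "'a measure \<Rightarrow> ('a \<Rightarrow> 'c) \<Rightarrow> ('a \<Rightarrow> 'd) \<Rightarrow> real" where
  "cond_ent M Y X = Hr M (\<lambda>x. (Y x, X x)) - Hr M X"

lemma ent_eq_Hr: "fin_ent M X \<Longrightarrow> ent M X = ennreal (Hr M X)"
  by (simp add: fin_ent_def Hr_def)

lemma Hr_nonneg [simp]: "Hr M X \<ge> 0"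
  by (simp add: Hr_def)

lemma fin_ent_discrete: "fin_ent M X \<Longrightarrow> discrete_var M X"
  by (simp add: fin_ent_def)

lemma tendsto_0_sandwich:
  fixes f g :: "nat \<Rightarrow> real"
  assumes "\<And>n. 0 \<le> f n" "\<And>n. f n \<le> g n" "g \<longlonglongrightarrow> 0"
  shows "f \<longlonglongrightarrow> 0"
  using assms by (intro real_tendsto_sandwich[OF _ _ tendsto_const assms(3)] always_eventually allI)

context prob_space
begin

lemma fin_ent_determined: "fin_ent M Y \<Longrightarrow> determines M Y X \<Longrightarrow> fin_ent M X"
  unfolding fin_ent_def using discrete_var_determined ent_determines_mono le_less_trans by blast

lemma fin_ent_Pair:
  assumes "fin_ent M X" "fin_ent M Y"
  shows "fin_ent M (\<lambda>x. (X x, Y x))"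
proof -
  have "ent M (\<lambda>x. (X x, Y x)) \<le> ent M X + ent M Y"
    using ent_submodular_Pair[of X Y "\<lambda>_. ()"] assms
    by (simp add: fin_ent_def determines_def ent_const)
  then show ?thesis
    using assms by (auto simp: fin_ent_def discrete_var_Pair intro: le_less_trans)
qed

lemma fin_ent_const: "fin_ent M (\<lambda>x. c)"
  by (simp add: fin_ent_def discrete_var_def ent_const image_constant_conv)

lemma Hr_const: "Hr M (\<lambda>x. c) = 0"
  by (simp add: Hr_def ent_const)

lemma Hr_mono:
  assumes "fin_ent M Y" "determines M Y X"
  shows "Hr M X \<le> Hr M Y"
  unfolding Hr_def using assms
  by (intro enn2real_mono ent_determines_mono) (auto simp: fin_ent_def)

lemma Hr_cong:
  assumes "fin_ent M Y" "determines M Y X" "determines M X Y"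
  shows "Hr M X = Hr M Y"
  by (metis Hr_mono antisym assms fin_ent_determined)

lemma Hr_submodular:
  assumes "fin_ent M A" "fin_ent M B"
    and "determines M A C" "determines M B C" "determines M (\<lambda>x. (A x, B x)) J"
  shows "Hr M J + Hr M C \<le> Hr M A + Hr M B"
proof -
  have "fin_ent M C" "fin_ent M J"
    using assms fin_ent_determined fin_ent_Pair by blast+
  then show ?thesis
    using ent_submodular[OF _ _ assms(3-5)] assms(1,2)
    by (simp add: fin_ent_discrete ent_eq_Hr flip: ennreal_plus)
qed

lemma cond_ent_nonneg:
  assumes "fin_ent M Y" "fin_ent M X"
  shows "cond_ent M Y X \<ge> 0"
  unfolding cond_ent_def using Hr_mono[OF fin_ent_Pair[OF assms], of X]
  by (simp add: determines_def)

lemma determines_fst: "determines M (\<lambda>x. (X x, Y x)) X"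
  and determines_snd: "determines M (\<lambda>x. (X x, Y x)) Y"
  and determines_refl: "determines M X X"
  by (simp_all add: determines_def)

lemma determines_Pair:
  "determines M Z X \<Longrightarrow> determines M Z Y \<Longrightarrow> determines M Z (\<lambda>x. (X x, Y x))"
  unfolding determines_def prod.inject by blast

lemma determines_comp: "determines M X (\<lambda>x. f (X x))"
  by (simp add: determines_def)

lemma cond_ent_mono_left:
  assumes "fin_ent M Y" "fin_ent M X" "determines M (\<lambda>x. (Y x, X x)) Z"
  shows "cond_ent M Z X \<le> cond_ent M Y X"
  unfolding cond_ent_def
  using Hr_mono[OF fin_ent_Pair[OF assms(1,2)] determines_Pair[OF assms(3) determines_snd]] by simp

text \<open>Submodularity for (Y, X) and Z, which have X in common.\<close>

lemma cond_ent_mono_right: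
  assumes "fin_ent M Y" "fin_ent M Z" "determines M Z X"
  shows "cond_ent M Y Z \<le> cond_ent M Y X"
proof -
  have X: "fin_ent M X" using assms fin_ent_determined by blast
  have "determines M (\<lambda>x. ((Y x, X x), Z x)) (\<lambda>x. (Y x, Z x))" by (simp add: determines_def)
  then show ?thesis
    unfolding cond_ent_def
    using Hr_submodular[OF fin_ent_Pair[OF assms(1) X] assms(2) determines_snd assms(3)]
    by fastforce
qed

lemma cond_ent_le_Hr:
  assumes "fin_ent M Y" "fin_ent M X"
  shows "cond_ent M Y X \<le> Hr M Y"
  unfolding cond_ent_def
  using Hr_submodular[OF assms, of "\<lambda>_. ()" "\<lambda>x. (Y x, X x)"]
  by (auto simp: determines_def Hr_const)

lemma cond_ent_Pair_le:
  assumes "fin_ent M Y" "fin_ent M Z" "fin_ent M X"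
  shows "cond_ent M (\<lambda>x. (Y x, Z x)) X \<le> cond_ent M Y X + cond_ent M Z X"
  unfolding cond_ent_def
  using Hr_submodular[of "\<lambda>x. (Y x, X x)" "\<lambda>x. (Z x, X x)" X "\<lambda>x. ((Y x, Z x), X x)"] assms
  by (auto simp: determines_def fin_ent_Pair)

text \<open>Submodularity for (Y, Z) and (Z, X), which have Z in common.\<close>

lemma cond_ent_trans:
  assumes "fin_ent M Y" "fin_ent M Z" "fin_ent M X"
  shows "cond_ent M Y X \<le> cond_ent M Y Z + cond_ent M Z X"
  unfolding cond_ent_def
  using Hr_submodular[of "\<lambda>x. (Y x, Z x)" "\<lambda>x. (Z x, X x)" Z "\<lambda>x. (Y x, X x)"] assms
  by (auto simp: determines_def fin_ent_Pair)

lemma cond_ent_determined: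
  assumes "fin_ent M X" "determines M X Y"
  shows "cond_ent M Y X = 0"
  unfolding cond_ent_def
  using Hr_cong[OF assms(1) determines_Pair[OF assms(2) determines_refl] determines_snd] by simp

section \<open>Conditional entropy of events and of the sigma-algebra they generate\<close>

lemma discrete_var_event: "B \<in> events \<Longrightarrow> discrete_var M (\<lambda>x. x \<in> B)"
  unfolding discrete_var_def
proof (intro conjI allI)
  fix c assume "B \<in> events"
  then show "{x \<in> space M. (x \<in> B) = c} \<in> events" by (cases c) auto
qed auto

text \<open>Only the behaviour at small probability matters, so the binary entropy gets a crude
  explicit bound: -p ln p = 2 p ln (1 / sqrt p) \<le> 2 sqrt p for the event and -(1 - p) ln (1 - p)
  \<le> p for its complement.\<close>

lemma ent_event_le:
  assumes "B \<in> events"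
  shows "ent M (\<lambda>x. x \<in> B) \<le> ennreal (2 * sqrt (prob B) + prob B)"
proof -
  define p where "p = prob B"
  have fp: "fiber_prob M (\<lambda>x. x \<in> B) True = p" "fiber_prob M (\<lambda>x. x \<in> B) False = 1 - p"
  proof -
    have "{x \<in> space M. (x \<in> B) = True} = B" "{x \<in> space M. (x \<in> B) = False} = space M - B"
      using sets.sets_into_space[OF assms] by auto
    then show "fiber_prob M (\<lambda>x. x \<in> B) True = p" "fiber_prob M (\<lambda>x. x \<in> B) False = 1 - p"
      by (simp_all only: fiber_prob_def p_def prob_compl[OF assms])
  qed
  have p: "0 \<le> p" "p \<le> 1" by (auto simp: p_def)
  have 1: "- (p * ln p) \<le> 2 * sqrt p"
  proof (cases "p = 0")
    case False
    then have s: "sqrt p > 0" using p by simp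
    have "- ln p = 2 * ln (1 / sqrt p)" using s by (simp add: ln_div ln_sqrt)
    also have "\<dots> \<le> 2 * (1 / sqrt p)" using ln_le_minus_one[of "1 / sqrt p"] s by simp
    finally have "p * (- ln p) \<le> p * (2 * (1 / sqrt p))" using p by (intro mult_left_mono)
    also have "\<dots> = 2 * sqrt p" using s p by (simp add: field_simps)
    finally show ?thesis by simp
  qed simp
  have 2: "- ((1 - p) * ln (1 - p)) \<le> p"
  proof (cases "p = 1")
    case False
    then have s: "1 - p > 0" using p by simp
    have "- ln (1 - p) = ln (1 / (1 - p))" using s by (simp add: ln_div)
    also have "\<dots> \<le> 1 / (1 - p) - 1" using ln_le_minus_one[of "1 / (1 - p)"] s by simp
    also have "\<dots> = p / (1 - p)" using s by (simp add: field_simps)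
    finally have "(1 - p) * (- ln (1 - p)) \<le> (1 - p) * (p / (1 - p))" using p by (intro mult_left_mono) auto
    then show ?thesis using s by simp
  qed simp
  have "ent M (\<lambda>x. x \<in> B) = ennreal (- (p * ln p)) + ennreal (- ((1 - p) * ln (1 - p)))"
    unfolding ent_eq_sum[OF discrete_var_event[OF assms]]
    by (simp add: nn_integral_count_space_finite UNIV_bool fp add.commute)
  also have "\<dots> \<le> ennreal (2 * sqrt p) + ennreal p"
    using 1 2 by (intro add_mono ennreal_leI)
  also have "\<dots> = ennreal (2 * sqrt p + p)" using p by simp
  finally show ?thesis by (simp add: p_def)
qed

lemma fin_ent_event: "B \<in> events \<Longrightarrow> fin_ent M (\<lambda>x. x \<in> B)"
  unfolding fin_ent_def using ent_event_le[of B] discrete_var_event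
  by (auto intro: le_less_trans)

lemma Hr_event_le:
  assumes "B \<in> events"
  shows "Hr M (\<lambda>x. x \<in> B) \<le> 2 * sqrt (prob B) + prob B"
  using ent_event_le[OF assms] fin_ent_event[OF assms] by (simp add: ent_eq_Hr flip: ennreal_plus)

lemma cond_ent_event_Un:
  assumes "A \<in> events" "B \<in> events" "fin_ent M X"
  shows "cond_ent M (\<lambda>x. x \<in> A \<union> B) X \<le> cond_ent M (\<lambda>x. x \<in> A) X + cond_ent M (\<lambda>x. x \<in> B) X"
  using cond_ent_mono_left[OF fin_ent_Pair[OF fin_ent_event[OF assms(1)] fin_ent_event[OF assms(2)]]
      assms(3), of "\<lambda>x. x \<in> A \<union> B"]
    cond_ent_Pair_le[OF fin_ent_event[OF assms(1)] fin_ent_event[OF assms(2)] assms(3)]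
  by (auto simp: determines_def)

lemma cond_ent_event_sym_diff:
  assumes "A \<in> events" "B \<in> events" "fin_ent M X" "prob (sym_diff A B) = 0"
  shows "cond_ent M (\<lambda>x. x \<in> A) X \<le> cond_ent M (\<lambda>x. x \<in> B) X"
proof -
  let ?D = "sym_diff A B"
  have D: "?D \<in> events" using assms by auto
  have "cond_ent M (\<lambda>x. x \<in> A) X \<le> cond_ent M (\<lambda>x. (x \<in> ?D, x \<in> B)) X"
    by (intro cond_ent_mono_left fin_ent_Pair fin_ent_event assms D determinesI) (simp; blast)
  also have "\<dots> \<le> cond_ent M (\<lambda>x. x \<in> ?D) X + cond_ent M (\<lambda>x. x \<in> B) X"
    using assms D by (intro cond_ent_Pair_le fin_ent_event)
  also have "cond_ent M (\<lambda>x. x \<in> ?D) X \<le> 0"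
    using cond_ent_le_Hr[OF fin_ent_event[OF D] assms(3)] Hr_event_le[OF D] assms(4) by simp
  finally show ?thesis by simp
qed

text \<open>The events whose conditional entropy given X n tends to 0 form a sigma-algebra. This
  does the work of a martingale convergence theorem.\<close>

lemma cond_ent_sigma_sets_tendsto_0:
  assumes X: "\<And>n. fin_ent M (X n)" and \<A>: "\<A> \<subseteq> events"
    and lim: "\<And>A. A \<in> \<A> \<Longrightarrow> (\<lambda>n. cond_ent M (\<lambda>x. x \<in> A) (X n)) \<longlonglongrightarrow> 0"
    and B: "B \<in> sigma_sets (space M) \<A>"
  shows "(\<lambda>n. cond_ent M (\<lambda>x. x \<in> B) (X n)) \<longlonglongrightarrow> 0"
  using B
proof induction
  case (Basic A)
  then show ?case by (rule lim)
next
  case Empty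
  then show ?case by (simp add: cond_ent_determined[OF X] determines_def)
next
  case (Compl A)
  have A: "A \<in> events" using Compl(1) sets.sigma_sets_subset[OF \<A>] by blast
  show ?case
  proof (rule tendsto_0_sandwich[OF _ _ Compl(2)])
    fix n
    have "determines M (\<lambda>x. (x \<in> A, X n x)) (\<lambda>x. x \<in> space M - A)"
      by (simp add: determines_def)
    then show "cond_ent M (\<lambda>x. x \<in> space M - A) (X n) \<le> cond_ent M (\<lambda>x. x \<in> A) (X n)"
      by (intro cond_ent_mono_left fin_ent_event A X)
    show "0 \<le> cond_ent M (\<lambda>x. x \<in> space M - A) (X n)"
      using A X by (intro cond_ent_nonneg fin_ent_event) auto
  qed
next
  case (Union A)
  have A: "A i \<in> events" for i using Union(1) sets.sigma_sets_subset[OF \<A>] by blast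
  let ?U = "\<lambda>k. \<Union>i<k. A i" and ?A = "\<Union>i. A i"
  have U: "?U k \<in> events" "?A \<in> events" for k using A by auto
  have fin: "(\<lambda>n. cond_ent M (\<lambda>x. x \<in> ?U k) (X n)) \<longlonglongrightarrow> 0" for k
  proof (induction k)
    case 0
    then show ?case by (simp add: cond_ent_determined[OF X] determines_def)
  next
    case (Suc k)
    have "cond_ent M (\<lambda>x. x \<in> ?U (Suc k)) (X n) \<le>
       cond_ent M (\<lambda>x. x \<in> ?U k) (X n) + cond_ent M (\<lambda>x. x \<in> A k) (X n)" for n
      using cond_ent_event_Un[OF U(1)[of k] A[of k] X[of n]] by (simp add: lessThan_Suc Un_commute)
    moreover have lim0: "(\<lambda>n. cond_ent M (\<lambda>x. x \<in> ?U k) (X n) + cond_ent M (\<lambda>x. x \<in> A k) (X n)) \<longlonglongrightarrow> 0"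
      using tendsto_add[OF Suc Union(2)[of k]] by simp
    ultimately show ?case
      by (intro tendsto_0_sandwich[OF _ _ lim0] cond_ent_nonneg fin_ent_event U X)
  qed
  show ?case
  proof (rule LIMSEQ_I)
    fix r :: real assume r: "r > 0"
    \<comment> \<open>The tail event \<open>?A - ?U k\<close> has small entropy whatever it is
      conditioned on, so h k controls it uniformly in n; only the finite union is left to the limit
      in n.\<close>
    define h where "h k = 2 * sqrt (prob (?A - ?U k)) + prob (?A - ?U k)" for k
    have "(\<lambda>k. prob (?A - ?U k)) \<longlonglongrightarrow> prob (\<Inter>k. ?A - ?U k)"
      using A U by (intro finite_Lim_measure_decseq) (auto simp: decseq_def)
    also have "(\<Inter>k. ?A - ?U k) = {}" by auto
    finally have "h \<longlonglongrightarrow> 2 * sqrt 0 + 0"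
      unfolding h_def by (intro tendsto_intros) simp_all
    then have "\<forall>\<^sub>F k in sequentially. h k < r / 2"
      using r by (intro order_tendstoD(2)) auto
    then obtain k where k: "h k < r / 2" by (auto simp: eventually_sequentially)
    have "\<forall>\<^sub>F n in sequentially. cond_ent M (\<lambda>x. x \<in> ?U k) (X n) < r / 2"
      using fin[of k] r by (intro order_tendstoD(2)) auto
    then obtain N where N: "\<And>n. n \<ge> N \<Longrightarrow> cond_ent M (\<lambda>x. x \<in> ?U k) (X n) < r / 2"
      by (auto simp: eventually_sequentially)
    have "norm (cond_ent M (\<lambda>x. x \<in> ?A) (X n) - 0) < r" if "n \<ge> N" for n
    proof -
      have "cond_ent M (\<lambda>x. x \<in> (?A - ?U k) \<union> ?U k) (X n) \<le>
        cond_ent M (\<lambda>x. x \<in> ?A - ?U k) (X n) + cond_ent M (\<lambda>x. x \<in> ?U k) (X n)"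
        using U X by (intro cond_ent_event_Un) auto
      also have "(?A - ?U k) \<union> ?U k = ?A" by auto
      finally have "cond_ent M (\<lambda>x. x \<in> ?A) (X n) \<le>
        cond_ent M (\<lambda>x. x \<in> ?A - ?U k) (X n) + cond_ent M (\<lambda>x. x \<in> ?U k) (X n)" .
      also have "cond_ent M (\<lambda>x. x \<in> ?A - ?U k) (X n) \<le> Hr M (\<lambda>x. x \<in> ?A - ?U k)"
        using U X by (intro cond_ent_le_Hr fin_ent_event) auto
      also have "\<dots> \<le> h k"
        unfolding h_def using U by (intro Hr_event_le) auto
      finally show ?thesis
        using k N[OF that] cond_ent_nonneg[OF fin_ent_event[OF U(2)] X[of n]] by simp
    qed
    then show "\<exists>N. \<forall>n\<ge>N. norm (cond_ent M (\<lambda>x. x \<in> ?A) (X n) - 0) < r" by blast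
  qed
qed

text \<open>Monotone convergence for the information functions of the truncations. At each point
  they become stationary, since the fiber over the value of Y no longer changes once k exceeds that
  value.\<close>

lemma Hr_truncate_tendsto:
  fixes Y :: "'a \<Rightarrow> nat"
  assumes "fin_ent M Y"
  shows "(\<lambda>k. Hr M (\<lambda>x. min (Y x) k)) \<longlonglongrightarrow> Hr M Y"
proof -
  let ?Y = "\<lambda>k x. min (Y x) k"
  have det: "determines M (?Y l) (?Y k)" "determines M Y (?Y k)" if "k \<le> l" for k l
    using that determines_comp[of "?Y l" "\<lambda>y. min y k"] determines_comp[of Y "\<lambda>y. min y k"]
    by (simp_all add: min.assoc min.absorb2)
  have Y: "discrete_var M Y" using assms by (simp add: fin_ent_def)
  have Yk: "discrete_var M (?Y k)" for k using discrete_var_determined[OF Y det(2)] by blast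
  have AEpos: "AE x in M. \<forall>k. fiber_prob M (?Y k) (?Y k x) > 0"
    using AE_fiber_prob_pos[OF Yk] by (simp add: AE_all_countable)
  have "(\<integral>\<^sup>+x. (SUP k. info M (?Y k) x) \<partial>M) = (SUP k. ent M (?Y k))"
    unfolding ent_def
  proof (intro nn_integral_monotone_convergence_SUP_AE measurable_info Yk)
    fix k
    show "AE x in M. info M (?Y k) x \<le> info M (?Y (Suc k)) x"
      using AEpos AE_space
    proof eventually_elim
      case (elim x)
      then show ?case unfolding info_def
        using fiber_prob_determines_mono[OF det(1)[of k "Suc k"] Yk elim(2)] by (intro ennreal_leI) auto
    qed
  qed
  moreover have "AE x in M. (SUP k. info M (?Y k) x) \<ge> info M Y x"
  proof (rule AE_I2)
    fix x assume x: "x \<in> space M"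
    \<comment> \<open>The successor matters: truncation at Y x itself would merge this fiber with
      all larger values.\<close>
    have "{y \<in> space M. Y y = Y x} = {y \<in> space M. min (Y y) (Suc (Y x)) = min (Y x) (Suc (Y x))}"
      by auto
    then have "info M Y x = info M (?Y (Suc (Y x))) x"
      by (simp add: info_def fiber_prob_def)
    also have "\<dots> \<le> (SUP k. info M (?Y k) x)" by (rule SUP_upper) simp
    finally show "info M Y x \<le> (SUP k. info M (?Y k) x)" .
  qed
  then have "ent M Y \<le> (\<integral>\<^sup>+x. (SUP k. info M (?Y k) x) \<partial>M)"
    unfolding ent_def by (rule nn_integral_mono_AE)
  ultimately have "ent M Y \<le> (SUP k. ent M (?Y k))" by simp
  moreover have "ent M (?Y k) \<le> ent M Y" for k by (rule ent_determines_mono[OF Y det(2)[of k k]]) simp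
  ultimately have "ent M Y = (SUP k. ent M (?Y k))" by (intro antisym SUP_least) auto
  moreover have "incseq (\<lambda>k. ent M (?Y k))"
    by (intro monoI ent_determines_mono Yk det)
  ultimately have "(\<lambda>k. ent M (?Y k)) \<longlonglongrightarrow> ent M Y" by (metis LIMSEQ_SUP)
  then show ?thesis unfolding Hr_def using assms
    by (intro tendsto_enn2real) (auto simp: fin_ent_def)
qed

text \<open>A truncation is determined by finitely many of the events \<open>Y = c\<close>, so its
  conditional entropy tends to 0. What remains is H(Y) - H(min Y k), which is small for large k
  because the entropy of Y is finite.\<close>

lemma cond_ent_tendsto_0_nat:
  fixes Y :: "'a \<Rightarrow> nat"
  assumes X: "\<And>n. fin_ent M (X n)" and Y: "fin_ent M Y"
    and lim: "\<And>c. (\<lambda>n. cond_ent M (\<lambda>x. x \<in> {x \<in> space M. Y x = c}) (X n)) \<longlonglongrightarrow> 0"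
  shows "(\<lambda>n. cond_ent M Y (X n)) \<longlonglongrightarrow> 0"
proof (rule LIMSEQ_I)
  fix r :: real assume r: "r > 0"
  let ?Y = "\<lambda>k x. min (Y x) k"
  have ev: "{x \<in> space M. Y x = c} \<in> events" for c
    using Y by (auto simp: fin_ent_def discrete_var_def)
  have Yk: "fin_ent M (?Y k)" for k
    by (rule fin_ent_determined[OF Y determines_comp])
  have trunc: "(\<lambda>n. cond_ent M (?Y k) (X n)) \<longlonglongrightarrow> 0" for k
  proof (induction k)
    case 0
    then show ?case by (simp add: cond_ent_determined[OF X] determines_def)
  next
    case (Suc k)
    let ?E = "{x \<in> space M. Y x = k}"
    have "cond_ent M (?Y (Suc k)) (X n) \<le> cond_ent M (?Y k) (X n) + cond_ent M (\<lambda>x. x \<in> ?E) (X n)" for n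
    proof -
      have "cond_ent M (?Y (Suc k)) (X n) \<le> cond_ent M (\<lambda>x. (?Y k x, x \<in> ?E)) (X n)"
        by (intro cond_ent_mono_left fin_ent_Pair fin_ent_event Yk X ev determinesI)
          (auto simp: min_def split: if_splits)
      then show ?thesis
        using cond_ent_Pair_le[OF Yk[of k] fin_ent_event[OF ev[of k]] X[of n]] by simp
    qed
    moreover have lim0: "(\<lambda>n. cond_ent M (?Y k) (X n) + cond_ent M (\<lambda>x. x \<in> ?E) (X n)) \<longlonglongrightarrow> 0"
      using tendsto_add[OF Suc lim[of k]] by simp
    ultimately show ?case
      by (intro tendsto_0_sandwich[OF _ _ lim0] cond_ent_nonneg Yk X)
  qed
  have "\<forall>\<^sub>F k in sequentially. Hr M (?Y k) > Hr M Y - r / 2"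
    using Hr_truncate_tendsto[OF Y] r by (intro order_tendstoD(1)) auto
  then obtain k where k: "Hr M (?Y k) > Hr M Y - r / 2" by (auto simp: eventually_sequentially)
  have "\<forall>\<^sub>F n in sequentially. cond_ent M (?Y k) (X n) < r / 2"
    using trunc[of k] r by (intro order_tendstoD(2)) auto
  then obtain N where N: "\<And>n. n \<ge> N \<Longrightarrow> cond_ent M (?Y k) (X n) < r / 2"
    by (auto simp: eventually_sequentially)
  have Yk_eq: "Hr M (\<lambda>x. (Y x, ?Y k x)) = Hr M Y"
    by (rule Hr_cong[OF Y]) (simp_all add: determines_def)
  have "norm (cond_ent M Y (X n) - 0) < r" if "n \<ge> N" for n
    using cond_ent_trans[OF Y Yk[of k] X[of n]] N[OF that] k Yk_eq cond_ent_nonneg[OF Y X[of n]]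
    by (simp add: cond_ent_def)
  then show "\<exists>N. \<forall>n\<ge>N. norm (cond_ent M Y (X n) - 0) < r" by blast
qed

lemma cond_ent_tendsto_0:
  assumes X: "\<And>n. fin_ent M (X n)" and Y: "fin_ent M Y"
    and lim: "\<And>c. (\<lambda>n. cond_ent M (\<lambda>x. x \<in> {x \<in> space M. Y x = c}) (X n)) \<longlonglongrightarrow> 0"
  shows "(\<lambda>n. cond_ent M Y (X n)) \<longlonglongrightarrow> 0"
proof -
  let ?f = "to_nat_on (Y ` space M)"
  let ?Z = "\<lambda>x. ?f (Y x)"
  have count: "countable (Y ` space M)" using Y by (auto simp: fin_ent_def discrete_var_def)
  then have inj: "?f (Y x) = ?f (Y y) \<longleftrightarrow> Y x = Y y" if "x \<in> space M" "y \<in> space M" for x y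
    using that by (simp add: to_nat_on_inj)
  have Z: "fin_ent M ?Z" by (rule fin_ent_determined[OF Y determines_comp])
  have "(\<lambda>n. cond_ent M ?Z (X n)) \<longlonglongrightarrow> 0"
  proof (rule cond_ent_tendsto_0_nat[OF X Z])
    fix c
    show "(\<lambda>n. cond_ent M (\<lambda>x. x \<in> {x \<in> space M. ?Z x = c}) (X n)) \<longlonglongrightarrow> 0"
    proof (cases "\<exists>y\<in>space M. ?Z y = c")
      case True
      then obtain y where y: "y \<in> space M" "?Z y = c" by auto
      then have "{x \<in> space M. ?Z x = c} = {x \<in> space M. Y x = Y y}" using inj by auto
      then show ?thesis using lim by simp
    next
      case False
      then have empty: "{x \<in> space M. ?Z x = c} = {}" by auto
      show ?thesis unfolding empty using cond_ent_determined[OF X, of _ "\<lambda>_. False"] by (simp add: determines_def)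
    qed
  qed
  moreover have "cond_ent M ?Z (X n) = cond_ent M Y (X n)" for n
    by (intro antisym cond_ent_mono_left Y X Z determinesI) (simp_all add: inj)
  ultimately show ?thesis by simp
qed

end

section \<open>Partitions as discrete variables\<close>

definition parts :: "'a measure \<Rightarrow> ('a \<Rightarrow> 'c) \<Rightarrow> 'a set set" where
  "parts M X = (\<lambda>c. {x \<in> space M. X x = c}) ` X ` space M"

lemma infsum_ennreal_eq_nn_integral:
  fixes f :: "'c \<Rightarrow> ennreal"
  assumes "countable A"
  shows "infsum f A = (\<integral>\<^sup>+c. f c \<partial>count_space A)"
proof (cases "finite A")
  case True
  then show ?thesis by (simp add: nn_integral_count_space_finite)
next
  case False
  note bij = bij_betw_from_nat_into[OF assms False]
  have "infsum f A = infsum (\<lambda>n. f (from_nat_into A n)) UNIV"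
    by (rule infsum_reindex_bij_betw[OF bij, symmetric])
  also have "\<dots> = suminf (\<lambda>n. f (from_nat_into A n))"
    by (rule sums_unique[OF has_sum_imp_sums[OF has_sum_infsum[OF nonneg_summable_on_complete]]]) simp
  also have "\<dots> = (\<integral>\<^sup>+c. f c \<partial>count_space A)"
    by (simp add: nn_integral_bij_count_space[OF bij, symmetric] nn_integral_count_space_nat)
  finally show ?thesis .
qed

lemma inj_on_fiber: "inj_on (\<lambda>c. {x \<in> space M. X x = c}) (X ` space M)"
  by (rule inj_onI) blast

lemma Union_parts: "\<Union> (parts M X) = space M"
  by (auto simp: parts_def)

lemma partition_on_parts: "partition_on (space M) (parts M X)"
  by (rule partition_onI) (auto simp: parts_def disjnt_def)

lemma measurable_partition_parts: "discrete_var M X \<Longrightarrow> measurable_partition M (parts M X)"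
  unfolding measurable_partition_def using partition_on_parts
  by (auto simp: parts_def discrete_var_def)

lemma countable_parts: "discrete_var M X \<Longrightarrow> countable (parts M X)"
  by (simp add: parts_def discrete_var_def)

lemma parts_class: "x \<in> space M \<Longrightarrow> A \<in> parts M X \<Longrightarrow> x \<in> A \<Longrightarrow> A = {y \<in> space M. X y = X x}"
  by (auto simp: parts_def)

lemma parts_memI: "x \<in> space M \<Longrightarrow> {y \<in> space M. X y = X x} \<in> parts M X"
  by (auto simp: parts_def)

lemma (in prob_space) shannon_entropy_parts:
  assumes X: "discrete_var M X"
  shows "shannon_entropy M (parts M X) = ent M X"
proof -
  let ?h = "\<lambda>p::real. ennreal (- (p * ln p))"
  let ?R = "X ` space M"
  have "countable (parts M X)" "measure M (\<Union>(parts M X)) = 1"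
    using countable_parts[OF X] by (simp_all add: Union_parts prob_space)
  then have "shannon_entropy M (parts M X) = infsum (\<lambda>A. ?h (measure M A)) (parts M X)"
    unfolding shannon_entropy_def by (subst if_P) auto
  also have "\<dots> = infsum (\<lambda>c. ?h (fiber_prob M X c)) ?R"
    unfolding parts_def by (subst infsum_reindex[OF inj_on_fiber]) (simp add: o_def fiber_prob_def)
  also have "\<dots> = (\<integral>\<^sup>+c. ?h (fiber_prob M X c) \<partial>count_space ?R)"
    using X by (intro infsum_ennreal_eq_nn_integral) (simp add: discrete_var_def)
  also have "\<dots> = (\<integral>\<^sup>+c. ?h (fiber_prob M X c) \<partial>count_space UNIV)"
  proof (rule nn_integral_count_space_eq)
    fix c assume "c \<in> UNIV - ?R"
    then have "{x \<in> space M. X x = c} = {}" by auto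
    then have "fiber_prob M X c = 0" unfolding fiber_prob_def by (simp only: measure_empty)
    then show "?h (fiber_prob M X c) = 0" by simp
  qed simp
  also have "\<dots> = ent M X" by (rule ent_eq_sum[OF X, symmetric])
  finally show ?thesis .
qed

text \<open>X sends a point to the class containing it, so the classes themselves serve as
  values.\<close>

lemma measurable_partition_eq_parts:
  assumes "measurable_partition M \<alpha>" "countable \<alpha>"
  obtains X :: "'a \<Rightarrow> 'a set" where "discrete_var M X" "parts M X = \<alpha>"
    "\<And>A. A \<in> \<alpha> \<Longrightarrow> A = {x \<in> space M. X x = A}"
proof
  have P: "partition_on (space M) \<alpha>" "\<alpha> \<subseteq> sets M"
    using assms by (auto simp: measurable_partition_def)
  define X where "X = (\<lambda>x. \<Union>{A \<in> \<alpha>. x \<in> A})"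
  have X: "X x = A" if "A \<in> \<alpha>" "x \<in> A" for x A
  proof -
    have "{A \<in> \<alpha>. x \<in> A} = {A}"
      using that partition_onD2[OF P(1)] by (auto simp: disjoint_def)
    then show ?thesis by (simp add: X_def)
  qed
  have cov: "\<exists>A\<in>\<alpha>. x \<in> A" if "x \<in> space M" for x using that partition_onD1[OF P(1)] by auto
  have sub: "A \<subseteq> space M" "A \<noteq> {}" if "A \<in> \<alpha>" for A
    using that partition_onD1[OF P(1)] partition_onD3[OF P(1)] by auto
  have img: "X ` space M = \<alpha>" using X cov sub by (fastforce simp: image_iff)
  show fib: "A = {x \<in> space M. X x = A}" if "A \<in> \<alpha>" for A
  proof (intro equalityI subsetI)
    fix x assume "x \<in> {x \<in> space M. X x = A}"
    then show "x \<in> A" using cov[of x] X by auto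
  qed (use that sub X in auto)
  show "parts M X = \<alpha>"
    unfolding parts_def img using fib by (auto simp: image_iff)
  show "discrete_var M X"
    unfolding discrete_var_def img
  proof (intro conjI allI)
    fix c show "{x \<in> space M. X x = c} \<in> sets M"
    proof (cases "c \<in> \<alpha>")
      case True
      then show ?thesis using fib[of c] P(2) by auto
    next
      case False
      then have "{x \<in> space M. X x = c} = {}" using img by auto
      then show ?thesis by (simp only: sets.empty_sets)
    qed
  qed fact
qed

text \<open>\<open>common_refinement\<close> picks one class from each partition. A point of a
  nonempty intersection fixes all the picks: they are the fibers through that point.\<close>

lemma common_refinement_parts:
  fixes M :: "'x measure"
  assumes "I \<noteq> {}"
  shows "common_refinement ((\<lambda>i. parts M (X i)) ` I) = parts M (\<lambda>x. \<lambda>i\<in>I. X i x)"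
proof -
  let ?P = "(\<lambda>i. parts M (X i)) ` I"
  let ?C = "\<lambda>x. {y \<in> space M. \<forall>i\<in>I. X i y = X i x}"
  have fibers: "{y \<in> space M. (\<lambda>i\<in>I. X i y) = (\<lambda>i\<in>I. X i x)} = ?C x" for x
    by (auto simp: restrict_def fun_eq_iff)
  have "common_refinement ?P = ?C ` space M"
  proof (intro equalityI subsetI)
    fix A assume "A \<in> common_refinement ?P"
    then obtain f where f: "f \<in> Pi ?P (\<lambda>P. P)" "A = \<Inter> (f ` ?P)" "A \<noteq> {}"
      by (auto simp: common_refinement)
    then obtain x where x: "x \<in> A" by auto
    have fi: "f (parts M (X i)) \<in> parts M (X i)" if "i \<in> I" for i using f(1) that by auto
    have xi: "x \<in> f (parts M (X i))" if "i \<in> I" for i using f(2) x that by auto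
    obtain i0 where i0: "i0 \<in> I" using assms by blast
    then have "x \<in> \<Union> (parts M (X i0))" using fi xi by (intro UnionI)
    then have xs: "x \<in> space M" by (simp only: Union_parts)
    have "f (parts M (X i)) = {y \<in> space M. X i y = X i x}" if "i \<in> I" for i
      using parts_class[OF xs fi[OF that] xi[OF that]] .
    then have "A = ?C x" using f(2) assms by auto
    then show "A \<in> ?C ` space M" using xs by auto
  next
    fix A assume "A \<in> ?C ` space M"
    then obtain x where x: "x \<in> space M" "A = ?C x" by auto
    \<comment> \<open>Written in terms of the partition P rather than of an index, because several
      indices may give the same partition.\<close>
    define f where "f P = \<Union>{B \<in> P. x \<in> B}" for P :: "'x set set"
    have fi: "f (parts M (X i)) = {y \<in> space M. X i y = X i x}" for i
      using x(1) by (auto simp: f_def parts_def)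
    have "f \<in> Pi ?P (\<lambda>P. P)" using fi parts_memI[OF x(1)] by auto
    moreover have "A = \<Inter> (f ` ?P)" using fi x assms by auto
    moreover have "A \<noteq> {}" using x by auto
    ultimately show "A \<in> common_refinement ?P" by (auto simp: common_refinement)
  qed
  also have "\<dots> = parts M (\<lambda>x. \<lambda>i\<in>I. X i x)"
    unfolding parts_def image_image fibers ..
  finally show ?thesis .
qed

section \<open>The f-invariant does not depend on the generating partition\<close>

lemma word_val_Nil [simp]: "word_val G [] = \<one>\<^bsub>G\<^esub>"
  by (simp add: word_val_def)

lemma word_val_Cons [simp]:
  "word_val G ((s, b) # w) = (if b then s else inv\<^bsub>G\<^esub> s) \<otimes>\<^bsub>G\<^esub> word_val G w"
  by (simp add: word_val_def)

text \<open>The setting in which F and f are compared on different partitions. Freeness enters with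
  \<open>free_group\<close>, where the exponent homomorphism and the number of edges in a ball are
  computed.\<close>

locale generated_group = group G for G :: "'g monoid" (structure) +
  fixes S :: "'g set"
  assumes S_closed: "S \<subseteq> carrier G" and finite_S: "finite S"
    and carrier_words: "carrier G \<subseteq> word_val G ` lists (S \<times> UNIV)"
begin

abbreviation \<B> where "\<B> n \<equiv> word_ball G S n"

lemma word_val_closed: "w \<in> lists (S \<times> UNIV) \<Longrightarrow> word_val G w \<in> carrier G"
proof (induction w)
  case (Cons a w)
  then show ?case using S_closed by (cases a) auto
qed simp

lemma ball_closed: "\<B> n \<subseteq> carrier G"
  unfolding word_ball_def using word_val_closed by auto

lemma finite_ball: "finite (\<B> n)"
proof -
  have "finite {w. set w \<subseteq> S \<times> (UNIV :: bool set) \<and> length w \<le> n}"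
    using finite_S by (intro finite_lists_length_le) simp
  then show ?thesis unfolding word_ball_def by (auto simp: lists_eq_set)
qed

lemma ball_mono: "m \<le> n \<Longrightarrow> \<B> m \<subseteq> \<B> n"
  unfolding word_ball_def by auto

lemma ball_0: "\<B> 0 = {\<one>}"
  unfolding word_ball_def by (auto simp: image_iff)

lemma one_in_ball: "\<one> \<in> \<B> n"
  using ball_0 ball_mono[of 0 n] by auto

lemma ball_exhausts:
  assumes "g \<in> carrier G"
  obtains n where "g \<in> \<B> n"
proof -
  obtain w where "w \<in> lists (S \<times> UNIV)" "g = word_val G w" using carrier_words assms by blast
  then have "g \<in> \<B> (length w)" unfolding word_ball_def by blast
  then show ?thesis by (rule that)
qed

text \<open>Words grow at the left end. This matches \<open>tr_mult\<close>: if g = s h, the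
  translate by s of a join over a ball containing h contains the translate by g.\<close>

lemma ball_Suc_cases:
  assumes "g \<in> \<B> (Suc n)"
  obtains "g \<in> \<B> n" | s h where "s \<in> S" "h \<in> \<B> n" "g = s \<otimes> h"
    | s h where "s \<in> S" "h \<in> \<B> n" "g = inv s \<otimes> h"
proof -
  obtain w where w: "w \<in> lists (S \<times> UNIV)" "length w \<le> Suc n" "g = word_val G w"
    using assms unfolding word_ball_def by blast
  show thesis
  proof (cases w)
    case Nil
    then show thesis using w one_in_ball that(1) by simp
  next
    case (Cons a v)
    obtain s b where a: "a = (s, b)" by (cases a)
    have v: "word_val G v \<in> \<B> n" "s \<in> S" using w Cons a unfolding word_ball_def by auto
    show thesis
      using that(2)[OF v(2,1)] that(3)[OF v(2,1)] w(3) Cons a by (cases b) auto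
  qed
qed

end

section \<open>Translates and joins under a measure preserving action\<close>

locale pmp_system = generated_group G S + prob_space M
  for G :: "'g monoid" (structure) and S :: "'g set" and M :: "'x measure" +
  fixes \<phi> :: "'g \<Rightarrow> 'x \<Rightarrow> 'x"
  assumes pmp: "pmp_action G M \<phi>"
begin

sublocale group_action G "space M" \<phi>
  using pmp by (simp add: pmp_action_def)

text \<open>Composition with the inverse makes the fibers of \<open>tr g X\<close> the images under
  g of the fibers of X, in agreement with \<open>translate_partition\<close>.\<close>

definition tr :: "'g \<Rightarrow> ('x \<Rightarrow> 'c) \<Rightarrow> 'x \<Rightarrow> 'c" where
  "tr g X = (\<lambda>x. X (\<phi> (inv g) x))"

text \<open>The join of the translates of X over the window W, as a single variable whose values are
  functions on W.\<close>

definition orb :: "'g set \<Rightarrow> ('x \<Rightarrow> 'c) \<Rightarrow> 'x \<Rightarrow> 'g \<Rightarrow> 'c" where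
  "orb W X = (\<lambda>x. \<lambda>g\<in>W. tr g X x)"

definition F :: "('x \<Rightarrow> 'c) \<Rightarrow> real" where
  "F X = (1 - 2 * real (card S)) * Hr M X + (\<Sum>s\<in>S. Hr M (\<lambda>x. (X x, tr s X x)))"

lemma act_closed: "g \<in> carrier G \<Longrightarrow> x \<in> space M \<Longrightarrow> \<phi> g x \<in> space M"
  using element_image by blast

lemma act_mult:
  "g \<in> carrier G \<Longrightarrow> h \<in> carrier G \<Longrightarrow> x \<in> space M \<Longrightarrow> \<phi> g (\<phi> h x) = \<phi> (g \<otimes> h) x"
  by (simp add: composition_rule)

lemma act_one: "x \<in> space M \<Longrightarrow> \<phi> \<one> x = x"
  using id_eq_one by (metis restrict_apply')

lemma act_measurable: "g \<in> carrier G \<Longrightarrow> \<phi> g \<in> measurable M M"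
  using pmp by (simp add: pmp_action_def)

lemma act_distr: "g \<in> carrier G \<Longrightarrow> distr M M (\<phi> g) = M"
  using pmp by (simp add: pmp_action_def)

lemma tr_Collect:
  "g \<in> carrier G \<Longrightarrow> {x \<in> space M. P (tr g X x)} = \<phi> (inv g) -` {x \<in> space M. P (X x)} \<inter> space M"
  using act_closed[of "inv g"] by (auto simp: tr_def)

lemma image_act_Collect:
  assumes g: "g \<in> carrier G"
  shows "\<phi> g ` {x \<in> space M. P x} = {x \<in> space M. P (\<phi> (inv g) x)}"
proof (intro equalityI subsetI)
  fix y assume "y \<in> {x \<in> space M. P (\<phi> (inv g) x)}"
  then have y: "y \<in> space M" "P (\<phi> (inv g) y)" by auto
  then have "y = \<phi> g (\<phi> (inv g) y)" using g by (simp add: act_mult act_one)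
  then show "y \<in> \<phi> g ` {x \<in> space M. P x}" using y g act_closed[of "inv g" y] by blast
qed (use g act_closed in \<open>auto simp: act_mult act_one\<close>)

lemma measure_act_vimage:
  assumes "g \<in> carrier G" "A \<in> events"
  shows "prob (\<phi> g -` A \<inter> space M) = prob A"
  using measure_distr[OF act_measurable[OF assms(1)] assms(2)] by (simp add: act_distr assms)

lemma image_act_events:
  assumes "g \<in> carrier G" "A \<in> events"
  shows "\<phi> g ` A \<in> events" "prob (\<phi> g ` A) = prob A"
proof -
  have "A = {x \<in> space M. x \<in> A}" using sets.sets_into_space[OF assms(2)] by auto
  then have "\<phi> g ` A = {x \<in> space M. \<phi> (inv g) x \<in> A}"
    using image_act_Collect[OF assms(1), of "\<lambda>x. x \<in> A"] by simp
  also have "\<dots> = \<phi> (inv g) -` A \<inter> space M" by auto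
  finally have eq: "\<phi> g ` A = \<phi> (inv g) -` A \<inter> space M" .
  show "\<phi> g ` A \<in> events" "prob (\<phi> g ` A) = prob A"
    unfolding eq using act_measurable[of "inv g"] assms
    by (simp_all add: measurable_sets measure_act_vimage)
qed

lemma tr_mult:
  assumes "g \<in> carrier G" "h \<in> carrier G" "x \<in> space M"
  shows "tr g (tr h X) x = tr (g \<otimes> h) X x"
  using assms by (simp add: tr_def act_mult inv_mult_group)

lemma determines_tr:
  assumes "determines M X Y" "g \<in> carrier G"
  shows "determines M (tr g X) (tr g Y)"
  unfolding tr_def
  by (intro determinesI determinesD[OF assms(1)]) (use assms(2) act_closed in auto)

lemma discrete_var_tr:
  assumes "discrete_var M X" "g \<in> carrier G"
  shows "discrete_var M (tr g X)"
  unfolding discrete_var_def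
proof (intro conjI allI)
  have "tr g X ` space M \<subseteq> X ` space M"
    using assms(2) act_closed[of "inv g"] by (auto simp: tr_def)
  then show "countable (tr g X ` space M)"
    using assms(1) countable_subset by (auto simp: discrete_var_def)
  show "{x \<in> space M. tr g X x = c} \<in> events" for c
    using assms act_measurable[of "inv g"]
    by (subst tr_Collect[of g "\<lambda>y. y = c"]) (auto simp: discrete_var_def intro: measurable_sets)
qed

lemma ent_tr:
  assumes "discrete_var M X" "g \<in> carrier G"
  shows "ent M (tr g X) = ent M X"
proof -
  have "fiber_prob M (tr g X) c = fiber_prob M X c" for c
    unfolding fiber_prob_def
    using assms measure_act_vimage[of "inv g" "{x \<in> space M. X x = c}"]
    by (simp only: tr_Collect[of g "\<lambda>y. y = c"] discrete_var_def inv_closed)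
  then show ?thesis using assms by (simp add: ent_eq_sum discrete_var_tr)
qed

lemma Hr_tr: "discrete_var M X \<Longrightarrow> g \<in> carrier G \<Longrightarrow> Hr M (tr g X) = Hr M X"
  by (simp add: Hr_def ent_tr)

lemma fin_ent_tr: "fin_ent M X \<Longrightarrow> g \<in> carrier G \<Longrightarrow> fin_ent M (tr g X)"
  by (simp add: fin_ent_def discrete_var_tr ent_tr)

lemma Hr_tr_Pair:
  "fin_ent M X \<Longrightarrow> fin_ent M Y \<Longrightarrow> g \<in> carrier G \<Longrightarrow>
    Hr M (\<lambda>x. (tr g X x, tr g Y x)) = Hr M (\<lambda>x. (X x, Y x))"
  using Hr_tr[OF fin_ent_discrete[OF fin_ent_Pair], of X Y g] by (simp add: tr_def)

lemma cond_ent_tr: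
  "fin_ent M X \<Longrightarrow> fin_ent M Y \<Longrightarrow> g \<in> carrier G \<Longrightarrow>
    cond_ent M (tr g X) (tr g Y) = cond_ent M X Y"
  by (simp add: cond_ent_def Hr_tr_Pair Hr_tr fin_ent_discrete)

lemma translate_parts:
  assumes g: "g \<in> carrier G"
  shows "translate_partition \<phi> g (parts M X) = parts M (tr g X)"
proof -
  have "X ` space M = tr g X ` space M"
  proof (intro equalityI subsetI)
    fix c assume "c \<in> X ` space M"
    then obtain x where "x \<in> space M" "c = X x" by auto
    then have "c = tr g X (\<phi> g x)" "\<phi> g x \<in> space M"
      using g by (auto simp: tr_def act_mult act_one act_closed)
    then show "c \<in> tr g X ` space M" by blast
  qed (use g act_closed[of "inv g"] in \<open>auto simp: tr_def\<close>)
  moreover have "translate_partition \<phi> g (parts M X) = (\<lambda>c. \<phi> g ` {x \<in> space M. X x = c}) ` (X ` space M)"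
    unfolding translate_partition_def parts_def by (rule image_image)
  moreover have "\<phi> g ` {x \<in> space M. X x = c} = {x \<in> space M. tr g X x = c}" for c
    unfolding tr_def by (rule image_act_Collect[OF g])
  ultimately show ?thesis by (simp only: parts_def)
qed

lemma orb_eq_iff: "orb W X x = orb W X y \<longleftrightarrow> (\<forall>g\<in>W. tr g X x = tr g X y)"
  unfolding orb_def by (auto simp: restrict_def fun_eq_iff)

lemma fin_ent_orb:
  assumes "finite W" "W \<subseteq> carrier G" "fin_ent M X"
  shows "fin_ent M (orb W X)"
  using assms(1,2)
proof (induction W)
  case empty
  then show ?case by (simp add: orb_def fin_ent_const)
next
  case (insert g W)
  have det: "determines M (\<lambda>x. (orb W X x, tr g X x)) (orb (insert g W) X)"
    by (rule determinesI) (simp add: orb_eq_iff)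
  have "fin_ent M (orb W X)" "g \<in> carrier G" using insert by auto
  then show ?case
    by (intro fin_ent_determined[OF _ det] fin_ent_Pair fin_ent_tr assms(3))
qed

lemma orb_determines_tr: "g \<in> W \<Longrightarrow> determines M (orb W X) (tr g X)"
  by (rule determinesI) (simp add: orb_eq_iff)

lemma orb_mono: "W \<subseteq> V \<Longrightarrow> determines M (orb V X) (orb W X)"
  by (rule determinesI) (simp add: orb_eq_iff subset_iff)

lemma fin_ent_orb_ball: "fin_ent M X \<Longrightarrow> fin_ent M (orb (\<B> n) X)"
  by (intro fin_ent_orb finite_ball ball_closed)

section \<open>The functional F under joins\<close>

lemma F_cong:
  assumes "fin_ent M Y" "determines M Y X" "determines M X Y"
  shows "F X = F Y"
proof -
  have "Hr M (\<lambda>x. (X x, tr s X x)) = Hr M (\<lambda>x. (Y x, tr s Y x))" if "s \<in> S" for s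
  proof -
    have s: "s \<in> carrier G" using that S_closed by auto
    note d = determines_trans[OF _ determines_fst] determines_trans[OF _ determines_snd]
    show ?thesis
      by (intro Hr_cong fin_ent_Pair fin_ent_tr assms(1) s determines_Pair d assms(2,3) determines_tr)
  qed
  then show ?thesis using Hr_cong[OF assms] by (simp add: F_def)
qed

text \<open>With d = H(T | A), joining T adds (1 - 2r) d to the first term of F and at most H(T | A,
  sA) + H(sT | A, sA) to the edge term of s. Spreading the 2r copies of -d over the two ends of the
  r edges leaves one d and brackets that are nonpositive, because conditioning on more decreases
  entropy.\<close>

lemma F_join_le_sum:
  assumes A: "fin_ent M A" and T: "fin_ent M T"
  shows "F (\<lambda>x. (A x, T x)) \<le> F A + cond_ent M T A +
    (\<Sum>s\<in>S. (cond_ent M T (\<lambda>x. (A x, tr s A x)) - cond_ent M T A) +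
       (cond_ent M (tr s T) (\<lambda>x. (A x, tr s A x)) - cond_ent M T A))"
proof -
  let ?J = "\<lambda>x. (A x, T x)"
  let ?c = "\<lambda>s. \<lambda>x. (A x, tr s A x)"
  let ?d = "cond_ent M T A"
  have HJ: "Hr M ?J = Hr M A + ?d"
    using Hr_cong[OF fin_ent_Pair[OF A T], of "\<lambda>x. (T x, A x)"]
    by (simp add: cond_ent_def determines_def)
  have step: "Hr M (\<lambda>x. (?J x, tr s ?J x)) \<le>
      Hr M (?c s) + cond_ent M T (?c s) + cond_ent M (tr s T) (?c s)" if "s \<in> S" for s
  proof -
    have s: "s \<in> carrier G" using that S_closed by auto
    have c: "fin_ent M (?c s)" by (intro fin_ent_Pair fin_ent_tr A s)
    have "Hr M (\<lambda>x. (?J x, tr s ?J x)) \<le> Hr M (\<lambda>x. ((T x, tr s T x), ?c s x))"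
      by (rule Hr_mono) (simp_all add: determines_def tr_def fin_ent_Pair c T fin_ent_tr[OF T s, unfolded tr_def] c[unfolded tr_def])
    then show ?thesis
      using cond_ent_Pair_le[OF T fin_ent_tr[OF T s] c] by (simp add: cond_ent_def)
  qed
  have "F ?J \<le> (1 - 2 * real (card S)) * (Hr M A + ?d) +
     (\<Sum>s\<in>S. Hr M (?c s) + cond_ent M T (?c s) + cond_ent M (tr s T) (?c s))"
    unfolding F_def HJ by (intro add_left_mono sum_mono step)
  also have "\<dots> = F A + ?d + (\<Sum>s\<in>S. (cond_ent M T (?c s) - ?d) + (cond_ent M (tr s T) (?c s) - ?d))"
    by (simp add: F_def sum.distrib sum_subtractf algebra_simps)
  finally show ?thesis .
qed

lemma cond_ent_translate_le:
  assumes A: "fin_ent M A" and T: "fin_ent M T" and s: "s \<in> carrier G"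
  shows "cond_ent M T (\<lambda>x. (A x, tr s A x)) \<le> cond_ent M T A"
    and "cond_ent M (tr s T) (\<lambda>x. (A x, tr s A x)) \<le> cond_ent M T A"
proof -
  show "cond_ent M T (\<lambda>x. (A x, tr s A x)) \<le> cond_ent M T A"
    by (intro cond_ent_mono_right fin_ent_Pair fin_ent_tr assms determines_fst)
  have "cond_ent M (tr s T) (\<lambda>x. (A x, tr s A x)) \<le> cond_ent M (tr s T) (tr s A)"
    by (intro cond_ent_mono_right fin_ent_Pair fin_ent_tr assms determines_snd)
  then show "cond_ent M (tr s T) (\<lambda>x. (A x, tr s A x)) \<le> cond_ent M T A"
    by (simp add: cond_ent_tr assms)
qed

lemma F_join_le:
  assumes A: "fin_ent M A" and T: "fin_ent M T"
  shows "F (\<lambda>x. (A x, T x)) \<le> F A + cond_ent M T A"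
proof -
  have "(\<Sum>s\<in>S. (cond_ent M T (\<lambda>x. (A x, tr s A x)) - cond_ent M T A) +
       (cond_ent M (tr s T) (\<lambda>x. (A x, tr s A x)) - cond_ent M T A)) \<le> 0"
    using cond_ent_translate_le[OF A T] S_closed by (intro sum_nonpos add_nonpos_nonpos) auto
  then show ?thesis using F_join_le_sum[OF A T] by linarith
qed

text \<open>One bracket of \<open>F_join_le_sum\<close> is at its minimum -d and pays for the extra
  d. If A and sA determine T, it is the first bracket of s; if A and (inv s)A determine T,
  translation by s shows that A and sA determine sT, and it is the second.\<close>

lemma F_join_determined_le:
  assumes A: "fin_ent M A" and T: "fin_ent M T" and s: "s \<in> S"
    and det: "determines M (\<lambda>x. (A x, tr s A x)) T \<or> determines M (\<lambda>x. (A x, tr (inv s) A x)) T"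
  shows "F (\<lambda>x. (A x, T x)) \<le> F A"
proof -
  have sc: "s \<in> carrier G" using s S_closed by auto
  let ?c = "\<lambda>s. \<lambda>x. (A x, tr s A x)"
  let ?d = "cond_ent M T A"
  let ?t = "\<lambda>s. (cond_ent M T (?c s) - ?d) + (cond_ent M (tr s T) (?c s) - ?d)"
  have c: "fin_ent M (?c s)" by (intro fin_ent_Pair fin_ent_tr A sc)
  have "?t s \<le> - ?d"
    using det
  proof
    assume "determines M (?c s) T"
    then have "cond_ent M T (?c s) = 0" by (rule cond_ent_determined[OF c])
    then show ?thesis using cond_ent_translate_le(2)[OF A T sc] by simp
  next
    assume det: "determines M (?c (inv s)) T"
    have "determines M (?c s) (tr s T)"
    proof (rule determinesI)
      fix x y assume xy: "x \<in> space M" "y \<in> space M" "?c s x = ?c s y"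
      have "tr (inv s) A (\<phi> (inv s) z) = A z" if "z \<in> space M" for z
        using that sc by (simp add: tr_def act_mult act_one)
      then show "tr s T x = tr s T y"
        unfolding tr_def using xy sc
        by (intro determinesD[OF det]) (auto simp: tr_def act_closed)
    qed
    then have "cond_ent M (tr s T) (?c s) = 0" by (rule cond_ent_determined[OF c])
    then show ?thesis using cond_ent_translate_le(1)[OF A T sc] by simp
  qed
  moreover have "(\<Sum>s\<in>S - {s}. ?t s) \<le> 0"
    using cond_ent_translate_le[OF A T] S_closed by (intro sum_nonpos add_nonpos_nonpos) auto
  ultimately have "(\<Sum>s\<in>S. ?t s) \<le> - ?d"
    using sum.remove[OF finite_S s, of ?t] by linarith
  then show ?thesis using F_join_le_sum[OF A T] by linarith
qed

text \<open>The edge terms can only grow, while the entropy grows by H(T | A) and carries the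
  coefficient 1 - 2r. This bounds the price of dropping T from a join.\<close>

lemma F_join_ge:
  assumes A: "fin_ent M A" and T: "fin_ent M T"
  shows "F A - 2 * real (card S) * cond_ent M T A \<le> F (\<lambda>x. (A x, T x))"
proof -
  let ?J = "\<lambda>x. (A x, T x)"
  have HJ: "Hr M ?J = Hr M A + cond_ent M T A"
    using Hr_cong[OF fin_ent_Pair[OF A T], of "\<lambda>x. (T x, A x)"]
    by (simp add: cond_ent_def determines_def)
  have "(\<Sum>s\<in>S. Hr M (\<lambda>x. (A x, tr s A x))) \<le> (\<Sum>s\<in>S. Hr M (\<lambda>x. (?J x, tr s ?J x)))"
  proof (intro sum_mono Hr_mono)
    fix s assume "s \<in> S"
    then show "fin_ent M (\<lambda>x. (?J x, tr s ?J x))"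
      using S_closed by (intro fin_ent_Pair fin_ent_tr A T) auto
    show "determines M (\<lambda>x. (?J x, tr s ?J x)) (\<lambda>x. (A x, tr s A x))"
      by (simp add: determines_def tr_def)
  qed
  then show ?thesis
    using cond_ent_nonneg[OF T A] unfolding F_def HJ by (simp add: algebra_simps)
qed

text \<open>The elements of the larger ball are added one at a time, each being a neighbour of an
  element of the smaller ball. R is a passive companion; later it is a join of translates of another
  variable.\<close>

lemma F_join_ball_Suc_le:
  assumes R: "fin_ent M R" and X: "fin_ent M X"
  shows "F (\<lambda>x. (R x, orb (\<B> (Suc n)) X x)) \<le> F (\<lambda>x. (R x, orb (\<B> n) X x))"
proof -
  let ?Z = "\<lambda>W x. (R x, orb W X x)"
  have "F (?Z (\<B> n \<union> V)) \<le> F (?Z (\<B> n))" if "finite V" "V \<subseteq> \<B> (Suc n)" for V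
    using that
  proof (induction V)
    case (insert g V)
    let ?W = "\<B> n \<union> V"
    have W: "finite ?W" "?W \<subseteq> carrier G" "g \<in> carrier G"
      using insert.hyps insert.prems finite_ball ball_closed[of n] ball_closed[of "Suc n"] by auto
    have fW: "fin_ent M (?Z ?W)" by (intro fin_ent_Pair fin_ent_orb R X W)
    have IH: "F (?Z ?W) \<le> F (?Z (\<B> n))" using insert by auto
    \<comment> \<open>Since h lies in the window, the translate by t of the current join already
      contains the translate by g = t h.\<close>
    have tr_det: "determines M (\<lambda>x. (?Z ?W x, tr t (?Z ?W) x)) (tr g X)"
      if "g = t \<otimes> h" "h \<in> \<B> n" "t \<in> carrier G" for t h
    proof -
      have h: "h \<in> carrier G" using that ball_closed by auto
      have "determines M (tr t (orb ?W X)) (tr t (tr h X))"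
        using that(2,3) by (intro determines_tr orb_determines_tr) auto
      moreover have "tr t (tr h X) x = tr g X x" if "x \<in> space M" for x
        using tr_mult[OF \<open>t \<in> carrier G\<close> h that] \<open>g = t \<otimes> h\<close> by simp
      ultimately have "determines M (tr t (orb ?W X)) (tr g X)"
        unfolding determines_def by metis
      then show ?thesis
        by (rule determines_trans) (simp add: determines_def tr_def)
    qed
    have "F (?Z (insert g ?W)) \<le> F (?Z ?W)"
    proof (cases "g \<in> \<B> n")
      case True
      then have "insert g ?W = ?W" by auto
      then show ?thesis by simp
    next
      case False
      have g: "g \<in> \<B> (Suc n)" using insert.prems by auto
      have "F (?Z (insert g ?W)) = F (\<lambda>x. (?Z ?W x, tr g X x))"
      proof (rule F_cong)
        show "fin_ent M (\<lambda>x. (?Z ?W x, tr g X x))" by (intro fin_ent_Pair fW fin_ent_tr X W)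
        show "determines M (\<lambda>x. (?Z ?W x, tr g X x)) (?Z (insert g ?W))"
          by (rule determinesI) (simp add: orb_eq_iff)
        show "determines M (?Z (insert g ?W)) (\<lambda>x. (?Z ?W x, tr g X x))"
          unfolding determines_def by (simp add: orb_eq_iff)
      qed
      also have "\<dots> \<le> F (?Z ?W)"
        using g
      proof (cases rule: ball_Suc_cases)
        case 1
        then show ?thesis using False by simp
      next
        case (2 s h)
        then show ?thesis using S_closed W
          by (intro F_join_determined_le[of _ _ s] fW fin_ent_tr X disjI1 tr_det[of s h]) auto
      next
        case (3 s h)
        then show ?thesis using S_closed W
          by (intro F_join_determined_le[of _ _ s] fW fin_ent_tr X disjI2 tr_det[of "inv s" h]) auto
      qed
      finally show ?thesis .
    qed
    then show ?case using IH by simp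
  qed simp
  from this[OF finite_ball order_refl] show ?thesis
    using ball_mono[of n "Suc n"] by (simp add: Un_absorb1)
qed

lemma F_join_ball_antimono:
  assumes "fin_ent M R" "fin_ent M X" "m \<le> n"
  shows "F (\<lambda>x. (R x, orb (\<B> n) X x)) \<le> F (\<lambda>x. (R x, orb (\<B> m) X x))"
  using assms(3)
proof (induction rule: dec_induct)
  case (step n)
  then show ?case using F_join_ball_Suc_le[OF assms(1,2), of n] by linarith
qed simp

lemma F_ball_antimono:
  assumes "fin_ent M X" "m \<le> n"
  shows "F (orb (\<B> n) X) \<le> F (orb (\<B> m) X)"
proof -
  have "F (\<lambda>x. ((), orb (\<B> k) X x)) = F (orb (\<B> k) X)" for k
    by (rule F_cong[OF fin_ent_orb_ball[OF assms(1)]]) (simp_all add: determines_def)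
  then show ?thesis using F_join_ball_antimono[OF fin_ent_const assms, of "()"] by simp
qed

text \<open>The type token stands for the quantification over the types of \<open>Z\<close>, which HOL lacks.\<close>

definition generates :: "('x \<Rightarrow> 'c) \<Rightarrow> 'd itself \<Rightarrow> bool" where
  "generates X (_ :: 'd itself) \<longleftrightarrow>
     (\<forall>Z :: 'x \<Rightarrow> 'd. fin_ent M Z \<longrightarrow> (\<lambda>n. cond_ent M Z (orb (\<B> n) X)) \<longlonglongrightarrow> 0)"

lemma F_ball_le_if_generates:
  fixes X :: "'x \<Rightarrow> 'c" and Y :: "'x \<Rightarrow> 'd"
  assumes X: "fin_ent M X" and Y: "fin_ent M Y"
    and XY: "generates X TYPE('d)" and YX: "generates Y TYPE('g \<Rightarrow> 'c)" and e: "e > 0"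
  shows "\<exists>n. F (orb (\<B> n) Y) \<le> F (orb (\<B> k) X) + e"
proof -
  define r where "r = real (card S)"
  \<comment> \<open>One \<delta> is spent on joining Y to the ball of X and 2r of them on dropping
    that ball again.\<close>
  define \<delta> where "\<delta> = e / (1 + 2 * r)"
  have r: "r \<ge> 0" by (simp add: r_def)
  then have "(1 + 2 * r) * \<delta> = e" by (simp add: \<delta>_def)
  then have \<delta>: "\<delta> + 2 * r * \<delta> = e" by (simp add: distrib_right)
  have "\<delta> > 0" using e r by (simp add: \<delta>_def)
  note \<delta> = this \<delta>
  have "(\<lambda>n. cond_ent M Y (orb (\<B> n) X)) \<longlonglongrightarrow> 0" using XY Y by (simp add: generates_def)
  \<comment> \<open>The condition n \<ge> k ensures that F of the larger ball of X does not exceed F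
    of its k-ball.\<close>
  then have "\<forall>\<^sub>F n in sequentially. cond_ent M Y (orb (\<B> n) X) < \<delta> \<and> n \<ge> k"
    using \<delta> by (intro eventually_conj order_tendstoD(2)[of _ 0] eventually_ge_at_top) auto
  then obtain m where m: "cond_ent M Y (orb (\<B> m) X) < \<delta>" "m \<ge> k"
    by (auto simp: eventually_sequentially)
  let ?A = "orb (\<B> m) X"
  have A: "fin_ent M ?A" by (rule fin_ent_orb_ball[OF X])
  have "(\<lambda>n. cond_ent M ?A (orb (\<B> n) Y)) \<longlonglongrightarrow> 0" using YX A by (simp add: generates_def)
  then have "\<forall>\<^sub>F n in sequentially. cond_ent M ?A (orb (\<B> n) Y) < \<delta>"
    using \<delta> by (intro order_tendstoD(2)) auto
  then obtain n where n: "cond_ent M ?A (orb (\<B> n) Y) < \<delta>"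
    by (auto simp: eventually_sequentially)
  let ?B = "orb (\<B> n) Y"
  have B: "fin_ent M ?B" by (rule fin_ent_orb_ball[OF Y])
  have Y1: "tr \<one> Y x = Y x" if "x \<in> space M" for x using that by (simp add: tr_def act_one)
  have "F ?B - 2 * r * cond_ent M ?A ?B \<le> F (\<lambda>x. (?B x, ?A x))"
    unfolding r_def by (rule F_join_ge[OF B A])
  also have "\<dots> = F (\<lambda>x. (?A x, ?B x))"
    by (rule F_cong[OF fin_ent_Pair[OF A B]]) (simp_all add: determines_def)
  also have "\<dots> \<le> F (\<lambda>x. (?A x, orb (\<B> 0) Y x))"
    by (rule F_join_ball_antimono[OF A Y]) simp
  also have "\<dots> = F (\<lambda>x. (?A x, Y x))"
    by (rule F_cong[OF fin_ent_Pair[OF A Y]])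
      (simp_all add: determines_def ball_0 orb_eq_iff Y1)
  also have "\<dots> \<le> F ?A + cond_ent M Y ?A" by (rule F_join_le[OF A Y])
  also have "F ?A \<le> F (orb (\<B> k) X)" by (rule F_ball_antimono[OF X m(2)])
  finally have "F ?B \<le> F (orb (\<B> k) X) + \<delta> + 2 * r * cond_ent M ?A ?B" using m by simp
  also have "\<dots> \<le> F (orb (\<B> k) X) + \<delta> + 2 * r * \<delta>"
    using n r by (intro add_left_mono mult_left_mono) auto
  finally show ?thesis using \<delta> by (intro exI[of _ n]) (simp add: algebra_simps)
qed

definition f_inf :: "('x \<Rightarrow> 'c) \<Rightarrow> ereal" where
  "f_inf X = (INF n. ereal (F (orb (\<B> n) X)))"

text \<open>The type tokens reflect two different roles: X has to capture Y, whereas Y has to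
  capture the joins of X over balls, whose values are functions on the group.\<close>

theorem f_inf_le_if_generates:
  fixes X :: "'x \<Rightarrow> 'c" and Y :: "'x \<Rightarrow> 'd"
  assumes "fin_ent M X" "fin_ent M Y" "generates X TYPE('d)" "generates Y TYPE('g \<Rightarrow> 'c)"
  shows "f_inf Y \<le> f_inf X"
  unfolding f_inf_def
proof (rule INF_greatest)
  fix k
  show "(INF n. ereal (F (orb (\<B> n) Y))) \<le> ereal (F (orb (\<B> k) X))"
  proof (rule ereal_le_epsilon2)
    fix e :: real assume "0 < e"
    then obtain n where "F (orb (\<B> n) Y) \<le> F (orb (\<B> k) X) + e"
      using F_ball_le_if_generates[OF assms] by blast
    then show "(INF n. ereal (F (orb (\<B> n) Y))) \<le> ereal (F (orb (\<B> k) X)) + ereal e"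
      by (intro INF_lower2[of n]) auto
  qed
qed

section \<open>From variables back to partitions\<close>

lemma enn2ereal_ent: "fin_ent M X \<Longrightarrow> enn2ereal (ent M X) = ereal (Hr M X)"
  by (simp add: ent_eq_Hr enn2ereal_ennreal)

lemma F_entropy_parts:
  assumes X: "fin_ent M X"
  shows "F_entropy S M \<phi> (parts M X) = ereal (F X)"
proof -
  have s: "enn2ereal (shannon_entropy M (common_refinement {parts M X, translate_partition \<phi> s (parts M X)}))
      = ereal (Hr M (\<lambda>x. (X x, tr s X x)))" if "s \<in> S" for s
  proof -
    have sc: "s \<in> carrier G" using that S_closed by auto
    \<comment> \<open>Booleans index the two partitions, which also covers the case that they
      coincide.\<close>
    let ?Z = "\<lambda>b. if b then X else tr s X"
    let ?J = "\<lambda>x. \<lambda>b\<in>{True, False}. ?Z b x"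
    let ?P = "\<lambda>x. (X x, tr s X x)"
    have P: "fin_ent M ?P" by (intro fin_ent_Pair fin_ent_tr X sc)
    have d: "determines M ?P ?J" "determines M ?J ?P"
      unfolding determines_def by (auto simp: fun_eq_iff)
    have "common_refinement {parts M X, translate_partition \<phi> s (parts M X)} = parts M ?J"
      using common_refinement_parts[of "{True, False}" M ?Z] by (simp add: translate_parts[OF sc])
    then show ?thesis
      using shannon_entropy_parts[OF fin_ent_discrete[OF fin_ent_determined[OF P d(1)]]]
        enn2ereal_ent[OF fin_ent_determined[OF P d(1)]] Hr_cong[OF P d] by simp
  qed
  show ?thesis
    unfolding F_entropy_def F_def
    by (simp add: s shannon_entropy_parts fin_ent_discrete X enn2ereal_ent)
qed

lemma f_partition_parts:
  assumes X: "fin_ent M X"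
  shows "f_partition G S M \<phi> (parts M X) = f_inf X"
proof -
  have "common_refinement ((\<lambda>g. translate_partition \<phi> g (parts M X)) ` \<B> n) = parts M (orb (\<B> n) X)" for n
  proof -
    have "(\<lambda>g. translate_partition \<phi> g (parts M X)) ` \<B> n = (\<lambda>g. parts M (tr g X)) ` \<B> n"
      using ball_closed by (intro image_cong refl translate_parts) auto
    then show ?thesis
      using common_refinement_parts[of "\<B> n" M "\<lambda>g. tr g X"] one_in_ball[of n]
      by (auto simp: orb_def)
  qed
  then show ?thesis
    unfolding f_partition_def f_inf_def by (simp add: F_entropy_parts fin_ent_orb_ball X)
qed

text \<open>Modulo null sets every event lies in the sigma-algebra of translates of classes, and the
  translate of a class by g is determined by the join over any ball containing g. Asking X to
  recover the classes only modulo null sets admits partitions with uncountably many null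
  classes.\<close>

lemma generates_if_generating_partition:
  assumes gen: "generating_partition G M \<phi> \<alpha>" and X: "fin_ent M X"
    and approx: "\<And>A. A \<in> \<alpha> \<Longrightarrow> \<exists>P. prob (sym_diff A {x \<in> space M. P (X x)}) = 0"
  shows "generates X TYPE('d)"
  unfolding generates_def
proof (intro allI impI)
  fix Z :: "'x \<Rightarrow> 'd"
  assume Z: "fin_ent M Z"
  show "(\<lambda>n. cond_ent M Z (orb (\<B> n) X)) \<longlonglongrightarrow> 0"
  proof (rule cond_ent_tendsto_0[OF fin_ent_orb_ball[OF X] Z])
    fix c
    let ?B = "{x \<in> space M. Z x = c}"
    let ?A = "\<Union>g\<in>carrier G. translate_partition \<phi> g \<alpha>"
    have \<alpha>: "\<alpha> \<subseteq> events" using gen by (auto simp: generating_partition_def measurable_partition_def)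
    then have A: "?A \<subseteq> events" by (auto simp: translate_partition_def image_act_events)
    have B: "?B \<in> events" using Z by (auto simp: fin_ent_def discrete_var_def)
    then obtain B' where B': "B' \<in> sigma_sets (space M) ?A" "prob (sym_diff ?B B') = 0"
      using gen unfolding generating_partition_def generated_algebra_def by blast
    have B'e: "B' \<in> events" using B'(1) sets.sigma_sets_subset[OF A] by blast
    have "(\<lambda>n. cond_ent M (\<lambda>x. x \<in> B') (orb (\<B> n) X)) \<longlonglongrightarrow> 0"
    proof (rule cond_ent_sigma_sets_tendsto_0[OF fin_ent_orb_ball[OF X] A _ B'(1)])
      fix C assume "C \<in> ?A"
      then obtain g D where gD: "g \<in> carrier G" "D \<in> \<alpha>" "C = \<phi> g ` D"
        by (auto simp: translate_partition_def)
      obtain P where P: "prob (sym_diff D {x \<in> space M. P (X x)}) = 0" using approx gD by blast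
      let ?D = "{x \<in> space M. P (X x)}" and ?C = "{x \<in> space M. P (tr g X x)}"
      have De: "D \<in> events" "?D \<in> events"
        using gD \<alpha> discrete_var_Collect[OF fin_ent_discrete[OF X]] by auto
      have Ce: "C \<in> events" "?C \<in> events"
        using gD De image_act_events discrete_var_Collect[OF fin_ent_discrete[OF fin_ent_tr[OF X gD(1)]]] by auto
      have "?C = \<phi> g ` ?D" using image_act_Collect[OF gD(1)] by (simp add: tr_def)
      moreover have "\<phi> g ` (U - V) = \<phi> g ` U - \<phi> g ` V" if "U \<subseteq> space M" "V \<subseteq> space M" for U V
        using inj_on_image_set_diff[OF inj_prop[OF gD(1)], of U V] that by auto
      ultimately have "sym_diff C ?C = \<phi> g ` sym_diff D ?D"
        using sets.sets_into_space[OF De(1)] sets.sets_into_space[OF De(2)]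
        by (simp only: gD(3) image_Un)
      then have null: "prob (sym_diff C ?C) = 0"
        using image_act_events(2)[OF gD(1), of "sym_diff D ?D"] De P by (simp only:) auto
      obtain N where N: "g \<in> \<B> N" using ball_exhausts[OF gD(1)] .
      have "cond_ent M (\<lambda>x. x \<in> C) (orb (\<B> n) X) = 0" if "n \<ge> N" for n
      proof -
        have "determines M (orb (\<B> n) X) (tr g X)"
          using ball_mono[OF that] N by (intro orb_determines_tr) auto
        moreover have "determines M (tr g X) (\<lambda>x. x \<in> ?C)" by (simp add: determines_def)
        ultimately have "cond_ent M (\<lambda>x. x \<in> ?C) (orb (\<B> n) X) = 0"
          by (intro cond_ent_determined fin_ent_orb_ball X) (rule determines_trans)
        then show ?thesis
          using cond_ent_event_sym_diff[OF Ce fin_ent_orb_ball[OF X] null, of n]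
            cond_ent_nonneg[OF fin_ent_event[OF Ce(1)] fin_ent_orb_ball[OF X], of n] by simp
      qed
      then show "(\<lambda>n. cond_ent M (\<lambda>x. x \<in> C) (orb (\<B> n) X)) \<longlonglongrightarrow> 0"
        by (intro tendsto_eventually) (auto simp: eventually_sequentially)
    qed
    then show "(\<lambda>n. cond_ent M (\<lambda>x. x \<in> ?B) (orb (\<B> n) X)) \<longlonglongrightarrow> 0"
      by (rule tendsto_0_sandwich[rotated 2])
        (intro cond_ent_nonneg cond_ent_event_sym_diff fin_ent_event fin_ent_orb_ball B B'e B'(2) X)+
  qed
qed

end

section \<open>Words in free groups\<close>

definition esum :: "('g \<times> bool) list \<Rightarrow> int" where
  "esum w = (\<Sum>(s, b)\<leftarrow>w. if b then 1 else - 1)"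

lemma esum_simps [simp]:
  "esum [] = 0" "esum ((s, b) # w) = (if b then 1 else - 1) + esum w" "esum (v @ w) = esum v + esum w"
  by (simp_all add: esum_def)

lemma reduced_Cons:
  "reduced ((s, b) # w) \<longleftrightarrow> reduced w \<and> (\<forall>v. w \<noteq> (s, \<not> b) # v)"
  by (cases w) (auto simp: reduced_def)

lemma free_generating_set_carrier_words:
  assumes "free_generating_set G S"
  shows "S \<subseteq> carrier G" "carrier G \<subseteq> word_val G ` lists (S \<times> UNIV)"
  using assms by (auto simp: free_generating_set_def bij_betw_def)

lemma reduced_Nil [simp]: "reduced []"
  by (simp add: reduced_def)

locale free_group = generated_group G S for G :: "'g monoid" (structure) and S :: "'g set" +
  assumes free: "free_generating_set G S"
begin

abbreviation letters where "letters \<equiv> S \<times> (UNIV :: bool set)"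

definition red_words :: "('g \<times> bool) list set" where
  "red_words = {w \<in> lists letters. reduced w}"

lemma bij_word_val: "bij_betw (word_val G) red_words (carrier G)"
  using free by (simp add: free_generating_set_def red_words_def)

lemma word_val_append:
  "v \<in> lists letters \<Longrightarrow> w \<in> lists letters \<Longrightarrow> word_val G (v @ w) = word_val G v \<otimes> word_val G w"
proof (induction v)
  case Nil
  then show ?case by (simp add: word_val_closed)
next
  case (Cons a v)
  obtain s b where a: "a = (s, b)" by (cases a)
  then have "s \<in> carrier G" using Cons S_closed by auto
  then show ?case using Cons by (cases b) (simp_all add: a m_assoc word_val_closed)
qed

lemma word_val_cancel:
  "s \<in> S \<Longrightarrow> w \<in> lists letters \<Longrightarrow> word_val G ((s, b) # (s, \<not> b) # w) = word_val G w"
  using S_closed word_val_closed[of w] by (cases b) (auto simp flip: m_assoc)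

text \<open>Free reduction, with three quantities tracked at once: besides the value, the exponent
  sum lets \<open>exponent\<close> be read off any word, and the length bound lets balls be counted
  by reduced words.\<close>

lemma ex_red_word:
  assumes "w \<in> lists letters"
  shows "\<exists>v\<in>red_words. word_val G v = word_val G w \<and> esum v = esum w \<and> length v \<le> length w"
  using assms
proof (induction w)
  case Nil
  then show ?case by (auto simp: red_words_def intro!: bexI[of _ "[]"])
next
  case (Cons a w)
  obtain s b where a: "a = (s, b)" by (cases a)
  have s: "s \<in> S" using Cons a by auto
  obtain v where v: "v \<in> red_words" "word_val G v = word_val G w" "esum v = esum w" "length v \<le> length w"
    using Cons by auto
  show ?case
  proof (cases "\<exists>u. v = (s, \<not> b) # u")
    case True
    then obtain u where u: "v = (s, \<not> b) # u" by blast
    then have "u \<in> red_words" using v(1) by (auto simp: red_words_def reduced_Cons)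
    moreover have "word_val G (a # w) = word_val G ((s, b) # v)" using a v by simp
    moreover have "word_val G ((s, b) # v) = word_val G u"
      unfolding u using \<open>u \<in> red_words\<close> s by (intro word_val_cancel) (auto simp: red_words_def)
    moreover have "esum u = esum (a # w)" using a v(3) u by (cases b) auto
    ultimately show ?thesis using u v by (intro bexI[of _ u]) auto
  next
    case False
    then have "(s, b) # v \<in> red_words" using v(1) s by (auto simp: red_words_def reduced_Cons)
    then show ?thesis using v a by (intro bexI[of _ "(s, b) # v"]) auto
  qed
qed

section \<open>Normal forms and the exponent homomorphism\<close>

definition red :: "'g \<Rightarrow> ('g \<times> bool) list" where
  "red g = inv_into red_words (word_val G) g"

lemma red_in: "g \<in> carrier G \<Longrightarrow> red g \<in> red_words"
  unfolding red_def using bij_word_val by (metis bij_betw_imp_surj_on inv_into_into)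

lemma word_val_red: "g \<in> carrier G \<Longrightarrow> word_val G (red g) = g"
  unfolding red_def using bij_word_val by (metis bij_betw_inv_into_right)

lemma red_word_val: "w \<in> red_words \<Longrightarrow> red (word_val G w) = w"
  unfolding red_def using bij_word_val by (metis bij_betw_inv_into_left)

text \<open>The homomorphism to the integers that sends every generator to 1; modulo N it drives the
  finite cyclic factor.\<close>

definition exponent :: "'g \<Rightarrow> int" where
  "exponent g = esum (red g)"

lemma exponent_word_val:
  assumes "w \<in> lists letters"
  shows "exponent (word_val G w) = esum w"
proof -
  obtain v where v: "v \<in> red_words" "word_val G v = word_val G w" "esum v = esum w"
    using ex_red_word[OF assms] by blast
  then show ?thesis using red_word_val[OF v(1)] by (simp add: exponent_def)
qed

lemma exponent_mult:
  assumes "g \<in> carrier G" "h \<in> carrier G"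
  shows "exponent (g \<otimes> h) = exponent g + exponent h"
proof -
  obtain v where "v \<in> lists letters" "g = word_val G v"
    using subsetD[OF carrier_words assms(1)] by auto
  moreover obtain w where "w \<in> lists letters" "h = word_val G w"
    using subsetD[OF carrier_words assms(2)] by auto
  ultimately show ?thesis
    using exponent_word_val[of "v @ w"] by (simp add: exponent_word_val word_val_append)
qed

lemma exponent_one: "exponent \<one> = 0"
  using exponent_word_val[of "[]"] by simp

lemma exponent_inv: "g \<in> carrier G \<Longrightarrow> exponent (inv g) = - exponent g"
  using exponent_mult[of "inv g" g] by (simp add: exponent_one)

lemma exponent_generator: "s \<in> S \<Longrightarrow> exponent s = 1"
  using exponent_word_val[of "[(s, True)]"] S_closed by auto

lemma exponent_pow: "g \<in> carrier G \<Longrightarrow> exponent (g [^] (n::int)) = n * exponent g"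
proof (induction n rule: int_induct[where k=0])
  case base
  then show ?case by (simp add: exponent_one)
next
  case (step1 i)
  have "exponent (g [^] (i + 1)) = exponent (g [^] i \<otimes> g)"
    using int_pow_mult[OF step1(3), of i 1] step1(3) by simp
  then show ?case using step1 by (simp add: exponent_mult algebra_simps)
next
  case (step2 i)
  have "exponent (g [^] (i - 1)) = exponent (g [^] i \<otimes> inv g)"
    using int_pow_diff[OF step2(3), of i 1] step2(3) by simp
  then show ?case using step2 by (simp add: exponent_mult exponent_inv algebra_simps)
qed

lemma countable_carrier: "countable (carrier G)"
proof -
  have "countable letters" using finite_S by (intro countable_finite finite_cartesian_product) auto
  then show ?thesis
    using carrier_words by (meson countable_image countable_lists countable_subset)
qed

section \<open>Vertices and edges of balls\<close>

lemma ball_eq_red: "\<B> n = word_val G ` {w \<in> red_words. length w \<le> n}"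
proof (intro equalityI subsetI)
  fix g assume "g \<in> \<B> n"
  then obtain w where w: "w \<in> lists letters" "length w \<le> n" "g = word_val G w"
    unfolding word_ball_def by blast
  then obtain v where "v \<in> red_words" "word_val G v = g" "length v \<le> n"
    using ex_red_word[OF w(1)] by auto
  then show "g \<in> word_val G ` {w \<in> red_words. length w \<le> n}" by blast
qed (auto simp: word_ball_def red_words_def)

lemma length_red_ball: "g \<in> \<B> n \<Longrightarrow> length (red g) \<le> n"
  unfolding ball_eq_red using red_word_val by auto

lemma word_val_in_ball: "w \<in> red_words \<Longrightarrow> length w \<le> n \<Longrightarrow> word_val G w \<in> \<B> n"
  unfolding ball_eq_red by blast

lemma finite_red_ball: "finite {w \<in> red_words. length w \<le> n}"
proof (rule finite_subset)
  show "{w \<in> red_words. length w \<le> n} \<subseteq> {w. set w \<subseteq> letters \<and> length w \<le> n}"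
    by (auto simp: red_words_def)
  show "finite {w. set w \<subseteq> letters \<and> length w \<le> n}"
    using finite_S by (intro finite_lists_length_le finite_cartesian_product) auto
qed

lemma card_ball: "card (\<B> n) = card {w \<in> red_words. length w \<le> n}"
  unfolding ball_eq_red using bij_word_val
  by (intro card_image) (auto simp: bij_betw_def intro: inj_on_subset)

text \<open>The edges of the Cayley tree inside a ball are matched with the vertices other than the
  root: each such vertex is joined to its parent, obtained by deleting the first letter.\<close>

lemma sum_card_ball_edges:
  "(\<Sum>s\<in>S. card {g \<in> \<B> n. inv s \<otimes> g \<in> \<B> n}) + 1 = card (\<B> n)"
proof -
  let ?R = "{w \<in> red_words. length w \<le> n}"
  let ?E = "SIGMA s:S. {g \<in> \<B> n. inv s \<otimes> g \<in> \<B> n}"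
  \<comment> \<open>The pair (s, g) is the edge from inv s g to g. If w starts with s, then w
    represents g and its parent is inv s g; if w starts with the inverse of s, then w represents inv
    s g and g is the parent.\<close>
  let ?f = "\<lambda>w. (fst (hd w), word_val G (if snd (hd w) then w else tl w))"
  let ?h = "\<lambda>(s, g). if \<exists>v. red g = (s, True) # v then red g else (s, False) # red g"
  have "bij_betw ?f (?R - {[]}) ?E"
  proof (rule bij_betw_byWitness[where f' = ?h])
    show "\<forall>w\<in>?R - {[]}. ?h (?f w) = w"
    proof
      fix w assume w: "w \<in> ?R - {[]}"
      then obtain s b v where wv: "w = (s, b) # v" by (cases w) auto
      then have v: "v \<in> red_words" "\<forall>u. v \<noteq> (s, \<not> b) # u" using w by (auto simp: red_words_def reduced_Cons)
      have "w \<in> red_words" using w by simp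
      then show "?h (?f w) = w"
        using wv v red_word_val[of w] red_word_val[of v] by (cases b) (auto simp del: word_val_Cons)
    qed
    show "\<forall>p\<in>?E. ?f (?h p) = p"
    proof
      fix p assume "p \<in> ?E"
      then obtain s g where p: "p = (s, g)" "s \<in> S" "g \<in> \<B> n" by auto
      then have "word_val G (red g) = g" using ball_closed word_val_red by auto
      then show "?f (?h p) = p" using p by (auto simp del: word_val_Cons)
    qed
    show "?f ` (?R - {[]}) \<subseteq> ?E"
    proof (rule image_subsetI)
      fix w assume w: "w \<in> ?R - {[]}"
      then obtain s b v where wv: "w = (s, b) # v" by (cases w) auto
      have s: "s \<in> S" "s \<in> carrier G" using w wv S_closed by (auto simp: red_words_def)
      have v: "v \<in> red_words" "length v \<le> n" using w wv by (auto simp: red_words_def reduced_Cons)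
      have wb: "word_val G w \<in> \<B> n" "word_val G v \<in> \<B> n"
        using w v by (auto intro: word_val_in_ball)
      have vc: "word_val G v \<in> carrier G" using wb(2) ball_closed by auto
      show "?f w \<in> ?E"
        using wb s vc unfolding wv by (cases b) (auto simp flip: m_assoc)
    qed
    show "?h ` ?E \<subseteq> ?R - {[]}"
    proof (rule image_subsetI)
      fix p assume "p \<in> ?E"
      then obtain s g where p: "p = (s, g)" "s \<in> S" "g \<in> \<B> n" "inv s \<otimes> g \<in> \<B> n" by auto
      have g: "red g \<in> red_words" "length (red g) \<le> n" "word_val G (red g) = g"
        using p ball_closed word_val_red red_in length_red_ball by auto
      show "?h p \<in> ?R - {[]}"
      proof (cases "\<exists>v. red g = (s, True) # v")
        case True
        then show ?thesis using p g by auto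
      next
        case False
        then have r: "(s, False) # red g \<in> red_words"
          using g p by (auto simp: red_words_def reduced_Cons)
        have "red (inv s \<otimes> g) = (s, False) # red g"
          using red_word_val[OF r] g by simp
        then show ?thesis using False r p length_red_ball[OF p(4)] by auto
      qed
    qed
  qed
  then have "card (?R - {[]}) = card ?E" by (rule bij_betw_same_card)
  also have "card ?E = (\<Sum>s\<in>S. card {g \<in> \<B> n. inv s \<otimes> g \<in> \<B> n})"
    using finite_S finite_ball by (intro card_SigmaI) auto
  finally show ?thesis
    using card_Suc_Diff1[OF finite_red_ball, of "[]" n] by (simp add: card_ball red_words_def)
qed

text \<open>|B \<union> sB| is the number of translates that occur in the edge term of s. As |B
  \<inter> sB| counts the edges labelled s in the ball, inclusion-exclusion and the tree count give
  2r|B| - (|B| - 1) in total.\<close>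

lemma sum_card_ball_Un:
  "real (\<Sum>s\<in>S. card (\<B> n \<union> (\<lambda>g. s \<otimes> g) ` \<B> n)) =
    (2 * real (card S) - 1) * real (card (\<B> n)) + 1"
proof -
  let ?B = "\<B> n"
  have "real (card (?B \<union> (\<lambda>g. s \<otimes> g) ` ?B)) =
      2 * real (card ?B) - real (card {g \<in> ?B. inv s \<otimes> g \<in> ?B})" if "s \<in> S" for s
  proof -
    have s: "s \<in> carrier G" using that S_closed by auto
    have "inj_on (\<lambda>g. s \<otimes> g) ?B"
      using s ball_closed[of n] by (intro inj_onI) (simp add: subset_iff)
    then have c: "card ((\<lambda>g. s \<otimes> g) ` ?B) = card ?B" by (rule card_image)
    have "?B \<inter> (\<lambda>g. s \<otimes> g) ` ?B = {g \<in> ?B. inv s \<otimes> g \<in> ?B}"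
    proof (intro equalityI subsetI)
      fix g assume "g \<in> {g \<in> ?B. inv s \<otimes> g \<in> ?B}"
      then have g: "g \<in> ?B" "inv s \<otimes> g \<in> ?B" by auto
      then have "g \<in> carrier G" using ball_closed by auto
      then have "g = s \<otimes> (inv s \<otimes> g)" using s by (simp flip: m_assoc)
      with g show "g \<in> ?B \<inter> (\<lambda>g. s \<otimes> g) ` ?B" by blast
    next
      fix g assume "g \<in> ?B \<inter> (\<lambda>g. s \<otimes> g) ` ?B"
      then obtain h where "g \<in> ?B" "h \<in> ?B" "g = s \<otimes> h" by auto
      moreover from this have "inv s \<otimes> g = h"
        using s subsetD[OF ball_closed] by (simp flip: m_assoc)
      ultimately show "g \<in> {g \<in> ?B. inv s \<otimes> g \<in> ?B}" by simp
    qed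
    then show ?thesis
      using card_Un_Int[OF finite_ball finite_imageI[OF finite_ball], of n "\<lambda>g. s \<otimes> g" n] c by simp
  qed
  then have "real (\<Sum>s\<in>S. card (?B \<union> (\<lambda>g. s \<otimes> g) ` ?B)) =
      (\<Sum>s\<in>S. 2 * real (card ?B) - real (card {g \<in> ?B. inv s \<otimes> g \<in> ?B}))"
    by simp
  also have "\<dots> = 2 * real (card S) * real (card ?B) - (real (card ?B) - 1)"
    using sum_card_ball_edges[of n, symmetric] by (simp add: sum_subtractf)
  finally show ?thesis by (simp add: algebra_simps)
qed

text \<open>Powers of one generator suffice, being separated by their exponents. For n = N these
  elements fix the phase, and there are enough of them to move a finite window off itself.\<close>

lemma infinite_exponent_kernel:
  assumes "\<not> cyclic_group G" and n: "n > 0"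
  shows "infinite {g \<in> carrier G. exponent g mod n = 0}"
proof -
  have "S \<noteq> {}"
  proof
    assume "S = {}"
    then have "carrier G = {\<one>}" using carrier_words by auto
    then show False using assms(1) trivial_imp_cyclic_group[of G] by (simp add: trivial_group_def group_axioms)
  qed
  then obtain s where s: "s \<in> S" by auto
  then have sc: "s \<in> carrier G" using S_closed by auto
  have "inj (\<lambda>k::int. s [^] (n * k))"
  proof (rule injI)
    fix k l :: int assume "s [^] (n * k) = s [^] (n * l)"
    then have "exponent (s [^] (n * k)) = exponent (s [^] (n * l))" by simp
    then show "k = l" using n s sc by (simp add: exponent_pow exponent_generator)
  qed
  then have "infinite (range (\<lambda>k::int. s [^] (n * k)))"
    using range_inj_infinite infinite_UNIV_int finite_imageD by blast
  moreover have "range (\<lambda>k::int. s [^] (n * k)) \<subseteq> {g \<in> carrier G. exponent g mod n = 0}"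
    using s sc by (auto simp: exponent_pow exponent_generator)
  ultimately show ?thesis using finite_subset by blast
qed

text \<open>Here non-cyclicity becomes quantitative: r \<ge> 2 makes (r - 1) ln N unbounded in
  N.\<close>

lemma card_generators_ge_2:
  assumes "\<not> cyclic_group G"
  shows "card S \<ge> 2"
proof (rule ccontr)
  assume "\<not> card S \<ge> 2"
  then consider "S = {}" | s where "S = {s}"
    using finite_S by (metis One_nat_def card_1_singleton_iff card_0_eq less_2_cases not_le)
  then show False
  proof cases
    case 1
    then have "carrier G = {\<one>}" using carrier_words by auto
    then show False using assms(1) trivial_imp_cyclic_group[of G] by (simp add: trivial_group_def group_axioms)
  next
    case (2 s)
    then have s: "s \<in> carrier G" using S_closed by auto
    have "word_val G w \<in> range (\<lambda>n::int. s [^] n)" if "w \<in> lists letters" for w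
      using that
    proof (induction w)
      case Nil
      have "\<one> = s [^] (0::int)" by simp
      then show ?case by (simp only: word_val_Nil rangeI)
    next
      case (Cons a w)
      obtain b where a: "a = (s, b)" using Cons 2 by (cases a) auto
      obtain n :: int where n: "word_val G w = s [^] n" using Cons by auto
      have "word_val G (a # w) = s [^] ((if b then 1 else - 1) + n)"
        using s by (simp add: a n int_pow_mult int_pow_neg)
      then show ?case by (simp only: rangeI)
    qed
    then have "word_val G ` lists letters \<subseteq> range (\<lambda>n::int. s [^] n)" by (rule image_subsetI)
    then have "carrier G = range (\<lambda>n::int. s [^] n)"
      using carrier_words s by (intro equalityI) auto
    then show False using assms s cyclic_group by blast
  qed
qed

end

section \<open>Lower bound for generating partitions and ergodicity\<close>

context prob_space
begin

text \<open>The information of the finer variable dominates that of the coarser one almost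
  everywhere; having the same finite integral, the two agree almost everywhere.\<close>

lemma AE_fiber_prob_eq:
  assumes X: "fin_ent M X" and YX: "determines M X Y" and eq: "Hr M X = Hr M Y"
  shows "AE x in M. fiber_prob M X (X x) = fiber_prob M Y (Y x)"
proof -
  have Y: "fin_ent M Y" by (rule fin_ent_determined[OF X YX])
  note dX = fin_ent_discrete[OF X] and dY = fin_ent_discrete[OF Y]
  note pos = AE_fiber_prob_pos[OF dX] AE_fiber_prob_pos[OF dY]
  have le: "AE x in M. info M Y x \<le> info M X x"
    using pos AE_space
  proof eventually_elim
    case (elim x)
    then show ?case
      using fiber_prob_determines_mono[OF YX dY elim(3)] by (simp add: info_def ennreal_leI)
  qed
  have "(\<integral>\<^sup>+x. info M X x - info M Y x \<partial>M) = ent M X - ent M Y"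
    unfolding ent_def using le Y dX dY
    by (intro nn_integral_diff measurable_info) (auto simp: fin_ent_def ent_def)
  also have "\<dots> = 0" using eq by (simp add: ent_eq_Hr X Y)
  finally have "AE x in M. info M X x - info M Y x = 0"
    using dX dY by (subst (asm) nn_integral_0_iff_AE) (auto intro!: borel_measurable_minus_ennreal measurable_info)
  then show ?thesis
    using le pos
  proof eventually_elim
    case (elim x)
    then have "info M X x = info M Y x"
      by (metis antisym ennreal_minus_eq_0 ) 
    then have "- ln (fiber_prob M X (X x)) = - ln (fiber_prob M Y (Y x))"
      unfolding info_def by (subst (asm) ennreal_inj) auto
    then show ?case using elim by simp
  qed
qed

text \<open>The bound -p ln p \<le> 1 per class is cruder than the logarithm of the number of
  classes, but it suffices to turn unbounded entropy into an unbounded number of classes.\<close>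

lemma shannon_entropy_le_card:
  assumes "measurable_partition M \<alpha>" "finite \<alpha>"
  shows "shannon_entropy M \<alpha> \<le> of_nat (card \<alpha>)"
proof -
  have "\<Union>\<alpha> = space M" using assms by (auto simp: measurable_partition_def dest: partition_onD1)
  then have "shannon_entropy M \<alpha> = (\<Sum>A\<in>\<alpha>. ennreal (- (prob A * ln (prob A))))"
    unfolding shannon_entropy_def using assms(2) prob_space
    by (subst if_P) (auto intro!: exI[of _ \<alpha>] countable_finite)
  also have "\<dots> \<le> (\<Sum>A\<in>\<alpha>. 1)"
  proof (rule sum_mono)
    fix A assume "A \<in> \<alpha>"
    have "- (p * ln p) \<le> 1" if "0 \<le> p" for p :: real
    proof (cases "p = 0")
      case False
      then have p: "p > 0" using that by simp
      then have "p * ln (1 / p) \<le> p * (1 / p - 1)"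
        using that by (intro mult_left_mono ln_le_minus_one) auto
      also have "\<dots> \<le> 1" using p by (simp add: algebra_simps)
      finally show ?thesis using p by (simp add: ln_div)
    qed simp
    then show "ennreal (- (prob A * ln (prob A))) \<le> 1"
      by (simp add: ennreal_le_1)
  qed
  finally show ?thesis by simp
qed

end

context pmp_system
begin

lemma determines_orb:
  assumes "determines M Y X" "W \<subseteq> carrier G"
  shows "determines M (orb W Y) (orb W X)"
proof (rule determinesI)
  fix x y assume xy: "x \<in> space M" "y \<in> space M" "orb W Y x = orb W Y y"
  have "tr g X x = tr g X y" if "g \<in> W" for g
    using determinesD[OF determines_tr[OF assms(1)] xy(1,2), of g] xy(3) that assms(2)
    by (auto simp: orb_eq_iff)
  then show "orb W X x = orb W X y" by (simp add: orb_eq_iff)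
qed

lemma generates_mono:
  assumes Y: "fin_ent M Y" and YX: "determines M Y X" and gen: "generates X TYPE('d)"
  shows "generates Y TYPE('d)"
  unfolding generates_def
proof (intro allI impI)
  fix Z :: "'x \<Rightarrow> 'd" assume Z: "fin_ent M Z"
  have "(\<lambda>n. cond_ent M Z (orb (\<B> n) X)) \<longlonglongrightarrow> 0" using gen Z by (simp add: generates_def)
  then show "(\<lambda>n. cond_ent M Z (orb (\<B> n) Y)) \<longlonglongrightarrow> 0"
    by (rule tendsto_0_sandwich[rotated 2])
      (intro cond_ent_nonneg cond_ent_mono_right Z fin_ent_orb_ball Y determines_orb YX ball_closed)+
qed

text \<open>J = (X, Y) and its translate sJ share the invariant Y, so H(J, sJ) \<le> 2 H(J) - H(Y).
  The terms 2r H(J) cancel, which leaves H(J) - r H(Y).\<close>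

lemma F_join_invariant_le:
  assumes X: "fin_ent M X" and Y: "fin_ent M Y"
    and inv: "\<And>s. s \<in> S \<Longrightarrow> determines M Y (tr s Y)" "\<And>s. s \<in> S \<Longrightarrow> determines M (tr s Y) Y"
  shows "F (\<lambda>x. (X x, Y x)) \<le> Hr M X + (1 - real (card S)) * Hr M Y"
proof -
  let ?J = "\<lambda>x. (X x, Y x)"
  have J: "fin_ent M ?J" by (rule fin_ent_Pair[OF X Y])
  have step: "Hr M (\<lambda>x. (?J x, tr s ?J x)) \<le> 2 * Hr M ?J - Hr M Y" if "s \<in> S" for s
  proof -
    have s: "s \<in> carrier G" using that S_closed by auto
    have "determines M (tr s ?J) (tr s Y)" by (simp add: determines_def tr_def)
    from determines_trans[OF inv(2)[OF that] this]
    have "Hr M (\<lambda>x. (?J x, tr s ?J x)) + Hr M Y \<le> Hr M ?J + Hr M (tr s ?J)"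
      by (intro Hr_submodular J fin_ent_tr s determines_snd determines_refl)
    also have "Hr M (tr s ?J) = Hr M ?J" by (rule Hr_tr[OF fin_ent_discrete[OF J] s])
    finally show ?thesis by simp
  qed
  have "F ?J \<le> (1 - 2 * real (card S)) * Hr M ?J + (\<Sum>s\<in>S. 2 * Hr M ?J - Hr M Y)"
    unfolding F_def by (intro add_left_mono sum_mono step)
  also have "\<dots> = Hr M ?J - real (card S) * Hr M Y" by (simp add: algebra_simps)
  also have "Hr M ?J \<le> Hr M X + Hr M Y"
    using Hr_submodular[OF X Y, of "\<lambda>_. ()" ?J] by (simp add: determines_def Hr_const)
  finally show ?thesis by (simp add: algebra_simps)
qed

text \<open>A partition of finite entropy may have uncountably many classes, but all of them outside
  a countable subcollection are null. Merging these into one null class keeps the entropy, and every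
  class stays recoverable modulo a null set.\<close>

lemma generating_partition_finite_entropy:
  assumes gen: "generating_partition G M \<phi> \<alpha>" and fin: "shannon_entropy M \<alpha> < \<infinity>"
  obtains X :: "'x \<Rightarrow> 'x set" where "fin_ent M X" "ent M X = shannon_entropy M \<alpha>"
    "generates X TYPE('d)" 
proof -
  have \<alpha>: "partition_on (space M) \<alpha>" "\<alpha> \<subseteq> events"
    using gen by (auto simp: generating_partition_def measurable_partition_def)
  obtain \<beta> where \<beta>: "\<beta> \<subseteq> \<alpha>" "countable \<beta>" "prob (\<Union>\<beta>) = 1"
    using fin unfolding shannon_entropy_def by (auto split: if_splits)
  define N where "N = space M - \<Union>\<beta>"
  \<comment> \<open>Classes of a partition are nonempty, so N is added only if it is.\<close>
  define \<beta>' where "\<beta>' = (if N = {} then \<beta> else insert N \<beta>)"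
  have Ub: "\<Union>\<beta> \<in> events" using \<beta> \<alpha>(2) by (intro sets.countable_Union) auto
  then have N: "N \<in> events" "prob N = 0"
    using prob_compl[OF Ub] \<beta>(3) by (auto simp: N_def)
  have sub: "A \<subseteq> space M" "A \<noteq> {}" if "A \<in> \<alpha>" for A
    using that partition_onD1[OF \<alpha>(1)] partition_onD3[OF \<alpha>(1)] by auto
  have null: "A \<subseteq> N" if "A \<in> \<alpha>" "A \<notin> \<beta>" for A
  proof -
    have "A \<inter> B = {}" if "B \<in> \<beta>" for B
      using disjointD[OF partition_onD2[OF \<alpha>(1)], of A B] that \<beta>(1) \<open>A \<in> \<alpha>\<close> \<open>A \<notin> \<beta>\<close> by blast
    then show ?thesis using sub(1)[OF that(1)] by (auto simp: N_def)
  qed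
  have null0: "prob A = 0" if "A \<in> \<alpha>" "A \<notin> \<beta>" for A
    using finite_measure_mono[OF null[OF that] N(1)] N(2) measure_nonneg[of M A] by linarith
  have part: "measurable_partition M \<beta>'"
    unfolding measurable_partition_def
  proof
    show "partition_on (space M) \<beta>'"
    proof (rule partition_onI)
      show "\<Union>\<beta>' = space M" using \<beta>(1) sub by (auto simp: \<beta>'_def N_def)
      show "disjnt p q" if "p \<in> \<beta>'" "q \<in> \<beta>'" "p \<noteq> q" for p q
      proof -
        have "disjnt p q" if "p \<in> \<beta>" "q \<in> \<beta>" "p \<noteq> q"
          using disjointD[OF partition_onD2[OF \<alpha>(1)], of p q] that \<beta>(1) by (auto simp: disjnt_def)
        moreover have "disjnt N q" "disjnt q N" if "q \<in> \<beta>" for q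
          using that by (auto simp: N_def disjnt_def)
        ultimately show ?thesis using that by (auto simp: \<beta>'_def split: if_splits)
      qed
      show "{} \<notin> \<beta>'" using \<beta>(1) partition_onD3[OF \<alpha>(1)] by (auto simp: \<beta>'_def)
    qed
    show "\<beta>' \<subseteq> events" using \<beta>(1) \<alpha>(2) N by (auto simp: \<beta>'_def)
  qed
  have count: "countable \<beta>'" using \<beta> by (simp add: \<beta>'_def)
  obtain X :: "'x \<Rightarrow> 'x set" where X: "discrete_var M X" "parts M X = \<beta>'"
      "\<And>A. A \<in> \<beta>' \<Longrightarrow> A = {x \<in> space M. X x = A}"
    using measurable_partition_eq_parts[OF part count] by metis
  let ?h = "\<lambda>A. ennreal (- (prob A * ln (prob A)))"
  have "shannon_entropy M \<alpha> = infsum ?h \<alpha>"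
    unfolding shannon_entropy_def using \<beta> by (subst if_P) auto
  also have "\<dots> = infsum ?h \<beta>'"
    using null0 \<beta>(1) N by (intro infsum_cong_neutral) (auto simp: \<beta>'_def split: if_splits)
  also have "\<dots> = shannon_entropy M \<beta>'"
    unfolding shannon_entropy_def using count partition_onD1[of "space M" \<beta>'] part prob_space
    by (subst if_P) (auto simp: measurable_partition_def intro!: exI[of _ \<beta>'])
  also have "\<dots> = ent M X" using shannon_entropy_parts[OF X(1)] X(2) by simp
  finally have ent: "ent M X = shannon_entropy M \<alpha>" ..
  then have fX: "fin_ent M X" using fin X(1) by (simp add: fin_ent_def)
  moreover have "generates X TYPE('d)"
  proof (rule generates_if_generating_partition[OF gen fX])
    fix A assume A: "A \<in> \<alpha>"
    show "\<exists>P. prob (sym_diff A {x \<in> space M. P (X x)}) = 0"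
    proof (cases "A \<in> \<beta>")
      case True
      then have "A = {x \<in> space M. X x = A}" using X(3)[of A] by (auto simp: \<beta>'_def)
      then have "sym_diff A {x \<in> space M. X x = A} = {}" by blast
      then show ?thesis by (intro exI[of _ "\<lambda>c. c = A"]) (simp only: measure_empty)
    next
      case False
      then show ?thesis using null0[OF A] by (intro exI[of _ "\<lambda>_. False"]) simp
    qed
  qed
  ultimately show thesis using that ent by blast
qed

lemma generates_parts:
  assumes "generating_partition G M \<phi> (parts M X)" "fin_ent M X"
  shows "generates X TYPE('d)"
proof (rule generates_if_generating_partition[OF assms])
  fix A assume "A \<in> parts M X"
  then obtain c where "A = {x \<in> space M. X x = c}" by (auto simp: parts_def)
  then show "\<exists>P. prob (sym_diff A {x \<in> space M. P (X x)}) = 0"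
    by (intro exI[of _ "\<lambda>d. d = c"]) simp
qed

lemma f_partition_generating:
  assumes gen: "generating_partition G M \<phi> \<alpha>" "countable \<alpha>" "shannon_entropy M \<alpha> < \<infinity>"
    and Z: "generating_partition G M \<phi> (parts M Z)" "fin_ent M Z"
  shows "f_partition G S M \<phi> \<alpha> = f_inf Z"
proof -
  have "measurable_partition M \<alpha>" using gen(1) by (simp add: generating_partition_def)
  then obtain X :: "'x \<Rightarrow> 'x set" where X: "discrete_var M X" "parts M X = \<alpha>"
    using measurable_partition_eq_parts[OF _ gen(2)] by metis
  then have fX: "fin_ent M X"
    using gen(3) shannon_entropy_parts[OF X(1)] by (simp add: fin_ent_def)
  have gX: "generating_partition G M \<phi> (parts M X)" using gen X by simp
  have "f_inf X = f_inf Z"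
    using f_inf_le_if_generates[OF fX Z(2) generates_parts[OF gX fX] generates_parts[OF Z]]
      f_inf_le_if_generates[OF Z(2) fX generates_parts[OF Z] generates_parts[OF gX fX]]
    by (rule antisym[rotated])
  then show ?thesis using f_partition_parts[OF fX] X(2) by simp
qed

lemma f_inf_le_F: "fin_ent M X \<Longrightarrow> f_inf X \<le> ereal (F X)"
proof -
  assume X: "fin_ent M X"
  have "tr \<one> X x = X x" if "x \<in> space M" for x using that by (simp add: tr_def act_one)
  then have "F (orb (\<B> 0) X) = F X"
    by (intro F_cong X) (simp_all add: determines_def ball_0 orb_eq_iff)
  then show "f_inf X \<le> ereal (F X)" unfolding f_inf_def by (intro INF_lower2[of 0]) auto
qed

text \<open>Joining the invariant Y preserves generation, which is why \<open>f_inf Z\<close> bounds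
  F of the join from below. Partitions of infinite entropy satisfy the bound trivially.\<close>

lemma shannon_entropy_ge:
  fixes Z :: "'x \<Rightarrow> 'c" and Y :: "'x \<Rightarrow> 'd"
  assumes gen: "generating_partition G M \<phi> \<alpha>"
    and Z: "generating_partition G M \<phi> (parts M Z)" "fin_ent M Z" "f_inf Z = ereal h"
    and Y: "fin_ent M Y"
    and inv: "\<And>s. s \<in> S \<Longrightarrow> determines M Y (tr s Y)" "\<And>s. s \<in> S \<Longrightarrow> determines M (tr s Y) Y"
  shows "ennreal (h + (real (card S) - 1) * Hr M Y) \<le> shannon_entropy M \<alpha>"
proof (cases "shannon_entropy M \<alpha> < \<infinity>")
  case True
  obtain X :: "'x \<Rightarrow> 'x set" where X: "fin_ent M X" "ent M X = shannon_entropy M \<alpha>"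
      "generates X TYPE('c)"
    using generating_partition_finite_entropy[OF gen True] .
  let ?J = "\<lambda>x. (X x, Y x)"
  have J: "fin_ent M ?J" by (rule fin_ent_Pair[OF X(1) Y])
  have "ereal h \<le> f_inf ?J"
    unfolding Z(3)[symmetric]
    by (rule f_inf_le_if_generates[OF J Z(2) generates_mono[OF J determines_fst X(3)] generates_parts[OF Z(1,2)]])
  also have "\<dots> \<le> ereal (F ?J)" by (rule f_inf_le_F[OF J])
  finally have "h + (real (card S) - 1) * Hr M Y \<le> Hr M X"
    using F_join_invariant_le[OF X(1) Y inv] by (simp add: algebra_simps)
  then have "ennreal (h + (real (card S) - 1) * Hr M Y) \<le> ennreal (Hr M X)" by (rule ennreal_leI)
  then show ?thesis using X(2) unfolding ent_eq_Hr[OF X(1)] by simp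
next
  case False
  then show ?thesis by (simp add: not_less top_unique)
qed

text \<open>The translate of the join over W is the join over g W with its indices renamed. The
  values are functions on different sets, so the two are compared by mutual determination.\<close>

lemma tr_orb_determines:
  assumes "g \<in> carrier G" "W \<subseteq> carrier G"
  shows "determines M (orb ((\<lambda>h. g \<otimes> h) ` W) X) (tr g (orb W X))"
    and "determines M (tr g (orb W X)) (orb ((\<lambda>h. g \<otimes> h) ` W) X)"
proof -
  have "tr g (orb W X) x = tr g (orb W X) y \<longleftrightarrow>
      orb ((\<lambda>h. g \<otimes> h) ` W) X x = orb ((\<lambda>h. g \<otimes> h) ` W) X y"
    if "x \<in> space M" "y \<in> space M" for x y
  proof -
    have "tr g (orb W X) x = tr g (orb W X) y \<longleftrightarrow> (\<forall>h\<in>W. tr g (tr h X) x = tr g (tr h X) y)"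
      unfolding tr_def[of g] by (rule orb_eq_iff)
    also have "\<dots> \<longleftrightarrow> (\<forall>h\<in>W. tr (g \<otimes> h) X x = tr (g \<otimes> h) X y)"
      using assms that by (intro ball_cong) (auto simp: tr_mult)
    finally show ?thesis by (simp add: orb_eq_iff)
  qed
  then show "determines M (orb ((\<lambda>h. g \<otimes> h) ` W) X) (tr g (orb W X))"
    "determines M (tr g (orb W X)) (orb ((\<lambda>h. g \<otimes> h) ` W) X)"
    unfolding determines_def by blast+
qed

text \<open>An invariant event is approximated both by the process over a window \<open>W\<close> and over a disjoint
  translate \<open>g W\<close>; these are independent given \<open>Y\<close>, so the event is a function of \<open>Y\<close>.\<close>

lemma ergodic_if_entropies_additive:
  assumes X: "fin_ent M X" and gen: "generates X TYPE(bool)"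
    and XY: "determines M X Y"
    and Hr_orb: "\<And>W. finite W \<Longrightarrow> W \<noteq> {} \<Longrightarrow> W \<subseteq> carrier G \<Longrightarrow> Hr M (orb W X) = Hr M Y + real (card W) * H0"
    and window: "\<And>W. finite W \<Longrightarrow> W \<subseteq> carrier G \<Longrightarrow>
      \<exists>g\<in>carrier G. (\<lambda>h. g \<otimes> h) ` W \<inter> W = {} \<and> (\<forall>x\<in>space M. tr g Y x = Y x)"
    and transitive: "\<And>c d. fiber_prob M Y c > 0 \<Longrightarrow> fiber_prob M Y d > 0 \<Longrightarrow>
      \<exists>g\<in>carrier G. \<forall>x\<in>space M. Y (\<phi> g x) = d \<longleftrightarrow> Y x = c"
  shows "ergodic_action G M \<phi>"
  unfolding ergodic_action_def
proof (intro ballI impI)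
  fix A assume A: "A \<in> events" "\<forall>g\<in>carrier G. \<phi> g ` A = A"
  let ?a = "\<lambda>x. x \<in> A"
  have Y: "fin_ent M Y" by (rule fin_ent_determined[OF X XY])
  have a: "fin_ent M ?a" by (rule fin_ent_event[OF A(1)])
  let ?J = "\<lambda>x. (?a x, Y x)"
  have J: "fin_ent M ?J" by (rule fin_ent_Pair[OF a Y])
  have inv: "tr g ?a x = ?a x" if "g \<in> carrier G" "x \<in> space M" for g x
  proof -
    have "A = {x \<in> space M. x \<in> A}" using sets.sets_into_space[OF A(1)] by auto
    then have "A = {x \<in> space M. \<phi> (inv g) x \<in> A}"
      using image_act_Collect[OF that(1), of "\<lambda>x. x \<in> A"] A(2) that(1) by auto
    then show ?thesis using that(2) by (auto simp: tr_def)
  qed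
  have "cond_ent M ?a Y \<le> 2 * cond_ent M ?a (orb (\<B> n) X)" for n
  proof -
    let ?W = "\<B> n"
    obtain g where g: "g \<in> carrier G" "(\<lambda>h. g \<otimes> h) ` ?W \<inter> ?W = {}" "\<And>x. x \<in> space M \<Longrightarrow> tr g Y x = Y x"
      using window[OF finite_ball ball_closed, of n] by blast
    let ?gW = "(\<lambda>h. g \<otimes> h) ` ?W"
    let ?P = "orb ?W X" and ?Q = "orb ?gW X"
    have gW: "?gW \<subseteq> carrier G" "finite ?gW" "card ?gW = card ?W"
      using g(1) ball_closed finite_ball[of n]
      by (auto intro!: card_image inj_onI simp: subset_iff)
    have P: "fin_ent M ?P" by (intro fin_ent_orb_ball X)
    have Q: "fin_ent M ?Q" by (intro fin_ent_orb gW X)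
    have PY: "determines M ?P Y"
    proof -
      have "determines M (tr \<one> X) X" by (simp add: determines_def tr_def act_one)
      then have "determines M (tr \<one> X) Y" using XY determines_trans by blast
      then show ?thesis using orb_determines_tr[OF one_in_ball, of n X] determines_trans by blast
    qed
    have QY: "determines M ?Q Y"
    proof -
      have "determines M (tr g ?P) (tr g Y)" by (rule determines_tr[OF PY g(1)])
      moreover have "determines M (tr g Y) Y" using g(3) by (simp add: determines_def)
      ultimately have "determines M (tr g ?P) Y" using determines_trans by blast
      then show ?thesis using tr_orb_determines(1)[OF g(1) ball_closed] by (rule determines_trans)
    qed
    have PQ: "Hr M (\<lambda>x. (?P x, ?Q x)) = Hr M (orb (?W \<union> ?gW) X)"
      using ball_closed gW finite_ball
      by (intro Hr_cong fin_ent_orb X) (auto intro!: determinesI simp: orb_eq_iff)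
    have card: "card (?W \<union> ?gW) = card ?W + card ?W"
      using card_Un_disjoint[OF finite_ball gW(2), of n] g(2) gW(3) by (simp add: Int_commute)
    have ne: "?W \<noteq> {}" using one_in_ball by auto
    \<comment> \<open>This says that P and Q are conditionally independent given Y; it holds because
      the windows are disjoint and their sizes add.\<close>
    have H: "Hr M (\<lambda>x. (?P x, ?Q x)) + Hr M Y = Hr M ?P + Hr M ?Q"
      unfolding PQ
      by (subst (1 2 3) Hr_orb) (use ne gW ball_closed finite_ball in \<open>auto simp: card algebra_simps\<close>)
    have eqQ: "cond_ent M ?a ?Q = cond_ent M ?a ?P"
    proof -
      have "cond_ent M ?a ?P = cond_ent M (tr g ?a) (tr g ?P)"
        by (rule cond_ent_tr[OF a P g(1), symmetric])
      also have "\<dots> = cond_ent M ?a ?Q"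
        unfolding cond_ent_def
      proof (rule arg_cong2[where f="(-)"])
        note d = tr_orb_determines[OF g(1) ball_closed, of n X]
        show "Hr M (tr g ?P) = Hr M ?Q" by (rule Hr_cong[OF Q d])
        have i: "tr g ?a x = tr g ?a y \<longleftrightarrow> ?a x = ?a y" if "x \<in> space M" "y \<in> space M" for x y
          using inv[OF g(1)] that by metis
        show "Hr M (\<lambda>x. (tr g ?a x, tr g ?P x)) = Hr M (\<lambda>x. (?a x, ?Q x))"
          using d unfolding determines_def
          by (intro Hr_cong fin_ent_Pair a Q; unfold determines_def prod.inject; metis i)
      qed
      finally show ?thesis by simp
    qed
    \<comment> \<open>Submodularity over the common part (a, Y). Together with conditional
      independence it yields H(a | Y) \<le> H(a | P) + H(a | Q), and the two terms on the right are
      equal because A is invariant.\<close>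
    have "Hr M (\<lambda>x. ((?a x, ?P x), (?a x, ?Q x))) + Hr M ?J \<le>
        Hr M (\<lambda>x. (?a x, ?P x)) + Hr M (\<lambda>x. (?a x, ?Q x))"
      by (intro Hr_submodular fin_ent_Pair a P Q determines_refl determines_Pair determines_fst
          determines_trans[OF PY determines_snd] determines_trans[OF QY determines_snd])
    moreover have "Hr M (\<lambda>x. (?P x, ?Q x)) \<le> Hr M (\<lambda>x. ((?a x, ?P x), (?a x, ?Q x)))"
      by (intro Hr_mono fin_ent_Pair a P Q) (simp add: determines_def)
    moreover have "j - y \<le> 2 * (ap - p)"
      if "apq + j \<le> ap + aq" "pq \<le> apq" "pq + y = p + q" "aq - q = ap - p"
      for apq j ap aq pq y p q :: real
    proof -
      have "j \<le> ap + aq - pq" using that(1,2) by linarith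
      also have "\<dots> = ap + aq - p - q + y" using that(3) by linarith
      finally have "j - y \<le> (ap - p) + (aq - q)" by linarith
      then show ?thesis unfolding that(4) mult_2 .
    qed
    ultimately show ?thesis
      using H eqQ unfolding cond_ent_def by blast
  qed
  moreover have lim: "(\<lambda>n. 2 * cond_ent M ?a (orb (\<B> n) X)) \<longlonglongrightarrow> 2 * 0"
    using gen a by (intro tendsto_intros) (simp add: generates_def)
  ultimately have "cond_ent M ?a Y \<le> 2 * 0"
    by (intro LIMSEQ_le_const[OF lim]) blast
  \<comment> \<open>Y carries all the entropy of the pair, so almost every fiber of Y lies in A or
    in its complement up to a null set.\<close>
  then have "Hr M ?J = Hr M Y" using cond_ent_nonneg[OF a Y] by (simp add: cond_ent_def)
  then have "AE x in M. fiber_prob M ?J (?J x) = fiber_prob M Y (Y x)"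
    by (rule AE_fiber_prob_eq[OF J determines_snd])
  then have AE: "AE x in M. fiber_prob M ?J (?J x) = fiber_prob M Y (Y x) \<and> fiber_prob M Y (Y x) > 0"
    using AE_fiber_prob_pos[OF fin_ent_discrete[OF Y]] by eventually_elim simp
  show "prob A = 0 \<or> prob A = 1"
  proof (rule ccontr)
    assume neg: "\<not> (prob A = 0 \<or> prob A = 1)"
    let ?good = "\<lambda>x. fiber_prob M ?J (?J x) = fiber_prob M Y (Y x) \<and> fiber_prob M Y (Y x) > 0"
    have ex: "\<exists>x\<in>B. ?good x" if "B \<in> events" "prob B \<noteq> 0" for B
    proof (rule ccontr)
      assume "\<not> (\<exists>x\<in>B. ?good x)"
      then have "AE x in M. x \<notin> B" using AE by (auto elim: eventually_mono)
      then show False using that prob_eq_0 by blast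
    qed
    \<comment> \<open>For a nontrivial A, one fiber of Y lies in A and another one in its
      complement, modulo null sets. A group element carrying the first to the second contradicts the
      invariance of A.\<close>
    obtain x where x: "x \<in> A" "?good x" using ex[OF A(1)] neg by blast
    have "prob (space M - A) \<noteq> 0" using prob_compl[OF A(1)] neg by simp
    then obtain y where y: "y \<in> space M - A" "?good y" using ex[of "space M - A"] A(1) by blast
    let ?c = "Y x" and ?d = "Y y"
    let ?Fc = "{z \<in> space M. Y z = ?c}" and ?Fd = "{z \<in> space M. Y z = ?d}"
    have Fe: "?Fc \<in> events" "?Fd \<in> events"
      using fin_ent_discrete[OF Y] by (auto simp: discrete_var_def)
    have px: "prob (A \<inter> ?Fc) = prob ?Fc"
    proof -
      have "A \<inter> ?Fc = {z \<in> space M. ?J z = ?J x}"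
        using x(1) sets.sets_into_space[OF A(1)] by auto
      then show ?thesis using x(2) by (simp add: fiber_prob_def)
    qed
    have py: "prob (?Fd - A) = prob ?Fd" "prob ?Fd > 0"
    proof -
      have "?Fd - A = {z \<in> space M. ?J z = ?J y}" using y(1) by auto
      then show "prob (?Fd - A) = prob ?Fd" "prob ?Fd > 0" using y(2) by (simp_all add: fiber_prob_def)
    qed
    obtain g where g: "g \<in> carrier G" "\<And>z. z \<in> space M \<Longrightarrow> Y (\<phi> g z) = ?d \<longleftrightarrow> Y z = ?c"
      using transitive[of ?c ?d] x(2) y(2) by blast
    have gFd: "\<phi> (inv g) ` ?Fd = ?Fc"
    proof -
      have "\<phi> (inv g) ` ?Fd = {z \<in> space M. Y (\<phi> g z) = ?d}"
        using image_act_Collect[of "inv g" "\<lambda>z. Y z = ?d"] g(1) by simp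
      also have "\<dots> = ?Fc"
        using g(2) by auto
      finally show ?thesis .
    qed
    have "prob (A \<inter> ?Fd) = prob (\<phi> (inv g) ` (A \<inter> ?Fd))"
      using image_act_events(2)[of "inv g" "A \<inter> ?Fd"] g(1) A(1) Fe by auto
    also have "\<phi> (inv g) ` (A \<inter> ?Fd) = A \<inter> ?Fc"
      using inj_on_image_Int[OF inj_prop[of "inv g"], of A ?Fd] g(1) gFd A(2)
        sets.sets_into_space[OF A(1)] by simp
    also have "prob \<dots> = prob (\<phi> (inv g) ` ?Fd)" unfolding px gFd ..
    also have "\<dots> = prob ?Fd"
      using image_act_events(2)[of "inv g" ?Fd] g(1) Fe by simp
    finally have "prob (A \<inter> ?Fd) = prob ?Fd" .
    moreover have "prob ?Fd = prob (A \<inter> ?Fd) + prob (?Fd - A)"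
    proof -
      have "?Fd = (A \<inter> ?Fd) \<union> (?Fd - A)" by blast
      also have "prob \<dots> = prob (A \<inter> ?Fd) + prob (?Fd - A)"
        using A(1) Fe(2) by (intro finite_measure_Union) auto
      finally show ?thesis .
    qed
    ultimately show False using py by linarith
  qed
qed

end

section \<open>Product measures\<close>

locale free_pmp_system = free_group G S + pmp_system G S M \<phi>
  for G :: "'g monoid" (structure) and S :: "'g set" and M :: "'x measure" and \<phi>
begin

text \<open>F has the same value on all balls: by \<open>sum_card_ball_Un\<close> the terms
  proportional to the size of the ball cancel, and c and H0 survive with the coefficients 1 - r and
  1.\<close>

lemma f_inf_if_entropies_additive:
  assumes X: "fin_ent M X"
    and Hr_orb: "\<And>W. finite W \<Longrightarrow> W \<noteq> {} \<Longrightarrow> W \<subseteq> carrier G \<Longrightarrow> Hr M (orb W X) = c + real (card W) * H0"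
  shows "f_inf X = ereal ((1 - real (card S)) * c + H0)"
proof -
  have "F (orb (\<B> n) X) = (1 - real (card S)) * c + H0" for n
  proof -
    let ?B = "\<B> n"
    let ?sB = "\<lambda>s. (\<lambda>g. s \<otimes> g) ` ?B"
    have ne: "?B \<noteq> {}" using one_in_ball by auto
    have "Hr M (\<lambda>x. (orb ?B X x, tr s (orb ?B X) x)) = c + real (card (?B \<union> ?sB s)) * H0" if "s \<in> S" for s
    proof -
      have s: "s \<in> carrier G" using that S_closed by auto
      have W: "?B \<union> ?sB s \<subseteq> carrier G" "finite (?B \<union> ?sB s)"
        using s ball_closed[of n] finite_ball[of n] by auto
      let ?O = "orb (?B \<union> ?sB s) X"
      have O: "fin_ent M ?O" by (rule fin_ent_orb[OF W(2,1) X])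
      have d1: "determines M ?O (\<lambda>x. (orb ?B X x, tr s (orb ?B X) x))"
        by (intro determines_Pair orb_mono determines_trans[OF tr_orb_determines(1)[OF s ball_closed] orb_mono]) auto
      have "determines M (\<lambda>x. (orb ?B X x, orb (?sB s) X x)) ?O"
        by (rule determinesI) (auto simp: orb_eq_iff)
      moreover have "determines M (\<lambda>x. (orb ?B X x, tr s (orb ?B X) x)) (\<lambda>x. (orb ?B X x, orb (?sB s) X x))"
        by (intro determines_Pair determines_fst determines_trans[OF tr_orb_determines(2)[OF s ball_closed] determines_snd])
      ultimately have d2: "determines M (\<lambda>x. (orb ?B X x, tr s (orb ?B X) x)) ?O"
        by (rule determines_trans)
      show ?thesis using Hr_cong[OF O d1 d2] Hr_orb[OF W(2) _ W(1)] ne by simp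
    qed
    then have "F (orb ?B X) = (1 - 2 * real (card S)) * (c + real (card ?B) * H0) +
        (\<Sum>s\<in>S. c + real (card (?B \<union> ?sB s)) * H0)"
      unfolding F_def using Hr_orb[OF finite_ball ne ball_closed] by simp
    also have "(\<Sum>s\<in>S. c + real (card (?B \<union> ?sB s)) * H0) =
        real (card S) * c + real (\<Sum>s\<in>S. card (?B \<union> ?sB s)) * H0"
      by (simp add: sum.distrib sum_distrib_right)
    also have "\<dots> = real (card S) * c + ((2 * real (card S) - 1) * real (card ?B) + 1) * H0"
      by (simp only: sum_card_ball_Un)
    finally show ?thesis by (simp add: algebra_simps)
  qed
  then show ?thesis by (simp add: f_inf_def)
qed

end

section \<open>Coordinates of infinite products\<close>

lemma emeasure_PiM_coordinates:
  assumes P: "\<And>i. prob_space (P i)" and K: "finite K" and inj: "inj_on \<iota> K"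
    and E: "\<And>k. k \<in> K \<Longrightarrow> E k \<in> sets (P (\<iota> k))"
  shows "emeasure (PiM UNIV P) {x \<in> space (PiM UNIV P). \<forall>k\<in>K. x (\<iota> k) \<in> E k} =
    (\<Prod>k\<in>K. emeasure (P (\<iota> k)) (E k))"
proof -
  interpret product_prob_space P UNIV
    by (intro product_prob_spaceI P)
  let ?v = "the_inv_into K \<iota>"
  have v: "?v (\<iota> k) = k" if "k \<in> K" for k using inj that by (simp add: the_inv_into_f_f)
  have "{x \<in> space (PiM UNIV P). \<forall>k\<in>K. x (\<iota> k) \<in> E k} =
      {x \<in> space (PiM UNIV P). \<forall>i\<in>\<iota> ` K. x i \<in> E (?v i)}"
    using v by auto
  also have "emeasure (PiM UNIV P) \<dots> = (\<Prod>i\<in>\<iota> ` K. emeasure (P i) (E (?v i)))"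
    using K E v by (intro emeasure_PiM_Collect) auto
  also have "\<dots> = (\<Prod>k\<in>K. emeasure (P (\<iota> k)) (E k))"
    using inj v by (simp add: prod.reindex)
  finally show ?thesis .
qed

text \<open>The shape of the model action: an injective renaming of coordinates combined with
  measure preserving maps between the factors. It suffices to compare the measures of
  cylinders.\<close>

lemma distr_PiM_twist:
  assumes P: "\<And>i. prob_space (P i)" and inj: "inj \<pi>"
    and T: "\<And>i. T i \<in> measurable (P (\<pi> i)) (P i)" "\<And>i. distr (P (\<pi> i)) (P i) (T i) = P i"
  shows "(\<lambda>x i. T i (x (\<pi> i))) \<in> measurable (PiM UNIV P) (PiM UNIV P)"
    and "distr (PiM UNIV P) (PiM UNIV P) (\<lambda>x i. T i (x (\<pi> i))) = PiM UNIV P"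
proof -
  interpret product_prob_space P UNIV
    by (intro product_prob_spaceI P)
  let ?T = "\<lambda>x i. T i (x (\<pi> i))"
  have "(\<lambda>x. T i (x (\<pi> i))) \<in> measurable (PiM UNIV P) (P i)" for i
    by (rule measurable_compose[where f = "\<lambda>x. x (\<pi> i)" and g = "T i", OF _ T(1)]) simp
  then have "(\<lambda>x. \<lambda>i\<in>UNIV. T i (x (\<pi> i))) \<in> measurable (PiM UNIV P) (PiM UNIV P)"
    by (rule measurable_restrict)
  then show meas: "?T \<in> measurable (PiM UNIV P) (PiM UNIV P)" by (simp add: restrict_UNIV)
  show "distr (PiM UNIV P) (PiM UNIV P) ?T = PiM UNIV P"
  proof (rule PiM_eq)
    fix J F assume J: "finite J" "J \<subseteq> UNIV" "\<And>j. j \<in> J \<Longrightarrow> F j \<in> sets (P j)"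
    have emb: "prod_emb UNIV P J (Pi\<^sub>E J F) \<in> sets (PiM UNIV P)"
      using J by (intro sets_PiM_I) auto
    have "?T -` prod_emb UNIV P J (Pi\<^sub>E J F) \<inter> space (PiM UNIV P) =
       {x \<in> space (PiM UNIV P). \<forall>j\<in>J. x (\<pi> j) \<in> T j -` F j \<inter> space (P (\<pi> j))}"
      using measurable_space[OF T(1)] by (auto simp: prod_emb_def space_PiM PiE_iff)
    then have "emeasure (distr (PiM UNIV P) (PiM UNIV P) ?T) (prod_emb UNIV P J (Pi\<^sub>E J F)) =
        (\<Prod>j\<in>J. emeasure (P (\<pi> j)) (T j -` F j \<inter> space (P (\<pi> j))))"
      using J inj measurable_sets[OF T(1)]
      by (simp only: emeasure_distr[OF meas emb])
        (intro emeasure_PiM_coordinates, auto intro: inj_on_subset M.prob_space_axioms)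
    also have "\<dots> = (\<Prod>j\<in>J. emeasure (P j) (F j))"
      using J by (intro prod.cong refl) (metis T emeasure_distr)
    finally show "emeasure (distr (PiM UNIV P) (PiM UNIV P) ?T) (prod_emb UNIV P J (Pi\<^sub>E J F)) =
        (\<Prod>j\<in>J. emeasure (P j) (F j))" .
  qed simp
qed

text \<open>Values are indexed by K rather than by the coordinates \<iota> k, so that the readings
  of two different windows over the same K can be compared for equality.\<close>

definition coords :: "('b \<Rightarrow> 'c) \<Rightarrow> ('k \<Rightarrow> 'i) \<Rightarrow> 'k set \<Rightarrow> ('i \<Rightarrow> 'b) \<Rightarrow> 'k \<Rightarrow> 'c" where
  "coords D \<iota> K x = (\<lambda>k\<in>K. D (x (\<iota> k)))"

lemma coords_eq_iff: "coords D \<iota> K x = coords D \<kappa> K y \<longleftrightarrow> (\<forall>k\<in>K. D (x (\<iota> k)) = D (y (\<kappa> k)))"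
  unfolding coords_def by (auto simp: restrict_def fun_eq_iff)

lemma coords_eq_ext_iff:
  "coords D \<iota> K x = c \<longleftrightarrow> c \<in> extensional K \<and> (\<forall>k\<in>K. D (x (\<iota> k)) = c k)"
  unfolding coords_def by (auto simp: restrict_def fun_eq_iff extensional_def)

context
  fixes P :: "'i \<Rightarrow> 'b measure" and D :: "'b \<Rightarrow> 'c" and M :: "('i \<Rightarrow> 'b) measure"
  assumes prob: "\<And>i. prob_space (P i)" and D: "\<And>i. discrete_var (P i) D"
  defines "M \<equiv> PiM UNIV P"
begin

lemma coords_fiber:
  assumes "finite K" "c \<in> extensional K"
  shows "{x \<in> space M. coords D \<iota> K x = c} =
    {x \<in> space M. \<forall>k\<in>K. x (\<iota> k) \<in> {y \<in> space (P (\<iota> k)). D y = c k}}"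
  using assms(2) by (auto simp: coords_eq_ext_iff M_def space_PiM)

lemma fiber_prob_coords:
  assumes K: "finite K" and inj: "inj_on \<iota> K" and c: "c \<in> extensional K"
  shows "fiber_prob M (coords D \<iota> K) c = (\<Prod>k\<in>K. fiber_prob (P (\<iota> k)) D (c k))"
proof -
  interpret product_prob_space P UNIV by (intro product_prob_spaceI prob)
  have "emeasure M {x \<in> space M. coords D \<iota> K x = c} =
      (\<Prod>k\<in>K. emeasure (P (\<iota> k)) {y \<in> space (P (\<iota> k)). D y = c k})"
    unfolding coords_fiber[OF K c] unfolding M_def
    using D by (intro emeasure_PiM_coordinates prob K inj) (auto simp: discrete_var_def)
  then have "ennreal (fiber_prob M (coords D \<iota> K) c) =
      ennreal (\<Prod>k\<in>K. fiber_prob (P (\<iota> k)) D (c k))"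
    unfolding fiber_prob_def M_def M.emeasure_eq_measure P.emeasure_eq_measure
    by (simp add: prod_ennreal)
  then show ?thesis by (simp add: prod_nonneg)
qed

lemma discrete_var_coords:
  assumes K: "finite K"
  shows "discrete_var M (coords D \<iota> K)"
  unfolding discrete_var_def
proof (intro conjI allI)
  have "coords D \<iota> K ` space M \<subseteq> (\<Pi>\<^sub>E k\<in>K. D ` space (P (\<iota> k)))"
    by (auto simp: coords_def M_def space_PiM PiE_iff)
  moreover have "countable (\<Pi>\<^sub>E k\<in>K. D ` space (P (\<iota> k)))"
    using D K by (intro countable_PiE) (auto simp: discrete_var_def)
  ultimately show "countable (coords D \<iota> K ` space M)" by (rule countable_subset)
  fix c
  show "{x \<in> space M. coords D \<iota> K x = c} \<in> sets M"
  proof (cases "c \<in> extensional K")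
    case True
    have "{x \<in> space M. x (\<iota> k) \<in> {y \<in> space (P (\<iota> k)). D y = c k}} \<in> sets M" for k
    proof -
      let ?B = "{y \<in> space (P (\<iota> k)). D y = c k}"
      have "(\<lambda>x. x (\<iota> k)) -` ?B \<inter> space M \<in> sets M"
        unfolding M_def using D
        by (intro measurable_sets[OF measurable_component_singleton]) (auto simp: discrete_var_def)
      also have "(\<lambda>x. x (\<iota> k)) -` ?B \<inter> space M = {x \<in> space M. x (\<iota> k) \<in> ?B}" by blast
      finally show ?thesis .
    qed
    then have "{x \<in> space M. \<forall>k\<in>K. x (\<iota> k) \<in> {y \<in> space (P (\<iota> k)). D y = c k}} \<in> sets M"
      using K by (rule sets.sets_Collect_finite_All)
    then show ?thesis unfolding coords_fiber[OF K True] .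
  next
    case False
    then have "{x \<in> space M. coords D \<iota> K x = c} = {}" by (auto simp: coords_eq_ext_iff)
    then show ?thesis by (simp only: sets.empty_sets)
  qed
qed

text \<open>By independence the information of a window is almost everywhere the sum of the
  informations of its coordinates; integration gives additivity, infinite entropies
  included.\<close>

lemma ent_coords:
  assumes K: "finite K" and inj: "inj_on \<iota> K"
  shows "ent M (coords D \<iota> K) = (\<Sum>k\<in>K. ent (P (\<iota> k)) D)"
proof -
  interpret product_prob_space P UNIV by (intro product_prob_spaceI prob)
  have meas: "info (P i) D \<in> borel_measurable (P i)" for i
    using prob_space.measurable_info[OF prob D] .
  have comp: "(\<lambda>x. x i) \<in> measurable M (P i)" for i
    unfolding M_def by (rule measurable_component_singleton) simp
  have "AE x in M. \<forall>k\<in>K. fiber_prob (P (\<iota> k)) D (D (x (\<iota> k))) > 0"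
    unfolding M_def using prob_space.AE_fiber_prob_pos[OF prob D]
    by (intro AE_finite_allI K AE_component) auto
  then have "AE x in M. info M (coords D \<iota> K) x = (\<Sum>k\<in>K. info (P (\<iota> k)) D (x (\<iota> k)))"
    using AE_space
  proof eventually_elim
    case (elim x)
    have "fiber_prob M (coords D \<iota> K) (coords D \<iota> K x) =
        (\<Prod>k\<in>K. fiber_prob (P (\<iota> k)) D (coords D \<iota> K x k))"
      by (rule fiber_prob_coords[OF K inj]) (simp add: coords_def)
    also have "\<dots> = (\<Prod>k\<in>K. fiber_prob (P (\<iota> k)) D (D (x (\<iota> k))))"
      by (intro prod.cong) (auto simp: coords_def)
    finally have eq: "fiber_prob M (coords D \<iota> K) (coords D \<iota> K x) =
        (\<Prod>k\<in>K. fiber_prob (P (\<iota> k)) D (D (x (\<iota> k))))" .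
    have "fiber_prob (P (\<iota> k)) D (D (x (\<iota> k))) \<noteq> 0" if "k \<in> K" for k
      using elim(1) that by force
    then have "- ln (fiber_prob M (coords D \<iota> K) (coords D \<iota> K x)) =
        (\<Sum>k\<in>K. - ln (fiber_prob (P (\<iota> k)) D (D (x (\<iota> k)))))"
      unfolding eq sum_negf by (subst ln_prod[OF K]) simp_all
    then show ?case
      unfolding info_def using prob_space.neg_ln_fiber_prob_nonneg[OF prob]
      by (simp add: sum_ennreal)
  qed
  then have "ent M (coords D \<iota> K) = (\<integral>\<^sup>+x. (\<Sum>k\<in>K. info (P (\<iota> k)) D (x (\<iota> k))) \<partial>M)"
    unfolding ent_def by (rule nn_integral_cong_AE)
  also have "\<dots> = (\<Sum>k\<in>K. \<integral>\<^sup>+x. info (P (\<iota> k)) D (x (\<iota> k)) \<partial>M)"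
    by (intro nn_integral_sum measurable_compose[OF comp meas])
  also have "\<dots> = (\<Sum>k\<in>K. ent (P (\<iota> k)) D)"
  proof (rule sum.cong[OF refl])
    fix k
    have "ent (P (\<iota> k)) D = (\<integral>\<^sup>+y. info (P (\<iota> k)) D y \<partial>distr M (P (\<iota> k)) (\<lambda>x. x (\<iota> k)))"
      unfolding ent_def M_def by (subst PiM_component) auto
    also have "\<dots> = (\<integral>\<^sup>+x. info (P (\<iota> k)) D (x (\<iota> k)) \<partial>M)"
      by (rule nn_integral_distr[OF comp]) (simp add: meas)
    finally show "(\<integral>\<^sup>+x. info (P (\<iota> k)) D (x (\<iota> k)) \<partial>M) = ent (P (\<iota> k)) D" ..
  qed
  finally show ?thesis .
qed

text \<open>The pair is a single reading over two copies of K, whose coordinates are distinct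
  because the windows are disjoint.\<close>

lemma fiber_prob_coords_Pair:
  assumes K: "finite K" and inj: "inj_on \<iota> K" "inj_on \<kappa> K" and disj: "\<iota> ` K \<inter> \<kappa> ` K = {}"
  shows "fiber_prob M (\<lambda>x. (coords D \<iota> K x, coords D \<kappa> K x)) (c, d) =
    fiber_prob M (coords D \<iota> K) c * fiber_prob M (coords D \<kappa> K) d"
proof (cases "c \<in> extensional K \<and> d \<in> extensional K")
  case True
  let ?L = "K \<times> (UNIV :: bool set)"
  let ?\<nu> = "\<lambda>(k, b). if b then \<iota> k else \<kappa> k"
  let ?e = "\<lambda>p\<in>?L. (case p of (k, b) \<Rightarrow> if b then c k else d k)"
  have injL: "inj_on ?\<nu> ?L"
    using inj disj by (auto simp: inj_on_def split: if_splits)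
  have "{x \<in> space M. (coords D \<iota> K x, coords D \<kappa> K x) = (c, d)} = {x \<in> space M. coords D ?\<nu> ?L x = ?e}"
    using True by (auto simp: coords_eq_ext_iff split: if_splits)
  then have "fiber_prob M (\<lambda>x. (coords D \<iota> K x, coords D \<kappa> K x)) (c, d) = fiber_prob M (coords D ?\<nu> ?L) ?e"
    by (simp only: fiber_prob_def)
  also have "\<dots> = (\<Prod>p\<in>?L. fiber_prob (P (?\<nu> p)) D (?e p))"
    using K by (intro fiber_prob_coords injL) auto
  also have "\<dots> = (\<Prod>k\<in>K. \<Prod>b\<in>UNIV. fiber_prob (P (if b then \<iota> k else \<kappa> k)) D (if b then c k else d k))"
    by (simp add: prod.cartesian_product split_beta)
  also have "\<dots> = (\<Prod>k\<in>K. fiber_prob (P (\<iota> k)) D (c k)) * (\<Prod>k\<in>K. fiber_prob (P (\<kappa> k)) D (d k))"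
    by (simp add: UNIV_bool prod.distrib mult.commute)
  finally show ?thesis using True by (simp add: fiber_prob_coords K inj)
next
  case False
  have "fiber_prob M (coords D \<iota> K) c * fiber_prob M (coords D \<kappa> K) d = 0"
    using False by (auto simp: fiber_prob_def coords_eq_ext_iff)
  moreover have "{x \<in> space M. (coords D \<iota> K x, coords D \<kappa> K x) = (c, d)} = {}"
    using False by (auto simp: coords_eq_ext_iff)
  ultimately show ?thesis unfolding fiber_prob_def by (simp only: measure_empty)
qed

end

text \<open>By independence P(A = B) is the sum of P(A = c) P(B = c), a weighted average of numbers
  at most e.\<close>

lemma (in prob_space) prob_eq_le_if_indep:
  fixes A B :: "'a \<Rightarrow> 'c"
  assumes A: "discrete_var M A" and B: "discrete_var M B"
    and indep: "\<And>c d. fiber_prob M (\<lambda>x. (A x, B x)) (c, d) = fiber_prob M A c * fiber_prob M B d"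
    and le: "\<And>c. fiber_prob M B c \<le> e"
  shows "prob {x \<in> space M. A x = B x} \<le> e"
proof -
  let ?J = "\<lambda>x. (A x, B x)"
  define f :: "'c \<times> 'c \<Rightarrow> ennreal" where "f j = (if fst j = snd j then 1 else 0)" for j
  have J: "discrete_var M ?J" by (rule discrete_var_Pair[OF A B])
  have e: "e \<ge> 0" using le[of undefined] fiber_prob_nonneg[of M B undefined] by linarith
  have ev: "{x \<in> space M. A x = B x} \<in> events"
    using discrete_var_Collect[OF J, of "\<lambda>j. fst j = snd j"] by simp
  have em: "emeasure M {x \<in> space M. ?J x = (c, d)} = ennreal (fiber_prob M A c * fiber_prob M B d)" for c d
    using indep[of c d] by (simp only: fiber_prob_def emeasure_eq_measure)
  have inner: "(\<integral>\<^sup>+d. f (c, d) * ennreal (fiber_prob M A c * fiber_prob M B d) \<partial>count_space UNIV) \<le>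
      ennreal e * (ennreal (fiber_prob M A c) * indicator UNIV c)" for c
  proof -
    have "(\<integral>\<^sup>+d. f (c, d) * ennreal (fiber_prob M A c * fiber_prob M B d) \<partial>count_space UNIV)
      = (\<integral>\<^sup>+d. ennreal (fiber_prob M A c * fiber_prob M B c) * indicator {c} d \<partial>count_space UNIV)"
      by (intro nn_integral_cong) (simp add: f_def split: split_indicator)
    also have "\<dots> = ennreal (fiber_prob M A c * fiber_prob M B c)"
      by (simp add: nn_integral_cmult)
    also have "\<dots> \<le> ennreal (e * fiber_prob M A c)"
      by (intro ennreal_leI) (simp add: le mult.commute[of e] mult_left_mono)
    finally show ?thesis using e by (simp add: ennreal_mult)
  qed
  have "emeasure M {x \<in> space M. A x = B x} = (\<integral>\<^sup>+x. indicator {x \<in> space M. A x = B x} x \<partial>M)"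
    by (rule nn_integral_indicator[symmetric, OF ev])
  also have "\<dots> = (\<integral>\<^sup>+x. f (?J x) \<partial>M)"
    by (intro nn_integral_cong) (simp add: f_def split: split_indicator)
  also have "\<dots> = (\<integral>\<^sup>+j. f j * emeasure M {x \<in> space M. ?J x = j} \<partial>count_space UNIV)"
    by (rule nn_integral_discrete_var[OF J])
  also have "\<dots> = (\<integral>\<^sup>+c. \<integral>\<^sup>+d. f (c, d) *
      ennreal (fiber_prob M A c * fiber_prob M B d) \<partial>count_space UNIV \<partial>count_space UNIV)"
    by (subst nn_integral_fst_count_space[symmetric]) (simp only: em)
  also have "\<dots> \<le> (\<integral>\<^sup>+c. ennreal e * (ennreal (fiber_prob M A c) * indicator UNIV c) \<partial>count_space UNIV)"
    by (intro nn_integral_mono inner)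
  also have "\<dots> = ennreal e * (\<integral>\<^sup>+c. ennreal (fiber_prob M A c) * indicator UNIV c \<partial>count_space UNIV)"
    by (intro nn_integral_cmult) auto
  also have "\<dots> \<le> ennreal e * emeasure M (space M)"
    by (intro mult_left_mono nn_integral_fiber_prob_le[OF A]) auto
  also have "\<dots> = ennreal e" by (simp add: emeasure_space_1)
  finally show ?thesis using e by (simp add: emeasure_eq_measure)
qed

section \<open>Laws on the natural numbers\<close>

text \<open>The law is pushed to the reals, so that the product of the coordinates is a Borel
  measure on a Polish space; \<open>floor\<close> recovers the original value.\<close>

definition nat_law :: "nat pmf \<Rightarrow> real measure" where
  "nat_law p = distr (measure_pmf p) borel real"

lemma prob_space_nat_law: "prob_space (nat_law p)"
  unfolding nat_law_def by (intro prob_space.prob_space_distr measure_pmf.prob_space_axioms) simp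

lemma space_nat_law [simp]: "space (nat_law p) = UNIV"
  and sets_nat_law [measurable_cong, simp]: "sets (nat_law p) = sets borel"
  by (simp_all add: nat_law_def)

lemma measurable_floor_count_space: "(floor :: real \<Rightarrow> int) \<in> measurable borel (count_space UNIV)"
  by measurable

lemma discrete_var_floor:
  assumes "space M = UNIV" "sets M = sets borel"
  shows "discrete_var M (floor :: real \<Rightarrow> int)"
  unfolding discrete_var_def
proof (intro conjI allI)
  fix c
  have "(floor :: real \<Rightarrow> int) -` {c} \<inter> space borel \<in> sets borel"
    by (intro measurable_sets[OF measurable_floor_count_space]) simp
  moreover have "(floor :: real \<Rightarrow> int) -` {c} \<inter> space borel = {x \<in> space M. \<lfloor>x\<rfloor> = c}"
    using assms(1) by auto
  ultimately show "{x \<in> space M. \<lfloor>x\<rfloor> = c} \<in> sets M" using assms(2) by simp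
qed simp

lemma discrete_var_nat_law: "discrete_var (nat_law p) (floor :: real \<Rightarrow> int)"
  by (intro discrete_var_floor) simp_all

lemma fiber_prob_nat_law:
  "fiber_prob (nat_law p) floor c = (if c \<ge> 0 then pmf p (nat c) else 0)"
proof -
  have "{x \<in> space (nat_law p). \<lfloor>x\<rfloor> = c} \<in> sets borel"
    using discrete_var_nat_law[of p] by (simp add: discrete_var_def)
  then have "fiber_prob (nat_law p) floor c = measure_pmf.prob p {k. \<lfloor>real k\<rfloor> = c}"
    unfolding fiber_prob_def by (subst nat_law_def) (simp add: measure_distr vimage_def)
  also have "{k. \<lfloor>real k\<rfloor> = c} = (if c \<ge> 0 then {nat c} else {})" by auto
  finally show ?thesis by (auto simp: measure_pmf_single)
qed

lemma ent_nat_law: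
  "ent (nat_law p) floor = (\<integral>\<^sup>+k. ennreal (- (pmf p k * ln (pmf p k))) \<partial>count_space UNIV)"
proof -
  interpret prob_space "nat_law p" by (rule prob_space_nat_law)
  have "ent (nat_law p) floor = (\<integral>\<^sup>+k. info (nat_law p) floor (real k) \<partial>measure_pmf p)"
    using measurable_info[OF discrete_var_nat_law[of p]]
    unfolding ent_def nat_law_def by (intro nn_integral_distr) simp_all
  also have "\<dots> = (\<integral>\<^sup>+k. ennreal (pmf p k) * ennreal (- ln (pmf p k)) \<partial>count_space UNIV)"
    by (simp add: nn_integral_measure_pmf info_def fiber_prob_nat_law)
  also have "\<dots> = (\<integral>\<^sup>+k. ennreal (- (pmf p k * ln (pmf p k))) \<partial>count_space UNIV)"
    by (intro nn_integral_cong) (simp flip: ennreal_mult')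
  finally show ?thesis .
qed

lemma ent_nat_law_uniform:
  assumes "N > 0"
  shows "ent (nat_law (pmf_of_set {..<N})) floor = ennreal (ln (real N))"
proof -
  have ne: "{..<N} \<noteq> {}" using assms by auto
  have "ent (nat_law (pmf_of_set {..<N})) floor = (\<Sum>k\<in>{..<N}. ennreal (ln (real N) / real N))"
    unfolding ent_nat_law
    by (subst nn_integral_count_space'[of "{..<N}"])
      (use assms ne in \<open>auto simp: pmf_of_set indicator_def ln_div\<close>)
  also have "\<dots> = ennreal (\<Sum>k\<in>{..<N}. ln (real N) / real N)"
    using assms by (intro sum_ennreal) auto
  finally show ?thesis using assms by simp
qed

lemma AE_nat_law_floor: "AE y in nat_law p. real_of_int \<lfloor>y\<rfloor> = y"
proof -
  have [measurable]: "(\<lambda>y :: real. real_of_int \<lfloor>y\<rfloor>) \<in> borel_measurable borel"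
    by (rule measurable_compose[OF measurable_floor_count_space]) simp
  have "{y \<in> space borel. real_of_int \<lfloor>y\<rfloor> = y} \<in> sets borel"
    by (intro borel_measurable_eq) simp_all
  then show ?thesis unfolding nat_law_def by (subst AE_distr_iff) auto
qed

text \<open>The rotation of \<open>{0..<N}\<close> by \<open>j\<close>, extended to a bijection of the reals that permutes every
  interval \<open>{k * N..<(k + 1) * N}\<close> in the same way.\<close>

definition rot :: "int \<Rightarrow> int \<Rightarrow> real \<Rightarrow> real" where
  "rot N j y = y + real_of_int ((\<lfloor>y\<rfloor> + j) mod N - \<lfloor>y\<rfloor> mod N)"

lemma floor_rot: "\<lfloor>rot N j y\<rfloor> = \<lfloor>y\<rfloor> + ((\<lfloor>y\<rfloor> + j) mod N - \<lfloor>y\<rfloor> mod N)"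
  unfolding rot_def by (simp only: floor_add_int)

lemma floor_rot_mod: "\<lfloor>rot N j y\<rfloor> mod N = (\<lfloor>y\<rfloor> + j) mod N"
proof -
  have "\<lfloor>rot N j y\<rfloor> mod N = ((\<lfloor>y\<rfloor> - \<lfloor>y\<rfloor> mod N) + (\<lfloor>y\<rfloor> + j) mod N) mod N"
    by (simp add: floor_rot algebra_simps)
  also have "\<lfloor>y\<rfloor> - \<lfloor>y\<rfloor> mod N = N * (\<lfloor>y\<rfloor> div N)" by (simp add: minus_mod_eq_mult_div)
  finally show ?thesis by simp
qed

lemma rot_rot: "rot N j (rot N k y) = rot N (j + k) y"
proof -
  have "(\<lfloor>rot N k y\<rfloor> + j) mod N = (\<lfloor>y\<rfloor> + (j + k)) mod N"
    using floor_rot_mod[of N k y] by (metis add.assoc add.commute mod_add_left_eq)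
  then show ?thesis
    unfolding rot_def[of N j] floor_rot_mod by (simp add: rot_def)
qed

lemma rot_0: "j mod N = 0 \<Longrightarrow> rot N j y = y"
  by (simp add: rot_def mod_0_imp_dvd flip: mod_add_right_eq[of "\<lfloor>y\<rfloor>" j])

lemma floor_rot_cong: "\<lfloor>x\<rfloor> = \<lfloor>y\<rfloor> \<Longrightarrow> \<lfloor>rot N j x\<rfloor> = \<lfloor>rot N j y\<rfloor>"
  by (simp add: floor_rot)

lemma floor_rot_eq_iff: "\<lfloor>rot N j x\<rfloor> = \<lfloor>rot N j y\<rfloor> \<longleftrightarrow> \<lfloor>x\<rfloor> = \<lfloor>y\<rfloor>"
  using floor_rot_cong[of "rot N j x" "rot N j y" N "- j"] floor_rot_cong[of x y N j]
  by (auto simp: rot_rot rot_0)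

lemma rot_measurable [measurable]: "rot N j \<in> borel_measurable borel"
proof -
  have "(\<lambda>y :: real. real_of_int ((\<lfloor>y\<rfloor> + j) mod N - \<lfloor>y\<rfloor> mod N)) \<in> borel_measurable borel"
    by (rule measurable_compose[OF measurable_floor_count_space,
          where g = "\<lambda>k. real_of_int ((k + j) mod N - k mod N)"]) simp
  then show ?thesis unfolding rot_def[abs_def] by (intro borel_measurable_add) simp_all
qed

lemma floor_rot_transitive:
  assumes "0 \<le> c" "c < N" "0 \<le> d" "d < N"
  shows "\<lfloor>rot N (d - c) y\<rfloor> = d \<longleftrightarrow> \<lfloor>y\<rfloor> = c"
proof -
  have "\<lfloor>rot N (d - c) (real_of_int c)\<rfloor> = d" using assms by (simp add: floor_rot)
  then show ?thesis using floor_rot_eq_iff[of N "d - c" y "real_of_int c"] by simp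
qed

text \<open>On 0, ..., N - 1, which carry all the mass, the rotation is the permutation
  \<open>\<sigma> j\<close>.\<close>

lemma distr_rot_uniform:
  assumes N: "N > 0"
  shows "distr (nat_law (pmf_of_set {..<N})) (nat_law (pmf_of_set {..<N})) (rot (int N) j) =
    nat_law (pmf_of_set {..<N})"
proof -
  let ?u = "pmf_of_set {..<N}"
  define \<sigma> where "\<sigma> i k = nat ((int k + i) mod int N)" for i k
  have ne: "{..<N} \<noteq> {}" using N by auto
  have lt: "\<sigma> i k < N" for i k using N by (simp add: \<sigma>_def nat_less_iff)
  have inv: "\<sigma> (- i) (\<sigma> i k) = k" if "k < N" for i k
    using that N by (simp add: \<sigma>_def mod_add_left_eq mod_diff_left_eq)
  have bij: "bij_betw (\<sigma> j) {..<N} {..<N}"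
    by (rule bij_betw_byWitness[where f' = "\<sigma> (- j)"]) (use lt inv[of _ j] inv[of _ "- j"] in auto)
  have rot: "rot (int N) j (real k) = real (\<sigma> j k)" if "k < N" for k
    using that N by (simp add: rot_def \<sigma>_def)
  have "distr (nat_law ?u) (nat_law ?u) (rot (int N) j) = distr (nat_law ?u) borel (rot (int N) j)"
    by (intro distr_cong) simp_all
  also have "\<dots> = distr (measure_pmf ?u) borel (rot (int N) j \<circ> real)"
    unfolding nat_law_def by (intro distr_distr) simp_all
  also have "\<dots> = distr (measure_pmf ?u) borel (real \<circ> \<sigma> j)"
    by (intro distr_cong_AE) (use rot ne in \<open>auto simp: AE_measure_pmf_iff set_pmf_of_set\<close>)
  also have "\<dots> = distr (distr (measure_pmf ?u) (count_space UNIV) (\<sigma> j)) borel real"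
    by (intro distr_distr[symmetric]) simp_all
  also have "distr (measure_pmf ?u) (count_space UNIV) (\<sigma> j) = measure_pmf (map_pmf (\<sigma> j) ?u)"
    by (simp add: map_pmf_rep_eq)
  also have "map_pmf (\<sigma> j) ?u = ?u"
    by (rule map_pmf_of_set_bij_betw[OF bij ne]) simp
  finally show ?thesis by (simp add: nat_law_def)
qed

text \<open>The entropy of the law giving mass \<open>1 - \<theta>\<close> to \<open>0\<close> and \<open>\<theta> / m\<close> to each of \<open>1, \<dots>, m\<close> varies
  continuously from \<open>0\<close> to a value that is unbounded in \<open>m\<close>.\<close>

lemma ex_pmf_entropy:
  assumes t: "t > 0"
  obtains p :: "nat pmf" and q where "\<And>k. pmf p k \<le> q" "q < 1" "ent (nat_law p) floor = ennreal t"
proof -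
  \<comment> \<open>Chosen so that E (1/2) = ln 2 + (ln m) / 2 is at least t.\<close>
  define m where "m = nat \<lceil>exp (2 * t)\<rceil>"
  have m: "real m \<ge> exp (2 * t)" by (simp add: m_def)
  then have m0: "m > 0" by (metis exp_gt_zero gr0I not_less of_nat_0)
  define E where "E \<theta> = - ((1 - \<theta>) * ln (1 - \<theta>)) - \<theta> * ln \<theta> + \<theta> * ln (real m)" for \<theta> :: real
  have "(E \<longlongrightarrow> 0) (at_right 0)" unfolding E_def by real_asymp
  then have "\<forall>\<^sub>F \<theta> in at_right 0. E \<theta> < t \<and> \<theta> < 1 / 2 \<and> \<theta> > 0"
    using t by (intro eventually_conj order_tendstoD(2) eventually_at_rightI[of 0 "1/2"]) auto
  \<comment> \<open>The intermediate value theorem is applied on [a, 1/2] with a > 0: this avoids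
    the logarithm at 0 and keeps 1 - \<theta> below 1.\<close>
  then obtain a where a: "E a < t" "a < 1 / 2" "a > 0"
    by (metis (mono_tags, lifting) eventually_happens trivial_limit_at_right_real)
  have "ln (exp (2 * t)) \<le> ln (real m)" using m by (subst ln_le_cancel_iff) (auto simp: m0)
  then have "2 * t \<le> ln (real m)" by simp
  moreover have "E (1 / 2) = ln 2 + ln (real m) / 2" by (simp add: E_def ln_div)
  moreover have "ln 2 > (0 :: real)" by simp
  ultimately have Eh: "t \<le> E (1 / 2)" by linarith
  have "continuous_on {a..1/2} E" unfolding E_def using a by (intro continuous_intros) auto
  then obtain \<theta> where \<theta>: "a \<le> \<theta>" "\<theta> \<le> 1 / 2" "E \<theta> = t"
    using IVT'[of E a t "1/2"] a Eh by auto
  define f where "f k = (if k = 0 then 1 - \<theta> else if k \<le> m then \<theta> / real m else 0)" for k :: nat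
  have f0: "f k \<ge> 0" for k using \<theta> a by (simp add: f_def)
  have split: "(\<Sum>k\<in>{0..m}. g k) = g 0 + (\<Sum>k\<in>{1..m}. g k)" for g :: "nat \<Rightarrow> real"
    by (simp add: sum.atLeast_Suc_atMost)
  have "(\<integral>\<^sup>+k. ennreal (f k) \<partial>count_space UNIV) = (\<Sum>k\<in>{0..m}. ennreal (f k))"
    by (rule nn_integral_count_space') (auto simp: f_def)
  also have "\<dots> = ennreal (\<Sum>k\<in>{0..m}. f k)" using f0 by (simp add: sum_ennreal)
  also have "(\<Sum>k\<in>{0..m}. f k) = 1" unfolding split using m0 by (simp add: f_def)
  finally have pmf: "pmf (embed_pmf f) k = f k" for k using f0 by (intro pmf_embed_pmf) auto
  \<comment> \<open>Since \<theta> \<le> 1/2, the mass at 0 is the largest one and can serve as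
    q.\<close>
  have fle: "f k \<le> 1 - \<theta>" for k
  proof -
    have "\<theta> / real m \<le> \<theta>" using \<theta> a m0 by (simp add: field_simps)
    then show ?thesis using \<theta> a by (auto simp: f_def)
  qed
  have "ent (nat_law (embed_pmf f)) floor = (\<Sum>k\<in>{0..m}. ennreal (- (f k * ln (f k))))"
    unfolding ent_nat_law pmf by (rule nn_integral_count_space') (auto simp: f_def)
  also have "\<dots> = ennreal (\<Sum>k\<in>{0..m}. - (f k * ln (f k)))"
  proof (rule sum_ennreal)
    fix k
    have "f k \<le> 1" using fle[of k] \<theta> a by linarith
    then have "ln (f k) \<le> 0" using f0[of k] by (cases "f k = 0") auto
    then show "0 \<le> - (f k * ln (f k))" using f0[of k] by (simp add: mult_nonneg_nonpos)
  qed
  also have "(\<Sum>k\<in>{0..m}. - (f k * ln (f k))) = t"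
  proof -
    have "(\<Sum>k\<in>{0..m}. - (f k * ln (f k))) = - ((1 - \<theta>) * ln (1 - \<theta>)) + real m * - (\<theta> / real m * ln (\<theta> / real m))"
      unfolding split by (simp add: f_def)
    also have "\<dots> = E \<theta>" using \<theta> a m0 by (simp add: E_def ln_div algebra_simps)
    finally show ?thesis using \<theta> by simp
  qed
  finally have "ent (nat_law (embed_pmf f)) floor = ennreal t" .
  then show ?thesis using fle \<theta> a by (intro that[of "embed_pmf f" "1 - \<theta>"]) (auto simp: pmf)
qed

section \<open>The product of a Bernoulli shift and a finite cyclic action\<close>

lemma (in pmp_system) tr_Collect_generated:
  assumes X: "discrete_var M X" and g: "g \<in> carrier G"
  shows "{x \<in> space M. P (tr g X x)} \<in> generated_algebra G M \<phi> (parts M X)"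
proof -
  let ?C = "{A \<in> parts M (tr g X). \<exists>x\<in>A. P (tr g X x)}"
  have "countable ?C" using countable_parts[OF discrete_var_tr[OF X g]] by simp
  moreover have "A \<in> generated_algebra G M \<phi> (parts M X)" if "A \<in> ?C" for A
    unfolding generated_algebra_def using that g by (intro sigma_sets.Basic) (auto simp: translate_parts)
  ultimately have "\<Union>?C \<in> generated_algebra G M \<phi> (parts M X)"
    unfolding generated_algebra_def by (intro sigma_sets_UNION)
  also have "\<Union>?C = {x \<in> space M. P (tr g X x)}" by (auto simp: parts_def)
  finally show ?thesis .
qed

text \<open>The bound q keeps the atoms of the colour law away from 1, which yields essential
  freeness. The colour entropy H0 is the parameter that is adjusted to reach a prescribed f.\<close>

locale bernoulli_model = free_group G S for G :: "'g monoid" (structure) and S :: "'g set" +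
  fixes p :: "nat pmf" and N :: nat and q H0 :: real
  assumes not_cyclic: "\<not> cyclic_group G" and N_pos: "N > 0"
    and pmf_le: "\<And>k. pmf p k \<le> q" and q_less: "q < 1"
    and ent_p: "ent (nat_law p) floor = ennreal H0" and H0_nonneg: "H0 \<ge> 0"
begin

text \<open>Coordinate \<open>0\<close> carries the phase in \<open>\<int>/N\<close>, coordinate \<open>Suc k\<close> the colour at the \<open>k\<close>-th group element.\<close>

definition law :: "nat \<Rightarrow> real measure" where
  "law i = (case i of 0 \<Rightarrow> nat_law (pmf_of_set {..<N}) | Suc _ \<Rightarrow> nat_law p)"

definition \<mu> :: "(nat \<Rightarrow> real) measure" where
  "\<mu> = PiM UNIV law"

definition idx :: "'g \<Rightarrow> nat" where
  "idx = to_nat_on (carrier G)"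

definition el :: "nat \<Rightarrow> 'g" where
  "el = from_nat_into (carrier G)"

text \<open>The phase turns by the exponent of g and the colours undergo the left shift (g x)(k) =
  x(inv g k). As the rotation is a bijection of all reals, \<open>act g\<close> is a bijection of
  the whole sequence space.\<close>

definition act :: "'g \<Rightarrow> (nat \<Rightarrow> real) \<Rightarrow> nat \<Rightarrow> real" where
  "act g x = (\<lambda>i. case i of 0 \<Rightarrow> rot (int N) (exponent g) (x 0) | Suc k \<Rightarrow> x (Suc (idx (inv g \<otimes> el k))))"

definition site :: "'g option \<Rightarrow> nat" where
  "site a = (case a of None \<Rightarrow> 0 | Some g \<Rightarrow> Suc (idx g))"

definition phase :: "(nat \<Rightarrow> real) \<Rightarrow> int" where
  "phase x = \<lfloor>x 0\<rfloor>"

text \<open>The generating variable: the phase together with the colour at the identity. Its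
  translate by g reads the colour at g.\<close>

definition label :: "(nat \<Rightarrow> real) \<Rightarrow> int \<times> int" where
  "label x = (phase x, \<lfloor>x (Suc (idx \<one>))\<rfloor>)"

lemma law_simps [simp]: "law 0 = nat_law (pmf_of_set {..<N})" "law (Suc k) = nat_law p"
  by (simp_all add: law_def)

lemma prob_space_law: "prob_space (law i)"
  by (cases i) (simp_all add: prob_space_nat_law)

lemma discrete_var_law: "discrete_var (law i) (floor :: real \<Rightarrow> int)"
  by (cases i) (simp_all add: discrete_var_nat_law)

lemma space_law [simp]: "space (law i) = UNIV"
  and sets_law [simp]: "sets (law i) = sets borel"
  by (cases i; simp)+

lemma space_\<mu> [simp]: "space \<mu> = UNIV"
  by (simp add: \<mu>_def space_PiM PiE_UNIV_domain)

lemma sets_\<mu>: "sets \<mu> = sets borel"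
proof -
  have "sets \<mu> = sets (PiM UNIV (\<lambda>_. borel :: real measure))"
    unfolding \<mu>_def by (intro sets_PiM_cong) simp_all
  then show ?thesis by (simp add: sets_PiM_equal_borel)
qed

lemma prob_space_\<mu>: "prob_space \<mu>"
  unfolding \<mu>_def by (intro prob_space_PiM prob_space_law)

lemma infinite_carrier: "infinite (carrier G)"
  using infinite_exponent_kernel[OF not_cyclic, of 1] by (simp add: finite_subset)

lemma el_closed [simp]: "el k \<in> carrier G"
  unfolding el_def using infinite_carrier by (intro from_nat_into) auto

lemma el_idx [simp]: "g \<in> carrier G \<Longrightarrow> el (idx g) = g"
  unfolding el_def idx_def by (intro from_nat_into_to_nat_on countable_carrier)

lemma idx_el [simp]: "idx (el k) = k"
  unfolding el_def idx_def by (intro to_nat_on_from_nat_into_infinite countable_carrier infinite_carrier)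

lemma idx_eq_iff: "g \<in> carrier G \<Longrightarrow> h \<in> carrier G \<Longrightarrow> idx g = idx h \<longleftrightarrow> g = h"
  by (metis el_idx)

section \<open>The action and its invariant measure\<close>

lemma act_act:
  assumes "g \<in> carrier G" "h \<in> carrier G"
  shows "act g (act h x) = act (g \<otimes> h) x"
proof
  fix i show "act g (act h x) i = act (g \<otimes> h) x i"
    using assms by (cases i) (simp_all add: act_def rot_rot exponent_mult inv_mult_group m_assoc)
qed

lemma act_one_eq: "act \<one> x = x"
proof
  fix i show "act \<one> x i = x i" by (cases i) (simp_all add: act_def exponent_one rot_0)
qed

lemma bij_act: "g \<in> carrier G \<Longrightarrow> bij (act g)"
  by (rule o_bij[where g = "act (inv g)"]) (auto simp: fun_eq_iff act_act act_one_eq)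

lemma act_preserves:
  assumes g: "g \<in> carrier G"
  shows "act g \<in> measurable \<mu> \<mu>" "distr \<mu> \<mu> (act g) = \<mu>"
proof -
  define \<pi> where "\<pi> i = (case i of 0 \<Rightarrow> 0 | Suc k \<Rightarrow> Suc (idx (inv g \<otimes> el k)))" for i
  define T where "T i = (case i of 0 \<Rightarrow> rot (int N) (exponent g) | Suc k \<Rightarrow> (\<lambda>y. y))" for i :: nat
  have act: "act g = (\<lambda>x i. T i (x (\<pi> i)))"
    by (auto simp: fun_eq_iff act_def T_def \<pi>_def split: nat.split)
  have inj: "inj \<pi>"
  proof (rule injI)
    fix i j assume eq: "\<pi> i = \<pi> j"
    show "i = j"
    proof (cases i; cases j)
      fix k l assume ij: "i = Suc k" "j = Suc l"
      then have "inv g \<otimes> el k = inv g \<otimes> el l"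
        using eq g idx_eq_iff[of "inv g \<otimes> el k" "inv g \<otimes> el l"] by (simp add: \<pi>_def)
      then have "el k = el l" using g by simp
      then show "i = j" using ij by (metis idx_el)
    qed (use eq in \<open>auto simp: \<pi>_def\<close>)
  qed
  have law_\<pi>: "law (\<pi> i) = law i" for i by (cases i) (simp_all add: \<pi>_def)
  have T: "T i \<in> measurable (law (\<pi> i)) (law i)" for i
    unfolding law_\<pi> by (cases i) (simp_all add: T_def cong: measurable_cong_sets)
  have D: "distr (law (\<pi> i)) (law i) (T i) = law i" for i
    unfolding law_\<pi> using N_pos by (cases i) (simp_all add: T_def distr_rot_uniform distr_id)
  show "act g \<in> measurable \<mu> \<mu>" "distr \<mu> \<mu> (act g) = \<mu>"
    unfolding act \<mu>_def by (intro distr_PiM_twist prob_space_law inj T D)+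
qed

lemma group_action_act: "group_action G (space \<mu>) act"
proof -
  have Bij: "act g \<in> Bij UNIV" if "g \<in> carrier G" for g
    using bij_act[OF that] by (simp add: Bij_def)
  have "act \<in> hom G (BijGroup UNIV)"
  proof (rule homI)
    fix g h assume gh: "g \<in> carrier G" "h \<in> carrier G"
    then show "act (g \<otimes> h) = act g \<otimes>\<^bsub>BijGroup UNIV\<^esub> act h"
      using Bij by (simp add: BijGroup_def compose_def fun_eq_iff act_act)
  qed (use Bij in \<open>simp add: BijGroup_def\<close>)
  then show ?thesis
    by (simp add: group_action_def group_hom_def group_hom_axioms_def group_BijGroup group_axioms)
qed

lemma pmp_action_act: "pmp_action G \<mu> act"
  unfolding pmp_action_def using prob_space_\<mu> group_action_act act_preserves by blast

sublocale free_pmp_system G S \<mu> act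
  by (intro free_pmp_system.intro pmp_system.intro pmp_system_axioms.intro
      free_group_axioms generated_group_axioms prob_space_\<mu> pmp_action_act)

lemma standard_\<mu>: "standard_probability_space \<mu>"
  unfolding standard_probability_space_def using prob_space_\<mu> by (simp add: sets_\<mu>)

section \<open>Entropies of phases and labels\<close>

lemma tr_phase: "tr g phase x = \<lfloor>rot (int N) (exponent (inv g)) (x 0)\<rfloor>"
  by (simp add: tr_def phase_def act_def)

lemma tr_phase_eq_iff: "tr g phase x = tr g phase y \<longleftrightarrow> phase x = phase y"
  by (simp add: tr_phase floor_rot_eq_iff phase_def)

lemma tr_label:
  "g \<in> carrier G \<Longrightarrow> tr g label x = (tr g phase x, \<lfloor>x (Suc (idx g))\<rfloor>)"
  by (simp add: tr_def label_def act_def)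

text \<open>The independent coordinates behind the join of labels over W: a single phase and one
  colour for each element of W.\<close>

definition sites :: "'g set \<Rightarrow> (nat \<Rightarrow> real) \<Rightarrow> 'g option \<Rightarrow> int" where
  "sites W = coords floor site (insert None (Some ` W))"

lemma sites_eq_iff:
  "sites W x = sites W y \<longleftrightarrow> phase x = phase y \<and> (\<forall>g\<in>W. \<lfloor>x (Suc (idx g))\<rfloor> = \<lfloor>y (Suc (idx g))\<rfloor>)"
  by (simp add: sites_def coords_eq_iff site_def phase_def)

lemma inj_site: "W \<subseteq> carrier G \<Longrightarrow> inj_on site (insert None (Some ` W))"
  by (auto simp: inj_on_def site_def idx_eq_iff subset_iff split: option.splits)

lemma ent_sites:
  assumes "finite W" "W \<subseteq> carrier G"
  shows "discrete_var \<mu> (sites W)" "ent \<mu> (sites W) = ennreal (ln (real N) + real (card W) * H0)"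
proof -
  let ?K = "insert None (Some ` W)"
  have K: "finite ?K" using assms(1) by simp
  show "discrete_var \<mu> (sites W)"
    unfolding \<mu>_def sites_def by (intro discrete_var_coords prob_space_law discrete_var_law K)
  have "ent \<mu> (sites W) = (\<Sum>k\<in>?K. ent (law (site k)) floor)"
    unfolding \<mu>_def sites_def by (intro ent_coords prob_space_law discrete_var_law K inj_site assms)
  also have "\<dots> = ent (law 0) floor + (\<Sum>g\<in>W. ent (nat_law p) floor)"
    using assms(1) by (simp add: sum.reindex site_def)
  also have "\<dots> = ennreal (ln (real N)) + (\<Sum>g\<in>W. ennreal H0)"
    using N_pos by (simp add: ent_nat_law_uniform ent_p)
  also have "\<dots> = ennreal (ln (real N)) + ennreal (real (card W) * H0)"
    using H0_nonneg by (simp add: ennreal_mult ennreal_of_nat_eq_real_of_nat)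
  also have "\<dots> = ennreal (ln (real N) + real (card W) * H0)"
    using N_pos H0_nonneg by (simp add: ennreal_plus)
  finally show "ent \<mu> (sites W) = ennreal (ln (real N) + real (card W) * H0)" .
qed

lemma sites_finite_entropy:
  assumes "finite W" "W \<subseteq> carrier G"
  shows "fin_ent \<mu> (sites W)" "Hr \<mu> (sites W) = ln (real N) + real (card W) * H0"
proof -
  have "0 \<le> ln (real N) + real (card W) * H0" using N_pos H0_nonneg by simp
  then show "fin_ent \<mu> (sites W)" "Hr \<mu> (sites W) = ln (real N) + real (card W) * H0"
    using ent_sites[OF assms] by (simp_all add: fin_ent_def Hr_def del: ennreal_plus)
qed

lemma label_determines_phase: "determines \<mu> label phase"
  by (simp add: determines_def label_def)

lemma fin_ent_label: "fin_ent \<mu> label"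
proof (rule fin_ent_determined[OF sites_finite_entropy(1)[of "{\<one>}"]])
  show "determines \<mu> (sites {\<one>}) label" by (rule determinesI) (simp add: sites_eq_iff label_def)
qed auto

lemma Hr_phase: "Hr \<mu> phase = ln (real N)"
proof -
  have "Hr \<mu> phase = Hr \<mu> (sites {})"
    by (intro Hr_cong sites_finite_entropy determinesI) (simp_all add: sites_eq_iff)
  then show ?thesis using sites_finite_entropy(2)[of "{}"] by simp
qed

text \<open>Every translate of the label shows the phase, rotated by a known amount. The phase is
  therefore counted only once, and a nonempty W makes it visible.\<close>

lemma Hr_orb_label:
  assumes W: "finite W" "W \<noteq> {}" "W \<subseteq> carrier G"
  shows "Hr \<mu> (orb W label) = ln (real N) + real (card W) * H0"
proof -
  have "orb W label x = orb W label y \<longleftrightarrow> sites W x = sites W y" for x y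
    using W(2,3) by (auto simp: orb_eq_iff sites_eq_iff tr_label tr_phase_eq_iff subset_iff)
  then have "Hr \<mu> (orb W label) = Hr \<mu> (sites W)"
    by (intro Hr_cong sites_finite_entropy W determinesI) simp_all
  then show ?thesis using sites_finite_entropy(2)[OF W(1,3)] by simp
qed

lemma f_inf_label: "f_inf label = ereal ((1 - real (card S)) * ln (real N) + H0)"
  by (intro f_inf_if_entropies_additive fin_ent_label Hr_orb_label)

lemma AE_floor_coordinate: "AE x in \<mu>. real_of_int \<lfloor>x i\<rfloor> = x i"
proof -
  have "AE y in law i. real_of_int \<lfloor>y\<rfloor> = y" by (cases i) (simp_all only: law_simps AE_nat_law_floor)
  then show ?thesis
    unfolding \<mu>_def
    by (intro AE_PiM_component[of UNIV law i "\<lambda>y. real_of_int \<lfloor>y\<rfloor> = y"] prob_space_law) simp_all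
qed

text \<open>Each coordinate is almost surely an integer, so it can be replaced by its floor. The
  sets agreeing almost everywhere with a member of the generated algebra contain the events on
  single coordinates and form a sigma-algebra.\<close>

lemma generating_label: "generating_partition G \<mu> act (parts \<mu> label)"
proof -
  let ?G = "generated_algebra G \<mu> act (parts \<mu> label)"
  note dl = fin_ent_discrete[OF fin_ent_label]
  have coord: "{x. P \<lfloor>x i\<rfloor>} \<in> ?G" for P i
  proof (cases i)
    case 0
    have "{x \<in> space \<mu>. P (fst (tr \<one> label x))} \<in> ?G" by (intro tr_Collect_generated dl one_closed)
    then show ?thesis using 0 by (simp add: tr_label tr_phase exponent_one rot_0)
  next
    case (Suc k)
    have "{x \<in> space \<mu>. P (snd (tr (el k) label x))} \<in> ?G" by (intro tr_Collect_generated dl el_closed)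
    then show ?thesis using Suc by (simp add: tr_label)
  qed
  have "\<exists>B'\<in>?G. AE x in \<mu>. x \<in> B \<longleftrightarrow> x \<in> B'"
    if "B \<in> sigma_sets UNIV {{f. f i \<in> A} | i A. A \<in> sets (borel :: real measure)}" for B
    using that
  proof induction
    case (Basic B)
    then obtain i A where B: "B = {f. f i \<in> A}" by blast
    have "AE x in \<mu>. x \<in> B \<longleftrightarrow> x \<in> {x. real_of_int \<lfloor>x i\<rfloor> \<in> A}"
      using AE_floor_coordinate[of i] by eventually_elim (simp only: B mem_Collect_eq)
    then show ?case using coord[of "\<lambda>c. real_of_int c \<in> A" i] by (rule rev_bexI[rotated])
  next
    case Empty
    then show ?case unfolding generated_algebra_def using sigma_sets.Empty by (intro bexI[of _ "{}"]) auto
  next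
    case (Compl B)
    then obtain B' where B': "B' \<in> ?G" "AE x in \<mu>. x \<in> B \<longleftrightarrow> x \<in> B'" by blast
    have "space \<mu> - B' \<in> ?G" using B'(1) unfolding generated_algebra_def by (rule sigma_sets.Compl)
    moreover have "AE x in \<mu>. x \<in> UNIV - B \<longleftrightarrow> x \<in> space \<mu> - B'"
      using B'(2) by eventually_elim simp
    ultimately show ?case by blast
  next
    case (Union B)
    then have "\<forall>n. \<exists>B'. B' \<in> ?G \<and> (AE x in \<mu>. x \<in> B n \<longleftrightarrow> x \<in> B')" by blast
    from choice[OF this] obtain B' where "\<forall>n. B' n \<in> ?G \<and> (AE x in \<mu>. x \<in> B n \<longleftrightarrow> x \<in> B' n)" ..
    then have B': "B' n \<in> ?G" "AE x in \<mu>. x \<in> B n \<longleftrightarrow> x \<in> B' n" for n by blast+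
    have "(\<Union>n. B' n) \<in> ?G" using B'(1) unfolding generated_algebra_def by (rule sigma_sets.Union)
    moreover have "AE x in \<mu>. \<forall>n. x \<in> B n \<longleftrightarrow> x \<in> B' n" using B'(2) by (simp add: AE_all_countable)
    then have "AE x in \<mu>. x \<in> (\<Union>n. B n) \<longleftrightarrow> x \<in> (\<Union>n. B' n)" by eventually_elim simp
    ultimately show ?case by blast
  qed
  moreover have "sets \<mu> = sigma_sets UNIV {{f. f i \<in> A} | i A. A \<in> sets (borel :: real measure)}"
    unfolding \<mu>_def sets_PiM_single by (simp add: PiE_UNIV_domain)
  ultimately have AE: "\<exists>B'\<in>?G. AE x in \<mu>. x \<in> B \<longleftrightarrow> x \<in> B'" if "B \<in> sets \<mu>" for B
    using that by blast
  have "?G \<subseteq> sets \<mu>"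
    unfolding generated_algebra_def
  proof (rule sets.sigma_sets_subset, rule UN_least)
    fix g assume g: "g \<in> carrier G"
    show "translate_partition act g (parts \<mu> label) \<subseteq> sets \<mu>"
      using measurable_partition_parts[OF discrete_var_tr[OF dl g]]
      by (simp add: translate_parts[OF g] measurable_partition_def)
  qed
  then have "\<exists>B'\<in>?G. measure \<mu> (sym_diff B B') = 0" if B: "B \<in> sets \<mu>" for B
  proof -
    obtain B' where B': "B' \<in> ?G" "AE x in \<mu>. x \<in> B \<longleftrightarrow> x \<in> B'" using AE[OF B] by blast
    have "AE x in \<mu>. x \<notin> sym_diff B B'" using B'(2) by eventually_elim auto
    moreover have "sym_diff B B' \<in> sets \<mu>" using B B' \<open>?G \<subseteq> sets \<mu>\<close> by blast
    ultimately show ?thesis using B'(1) prob_eq_0 by blast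
  qed
  then show ?thesis
    unfolding generating_partition_def using measurable_partition_parts[OF dl] by blast
qed

lemma f_defined_\<mu>: "f_defined G \<mu> act"
  unfolding f_defined_def using generating_label shannon_entropy_parts[OF fin_ent_discrete[OF fin_ent_label]] fin_ent_label
  by (intro exI[of _ "parts \<mu> label"]) (simp add: fin_ent_def)

lemma f_invariant_entropy_\<mu>:
  "f_invariant_entropy G S \<mu> act = ereal ((1 - real (card S)) * ln (real N) + H0)"
  unfolding f_invariant_entropy_def
proof (rule the_equality)
  show val: "\<forall>\<alpha>. generating_partition G \<mu> act \<alpha> \<and> countable \<alpha> \<and> shannon_entropy \<mu> \<alpha> < \<infinity> \<longrightarrow>
      f_partition G S \<mu> act \<alpha> = ereal ((1 - real (card S)) * ln (real N) + H0)"
    using f_partition_generating[OF _ _ _ generating_label fin_ent_label] f_inf_label by simp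
  fix v assume "\<forall>\<alpha>. generating_partition G \<mu> act \<alpha> \<and> countable \<alpha> \<and> shannon_entropy \<mu> \<alpha> < \<infinity> \<longrightarrow>
      f_partition G S \<mu> act \<alpha> = v"
  \<comment> \<open>Uniqueness in the definite description rests on the existence of one partition
    satisfying the premises; otherwise every v would qualify.\<close>
  moreover have "generating_partition G \<mu> act (parts \<mu> label)" "countable (parts \<mu> label)"
      "shannon_entropy \<mu> (parts \<mu> label) < \<infinity>"
    using generating_label countable_parts[OF fin_ent_discrete[OF fin_ent_label]] shannon_entropy_parts[OF fin_ent_discrete[OF fin_ent_label]] fin_ent_label
    by (simp_all add: fin_ent_def)
  ultimately show "v = ereal ((1 - real (card S)) * ln (real N) + H0)" using val by metis
qed

text \<open>The invariant variable is the phase, of entropy ln N. The gain (r - 1) ln N cancels the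
  loss in f, so exactly the colour entropy remains.\<close>

lemma shannon_entropy_ge_H0:
  assumes "generating_partition G \<mu> act \<alpha>"
  shows "ennreal H0 \<le> shannon_entropy \<mu> \<alpha>"
proof -
  have phase: "fin_ent \<mu> phase" by (rule fin_ent_determined[OF fin_ent_label label_determines_phase])
  have "ennreal (((1 - real (card S)) * ln (real N) + H0) + (real (card S) - 1) * Hr \<mu> phase) \<le> shannon_entropy \<mu> \<alpha>"
    by (intro shannon_entropy_ge[OF assms generating_label fin_ent_label f_inf_label phase] determinesI)
      (simp_all add: tr_phase_eq_iff)
  then show ?thesis by (simp add: Hr_phase algebra_simps)
qed

section \<open>Ergodicity and essential freeness of the model\<close>

lemma ergodic_\<mu>: "ergodic_action G \<mu> act"
proof (rule ergodic_if_entropies_additive[OF fin_ent_label generates_parts[OF generating_label fin_ent_label]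
      label_determines_phase])
  show "Hr \<mu> (orb W label) = Hr \<mu> phase + real (card W) * H0"
    if "finite W" "W \<noteq> {}" "W \<subseteq> carrier G" for W
    using Hr_orb_label[OF that] by (simp add: Hr_phase)
  show "\<exists>g\<in>carrier G. (\<lambda>h. g \<otimes> h) ` W \<inter> W = {} \<and> (\<forall>x\<in>space \<mu>. tr g phase x = phase x)"
    if W: "finite W" "W \<subseteq> carrier G" for W
  proof -
    \<comment> \<open>D consists of the g for which g W meets W. It is finite, so an element of the
      infinite kernel of the exponent modulo N avoids it and fixes the phase at the same
      time.\<close>
    define D where "D = (\<lambda>(a, b). a \<otimes> inv b) ` (W \<times> W)"
    have "finite D" using W by (simp add: D_def)
    moreover have "infinite {g \<in> carrier G. exponent g mod int N = 0}"
      using infinite_exponent_kernel[OF not_cyclic] N_pos by simp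
    ultimately have "{g \<in> carrier G. exponent g mod int N = 0} - D \<noteq> {}"
      using Diff_infinite_finite infinite_imp_nonempty by blast
    then obtain g where "g \<in> {g \<in> carrier G. exponent g mod int N = 0} - D"
      unfolding ex_in_conv[symmetric] ..
    then have g: "g \<in> carrier G" "exponent g mod int N = 0" "g \<notin> D" by simp_all
    have "(\<lambda>h. g \<otimes> h) ` W \<inter> W = {}"
    proof (rule ccontr)
      assume "(\<lambda>h. g \<otimes> h) ` W \<inter> W \<noteq> {}"
      then obtain b where b: "b \<in> W" "g \<otimes> b \<in> W" by auto
      then have "b \<in> carrier G" using W by auto
      then have "g = (g \<otimes> b) \<otimes> inv b" using g(1) by (simp add: m_assoc)
      moreover have "(g \<otimes> b) \<otimes> inv b \<in> D" using b by (auto simp: D_def)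
      ultimately show False using g(3) by simp
    qed
    moreover have "tr g phase x = phase x" for x
    proof -
      have "exponent (inv g) mod int N = 0" using g by (simp add: exponent_inv mod_0_imp_dvd)
      then show ?thesis by (simp add: tr_phase rot_0 phase_def)
    qed
    ultimately show ?thesis using g(1) by blast
  qed
  fix c d assume cd: "fiber_prob \<mu> phase c > 0" "fiber_prob \<mu> phase d > 0"
  \<comment> \<open>Only the phases 0, ..., N - 1 carry mass; the rotation is transitive on these
    and not on all integers.\<close>
  have range: "0 \<le> c \<and> c < int N" if "fiber_prob \<mu> phase c > 0" for c
  proof -
    have "fiber_prob \<mu> phase c = fiber_prob (law 0) floor c"
    proof -
      have "fiber_prob \<mu> phase c = fiber_prob \<mu> (coords floor (\<lambda>_. 0) {()}) (\<lambda>_\<in>{()}. c)"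
        unfolding fiber_prob_def by (intro arg_cong[where f = "measure \<mu>"]) (auto simp: coords_def phase_def fun_eq_iff)
      also have "\<dots> = fiber_prob (law 0) floor c"
        unfolding \<mu>_def by (subst fiber_prob_coords[OF prob_space_law discrete_var_law]) auto
      finally show ?thesis .
    qed
    moreover have "{..<N} \<noteq> {}" using N_pos by auto
    ultimately show ?thesis using that
      by (auto simp: fiber_prob_nat_law indicator_def nat_less_iff split: if_splits)
  qed
  obtain s where s: "s \<in> S" using not_cyclic card_generators_ge_2 by (metis card.empty ex_in_conv not_numeral_le_zero)
  then have sc: "s \<in> carrier G" using S_closed by auto
  have "phase (act (s [^] (d - c)) x) = d \<longleftrightarrow> phase x = c" for x
    using range[OF cd(1)] range[OF cd(2)] sc s
    by (simp add: phase_def act_def exponent_pow exponent_generator floor_rot_transitive)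
  then show "\<exists>g\<in>carrier G. \<forall>x\<in>space \<mu>. (phase (act g x) = d) = (phase x = c)"
    using sc by (intro bexI[of _ "s [^] (d - c)"]) auto
qed

text \<open>Greedy choice: a new element k is taken outside W, g W and inv g W. This excludes every
  new coincidence, as g k = k is impossible.\<close>

lemma ex_disjoint_window:
  assumes g: "g \<in> carrier G" "g \<noteq> \<one>"
  shows "\<exists>W\<subseteq>carrier G. finite W \<and> card W = m \<and> W \<inter> (\<lambda>h. g \<otimes> h) ` W = {}"
proof (induction m)
  case 0
  show ?case by (intro exI[of _ "{}"]) simp
next
  case (Suc m)
  then obtain W where W: "W \<subseteq> carrier G" "finite W" "card W = m" "W \<inter> (\<lambda>h. g \<otimes> h) ` W = {}" by blast
  have "finite (W \<union> (\<lambda>h. g \<otimes> h) ` W \<union> (\<lambda>h. inv g \<otimes> h) ` W)" using W by simp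
  then obtain k where k: "k \<in> carrier G" "k \<notin> W" "k \<notin> (\<lambda>h. g \<otimes> h) ` W" "k \<notin> (\<lambda>h. inv g \<otimes> h) ` W"
    using infinite_carrier by (metis UnCI ex_new_if_finite finite_subset subsetI)
  have "g \<otimes> k \<noteq> k" using g k(1) by simp
  moreover have "g \<otimes> k \<notin> W"
  proof
    assume "g \<otimes> k \<in> W"
    moreover have "k = inv g \<otimes> (g \<otimes> k)" using g k(1) by (simp flip: m_assoc)
    ultimately show False using k(4) by blast
  qed
  ultimately have "insert k W \<inter> (\<lambda>h. g \<otimes> h) ` insert k W = {}" using W(4) k by auto
  then show ?case using W k by (intro exI[of _ "insert k W"]) auto
qed

text \<open>A fixed point has equal colours at h and at inv g h for every h. Over a window of size m
  disjoint from its translate the two readings are independent, so they agree with probability at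
  most q^m. The fixed points are enclosed in measurable sets of such probabilities.\<close>

lemma AE_act_neq:
  assumes g: "g \<in> carrier G" "g \<noteq> \<one>"
  shows "AE x in \<mu>. act g x \<noteq> x"
proof -
  have "\<exists>Z\<in>sets \<mu>. {x. act g x = x} \<subseteq> Z \<and> prob Z \<le> q ^ m" for m
  proof -
    have ig: "inv g \<in> carrier G" "inv g \<noteq> \<one>" using g by auto
    obtain W where W: "W \<subseteq> carrier G" "finite W" "card W = m" "W \<inter> (\<lambda>h. inv g \<otimes> h) ` W = {}"
      using ex_disjoint_window[OF ig, of m] by blast
    let ?a = "\<lambda>h. Suc (idx h)" and ?b = "\<lambda>h. Suc (idx (inv g \<otimes> h))"
    let ?A = "coords floor ?a W :: (nat \<Rightarrow> real) \<Rightarrow> 'g \<Rightarrow> int"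
    let ?B = "coords floor ?b W :: (nat \<Rightarrow> real) \<Rightarrow> 'g \<Rightarrow> int"
    note law = prob_space_law discrete_var_law
    have inj: "inj_on ?a W" "inj_on ?b W"
      using W(1) ig by (auto simp: inj_on_def idx_eq_iff subset_iff)
    have disj: "?a ` W \<inter> ?b ` W = {}"
    proof -
      have "idx h \<noteq> idx (inv g \<otimes> k)" if "h \<in> W" "k \<in> W" for h k
      proof
        assume "idx h = idx (inv g \<otimes> k)"
        then have "h = inv g \<otimes> k" using that W(1) ig idx_eq_iff[of h "inv g \<otimes> k"] by auto
        then show False using W(4) that by auto
      qed
      then show ?thesis by auto
    qed
    have d: "discrete_var \<mu> ?A" "discrete_var \<mu> ?B"
      unfolding \<mu>_def by (intro discrete_var_coords law W)+
    have "fiber_prob \<mu> ?B c \<le> q ^ m" for c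
    proof (cases "c \<in> extensional W")
      case True
      have "fiber_prob \<mu> ?B c = (\<Prod>k\<in>W. fiber_prob (nat_law p) floor (c k))"
        unfolding \<mu>_def by (subst fiber_prob_coords[OF law W(2) inj(2) True]) simp
      also have "\<dots> \<le> (\<Prod>k\<in>W. q)"
        using pmf_le order_trans[OF pmf_nonneg pmf_le] by (intro prod_mono) (auto simp: fiber_prob_nat_law)
      finally show ?thesis using W(3) by simp
    next
      case False
      then have "fiber_prob \<mu> ?B c = 0" by (simp add: fiber_prob_def coords_eq_ext_iff)
      then show ?thesis using order_trans[OF pmf_nonneg pmf_le] by simp
    qed
    then have "prob {x \<in> space \<mu>. ?A x = ?B x} \<le> q ^ m"
      by (intro prob_eq_le_if_indep d) (simp_all add: \<mu>_def fiber_prob_coords_Pair[OF law W(2) inj disj])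
    moreover have "{x \<in> space \<mu>. ?A x = ?B x} \<in> sets \<mu>"
      using discrete_var_Collect[OF discrete_var_Pair[OF d], of "\<lambda>j. fst j = snd j"] by simp
    moreover have "{x. act g x = x} \<subseteq> {x \<in> space \<mu>. ?A x = ?B x}"
    proof safe
      fix x assume x: "act g x = x"
      have "x (?a h) = x (?b h)" if "h \<in> W" for h
      proof -
        have "h \<in> carrier G" using that W(1) by auto
        then have "act g x (?a h) = x (?b h)" by (simp add: act_def)
        then show ?thesis unfolding x .
      qed
      then show "?A x = ?B x" by (simp add: coords_eq_iff)
    qed simp
    ultimately show ?thesis by blast
  qed
  then have "\<forall>m. \<exists>Z. Z \<in> sets \<mu> \<and> {x. act g x = x} \<subseteq> Z \<and> prob Z \<le> q ^ m" by blast
  from choice[OF this] obtain Z where "\<forall>m. Z m \<in> sets \<mu> \<and> {x. act g x = x} \<subseteq> Z m \<and> prob (Z m) \<le> q ^ m" ..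
  then have Z: "\<And>m. Z m \<in> sets \<mu>" "\<And>m. {x. act g x = x} \<subseteq> Z m" "\<And>m. prob (Z m) \<le> q ^ m"
    by auto
  have "prob (\<Inter>m. Z m) \<le> q ^ m" for m
    using finite_measure_mono[of "\<Inter>m. Z m" "Z m"] Z(1,3)[of m] by (meson INT_lower UNIV_I order_trans)
  moreover have "(\<lambda>m. q ^ m) \<longlonglongrightarrow> 0"
    using order_trans[OF pmf_nonneg pmf_le] q_less by (intro LIMSEQ_realpow_zero) auto
  ultimately have "prob (\<Inter>m. Z m) \<le> 0" using LIMSEQ_le_const by blast
  then have "prob (\<Inter>m. Z m) = 0" by (simp add: measure_le_0_iff)
  moreover have "(\<Inter>m. Z m) \<in> sets \<mu>" using Z(1) by auto
  ultimately have "AE x in \<mu>. x \<notin> (\<Inter>m. Z m)" using prob_eq_0 by blast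
  then show ?thesis using Z(2) by (auto elim!: eventually_mono)
qed

lemma essentially_free_\<mu>: "essentially_free G \<mu> act"
proof -
  have "AE x in \<mu>. \<forall>g\<in>carrier G - {\<one>}. act g x \<noteq> x"
    using AE_act_neq countable_carrier by (subst AE_ball_countable) auto
  then show ?thesis
    unfolding essentially_free_def
    by eventually_elim (auto simp: stabilizer_def act_one_eq)
qed

lemma in_actions:
  assumes "h = (1 - real (card S)) * ln (real N) + H0"
  shows "(\<mu>, act) \<in> free_ergodic_actions_of_f_entropy G S h"
  unfolding free_ergodic_actions_of_f_entropy_def
  using standard_\<mu> pmp_action_act essentially_free_\<mu> ergodic_\<mu> f_defined_\<mu> f_invariant_entropy_\<mu> assms
  by simp

end

section \<open>Unbounded entropy at a fixed f-invariant\<close>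

lemma ex_action_large_entropy:
  fixes G :: "'g monoid" and S :: "'g set" and h c :: real
  assumes "group G" "free_generating_set G S" "finite S" "\<not> cyclic_group G"
  obtains M :: "(nat \<Rightarrow> real) measure" and \<phi> where
    "(M, \<phi>) \<in> free_ergodic_actions_of_f_entropy G S h"
    "\<And>\<alpha>. generating_partition G M \<phi> \<alpha> \<Longrightarrow> ennreal c \<le> shannon_entropy M \<alpha>"
proof -
  interpret group G by fact
  interpret free_group G S
    using assms free_generating_set_carrier_words[OF assms(2)] by unfold_locales
  define r where "r = real (card S)"
  have r: "r \<ge> 2" using card_generators_ge_2[OF assms(4)] by (simp add: r_def)
  \<comment> \<open>The term |h| makes H0 = h + (r - 1) ln N at least max c 1 whatever the sign of
    h; the 1 keeps H0 positive, as the construction of the colour law requires.\<close>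
  define b where "b = max c 1 + \<bar>h\<bar>"
  define N where "N = nat \<lceil>exp b\<rceil>"
  have N: "exp b \<le> real N" by (simp add: N_def)
  then have N_pos: "N > 0" by (metis exp_gt_zero gr0I not_less of_nat_0)
  then have "b \<le> ln (real N)" using N by (simp add: ln_ge_iff)
  also have "\<dots> \<le> (r - 1) * ln (real N)" using r N_pos by (simp add: mult_le_cancel_right1)
  finally have b: "b \<le> (r - 1) * ln (real N)" .
  define H0 where "H0 = h + (r - 1) * ln (real N)"
  have H0: "H0 \<ge> max c 1" using b abs_ge_minus_self[of h] unfolding H0_def b_def by linarith
  then have "H0 > 0" by simp
  then obtain p q where p: "\<And>k. pmf p k \<le> q" "q < 1" "ent (nat_law p) floor = ennreal H0"
    using ex_pmf_entropy by blast
  interpret bernoulli_model G S p N q H0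
    by unfold_locales (use assms(4) N_pos p \<open>H0 > 0\<close> in auto)
  have "(\<mu>, act) \<in> free_ergodic_actions_of_f_entropy G S h"
    by (rule in_actions) (simp add: H0_def r_def algebra_simps)
  moreover have "ennreal c \<le> shannon_entropy \<mu> \<alpha>" if "generating_partition G \<mu> act \<alpha>" for \<alpha>
    using shannon_entropy_ge_H0[OF that] H0 by (meson ennreal_leI max.boundedE order_trans)
  ultimately show ?thesis by (rule that)
qed

theorem proposition1p2:
  fixes G :: "'g monoid" and S :: "'g set" and h :: real
  assumes "group G"
    and "free_generating_set G S" and "finite S"
    and "\<not> cyclic_group G"
  shows "(SUP (M :: (nat \<Rightarrow> real) measure, \<phi>) \<in> free_ergodic_actions_of_f_entropy G S h.
            Delta_star G M \<phi>) = \<infinity>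
       \<and> (SUP (M :: (nat \<Rightarrow> real) measure, \<phi>) \<in> free_ergodic_actions_of_f_entropy G S h.
            Delta G M \<phi>) = \<infinity>"
proof
  let ?A = "free_ergodic_actions_of_f_entropy G S h :: ((nat \<Rightarrow> real) measure \<times> _) set"
  let ?D = "SUP (M, \<phi>) \<in> ?A. Delta_star G M \<phi>"
  let ?E = "SUP (M, \<phi>) \<in> ?A. Delta G M \<phi>"
  have "ennreal c \<le> ?D" for c
  proof -
    obtain M :: "(nat \<Rightarrow> real) measure" and \<phi> where M: "(M, \<phi>) \<in> ?A"
        "\<And>\<alpha>. generating_partition G M \<phi> \<alpha> \<Longrightarrow> ennreal c \<le> shannon_entropy M \<alpha>"
      using ex_action_large_entropy[OF assms, of h c] by blast
    have "ennreal c \<le> Delta_star G M \<phi>"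
      unfolding Delta_star_def using M(2) by (intro INF_greatest) auto
    also have "\<dots> \<le> ?D" using SUP_upper[OF M(1), of "\<lambda>(M, \<phi>). Delta_star G M \<phi>"] by simp
    finally show ?thesis .
  qed
  then have "of_nat n \<le> ?D" for n by (metis ennreal_of_nat_eq_real_of_nat)
  then show "?D = \<infinity>"
    by (metis ennreal_Ex_less_of_nat infinity_ennreal_def less_top not_less)
  have "enat n \<le> ?E" for n
  proof -
    obtain M :: "(nat \<Rightarrow> real) measure" and \<phi> where M: "(M, \<phi>) \<in> ?A"
        "\<And>\<alpha>. generating_partition G M \<phi> \<alpha> \<Longrightarrow> ennreal (real n) \<le> shannon_entropy M \<alpha>"
      using ex_action_large_entropy[OF assms, of h "real n"] by blast
    have "prob_space M"
      using M(1) by (simp add: free_ergodic_actions_of_f_entropy_def standard_probability_space_def)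
    then interpret prob_space M .
    have "enat n \<le> Delta G M \<phi>"
      unfolding Delta_def
    proof (rule INF_greatest)
      fix \<alpha> assume "\<alpha> \<in> {\<alpha>. generating_partition G M \<phi> \<alpha> \<and> finite \<alpha>}"
      then have \<alpha>: "generating_partition G M \<phi> \<alpha>" "finite \<alpha>" by auto
      have "ennreal (real n) \<le> of_nat (card \<alpha>)"
        using M(2)[OF \<alpha>(1)] shannon_entropy_le_card[of \<alpha>] \<alpha>
        by (meson generating_partition_def order_trans)
      then show "enat n \<le> enat (card \<alpha>)"
        by (simp add: ennreal_of_nat_eq_real_of_nat[symmetric])
    qed
    also have "\<dots> \<le> ?E" using SUP_upper[OF M(1), of "\<lambda>(M, \<phi>). Delta G M \<phi>"] by simp
    finally show ?thesis .
  qed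
  then show "?E = \<infinity>"
    by (cases ?E) (metis Suc_n_not_le_n enat_ord_simps(1), simp)
qed

end
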